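(* Let $n$ be finite with $n>2$. Any class $\mathsf K$ (of cylindric algebras of dimension $n$) that contains the class of completely representable algebras in $\mathsf{CA}_n$ and is contained in $S_c\mathfrak{Nr}_n\mathsf{CA}_{n+3}$ is not elementary. In particular, the class of completely representable $\mathsf{CA}_n$s is not elementary.
   Context: $\mathsf{CA}_n$ is the class of cylindric algebras of dimension $n$. For $\mathfrak B\in\mathsf{CA}_m$ with $m\ge n$, the neat reduct $\mathfrak{Nr}_n\mathfrak B\in\mathsf{CA}_n$ has universe $\{b\in B:c_ib=b\text{ for all }n\le i<m\}$ and the operations of $\mathfrak B$ with indices $<n$; $\mathfrak{Nr}_n\mathsf{CA}_m=\{\mathfrak{Nr}_n\mathfrak B:\mathfrak B\in\mathsf{CA}_m\}$. $\mathfrak A$ is a strong (complete) subalgebra of $\mathfrak B$ if $\mathfrak A$ is a subalgebra of $\mathfrak B$ and whenever $X\subseteq A$ satisfies $\sum^{\mathfrak A}X=1$, then $\sum^{\mathfrak B}X=1$; $S_c\mathsf L$ is the class of (isomorphic copies of) strong subalgebras of algebras in $\mathsf L$. A complete representation of $\mathfrak A\in\mathsf{CA}_n$ is an injective homomorphism $f:\mathfrak A\to\wp(V)$, where $V$ is a disjoint union of cartesian squares ${}^nU_i$ and $\wp(V)$ carries the concrete set-theoretic cylindric operations, such that $f$ carries arbitrary existing suprema in $\mathfrak A$ to unions. $\mathfrak A$ is completely representable if it has a complete representation. A class is elementary if it is the class of models of a first order theory. *)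

theory Defs
  imports Main "HOL-Library.FuncSet" "HOL-Library.Disjoint_Sets"
begin

text \<open>
  An algebra of the similarity type of cylindric algebras. The dimension is not part of the
  record: in dimension \<open>n\<close> only the operations \<open>cyl A i\<close> and \<open>diag A i j\<close> with \<open>i, j < n\<close>,
  restricted to the carrier, are meaningful, and every notion below ignores the remaining values.
\<close>

record 'a cyl_alg =
  carrier :: "'a set"
  join :: "'a \<Rightarrow> 'a \<Rightarrow> 'a"  (infixl \<open>\<oplus>\<index>\<close> 65)
  meet :: "'a \<Rightarrow> 'a \<Rightarrow> 'a"  (infixl \<open>\<odot>\<index>\<close> 70)
  compl :: "'a \<Rightarrow> 'a"  (\<open>\<ominus>\<index> _\<close> [81] 80)
  zero :: 'a  (\<open>\<zero>\<index>\<close>)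
  one :: 'a  (\<open>\<one>\<index>\<close>)
  cyl :: "nat \<Rightarrow> 'a \<Rightarrow> 'a"
  diag :: "nat \<Rightarrow> nat \<Rightarrow> 'a"

locale cyl_structure =
  fixes n :: nat and A :: "'a cyl_alg" (structure)
  assumes join_closed: "x \<in> carrier A \<Longrightarrow> y \<in> carrier A \<Longrightarrow> x \<oplus> y \<in> carrier A"
    and meet_closed: "x \<in> carrier A \<Longrightarrow> y \<in> carrier A \<Longrightarrow> x \<odot> y \<in> carrier A"
    and compl_closed: "x \<in> carrier A \<Longrightarrow> \<ominus> x \<in> carrier A"
    and zero_closed: "\<zero> \<in> carrier A"
    and one_closed: "\<one> \<in> carrier A"
    and cyl_closed: "i < n \<Longrightarrow> x \<in> carrier A \<Longrightarrow> cyl A i x \<in> carrier A"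
    and diag_closed: "i < n \<Longrightarrow> j < n \<Longrightarrow> diag A i j \<in> carrier A"

text \<open>
  The axioms of Henkin, Monk and Tarski; the Boolean part is given by Huntington's postulates.
  The one-element algebra is included.
\<close>

locale cylindric_algebra = cyl_structure +
  assumes join_comm: "x \<in> carrier A \<Longrightarrow> y \<in> carrier A \<Longrightarrow> x \<oplus> y = y \<oplus> x"
    and meet_comm: "x \<in> carrier A \<Longrightarrow> y \<in> carrier A \<Longrightarrow> x \<odot> y = y \<odot> x"
    and join_meet_distrib: "x \<in> carrier A \<Longrightarrow> y \<in> carrier A \<Longrightarrow> z \<in> carrier A \<Longrightarrow>
      x \<oplus> (y \<odot> z) = (x \<oplus> y) \<odot> (x \<oplus> z)"
    and meet_join_distrib: "x \<in> carrier A \<Longrightarrow> y \<in> carrier A \<Longrightarrow> z \<in> carrier A \<Longrightarrow>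
      x \<odot> (y \<oplus> z) = (x \<odot> y) \<oplus> (x \<odot> z)"
    and join_zero: "x \<in> carrier A \<Longrightarrow> x \<oplus> \<zero> = x"
    and meet_one: "x \<in> carrier A \<Longrightarrow> x \<odot> \<one> = x"
    and join_compl: "x \<in> carrier A \<Longrightarrow> x \<oplus> (\<ominus> x) = \<one>"
    and meet_compl: "x \<in> carrier A \<Longrightarrow> x \<odot> (\<ominus> x) = \<zero>"
    and cyl_zero: "i < n \<Longrightarrow> cyl A i \<zero> = \<zero>"
    and cyl_increasing: "i < n \<Longrightarrow> x \<in> carrier A \<Longrightarrow> x \<oplus> cyl A i x = cyl A i x"
    and cyl_meet_cyl: "i < n \<Longrightarrow> x \<in> carrier A \<Longrightarrow> y \<in> carrier A \<Longrightarrow>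
      cyl A i (x \<odot> cyl A i y) = cyl A i x \<odot> cyl A i y"
    and cyl_commute: "i < n \<Longrightarrow> j < n \<Longrightarrow> x \<in> carrier A \<Longrightarrow>
      cyl A i (cyl A j x) = cyl A j (cyl A i x)"
    and diag_refl: "i < n \<Longrightarrow> diag A i i = \<one>"
    and diag_cyl: "i < n \<Longrightarrow> j < n \<Longrightarrow> k < n \<Longrightarrow> k \<noteq> i \<Longrightarrow> k \<noteq> j \<Longrightarrow>
      diag A i j = cyl A k (diag A i k \<odot> diag A k j)"
    and cyl_diag_compl: "i < n \<Longrightarrow> j < n \<Longrightarrow> i \<noteq> j \<Longrightarrow> x \<in> carrier A \<Longrightarrow>
      cyl A i (diag A i j \<odot> x) \<odot> cyl A i (diag A i j \<odot> (\<ominus> x)) = \<zero>"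

definition CA :: "nat \<Rightarrow> 'a cyl_alg set" where
  "CA n = {A. cylindric_algebra n A}"

definition is_sum :: "'a cyl_alg \<Rightarrow> 'a set \<Rightarrow> 'a \<Rightarrow> bool" where
  "is_sum A X s \<longleftrightarrow> s \<in> carrier A \<and> (\<forall>x\<in>X. x \<oplus>\<^bsub>A\<^esub> s = s) \<and>
     (\<forall>t\<in>carrier A. (\<forall>x\<in>X. x \<oplus>\<^bsub>A\<^esub> t = t) \<longrightarrow> s \<oplus>\<^bsub>A\<^esub> t = t)"

definition cyl_hom :: "nat \<Rightarrow> 'a cyl_alg \<Rightarrow> 'b cyl_alg \<Rightarrow> ('a \<Rightarrow> 'b) set" where
  "cyl_hom n A B = {f. f \<in> carrier A \<rightarrow> carrier B \<and>
     (\<forall>x\<in>carrier A. \<forall>y\<in>carrier A. f (x \<oplus>\<^bsub>A\<^esub> y) = f x \<oplus>\<^bsub>B\<^esub> f y) \<and>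
     (\<forall>x\<in>carrier A. \<forall>y\<in>carrier A. f (x \<odot>\<^bsub>A\<^esub> y) = f x \<odot>\<^bsub>B\<^esub> f y) \<and>
     (\<forall>x\<in>carrier A. f (\<ominus>\<^bsub>A\<^esub> x) = \<ominus>\<^bsub>B\<^esub> f x) \<and>
     f \<zero>\<^bsub>A\<^esub> = \<zero>\<^bsub>B\<^esub> \<and> f \<one>\<^bsub>A\<^esub> = \<one>\<^bsub>B\<^esub> \<and>
     (\<forall>i<n. \<forall>x\<in>carrier A. f (cyl A i x) = cyl B i (f x)) \<and>
     (\<forall>i<n. \<forall>j<n. f (diag A i j) = diag B i j)}"

definition cyl_iso :: "nat \<Rightarrow> 'a cyl_alg \<Rightarrow> 'b cyl_alg \<Rightarrow> ('a \<Rightarrow> 'b) set" where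
  "cyl_iso n A B = {f \<in> cyl_hom n A B. bij_betw f (carrier A) (carrier B)}"

definition subalgebra :: "nat \<Rightarrow> 'a cyl_alg \<Rightarrow> 'a cyl_alg \<Rightarrow> bool" where
  "subalgebra n A B \<longleftrightarrow> cyl_structure n A \<and> carrier A \<subseteq> carrier B \<and> id \<in> cyl_hom n A B"

definition strong_subalgebra :: "nat \<Rightarrow> 'a cyl_alg \<Rightarrow> 'a cyl_alg \<Rightarrow> bool" where
  "strong_subalgebra n A B \<longleftrightarrow> subalgebra n A B \<and>
     (\<forall>X. X \<subseteq> carrier A \<longrightarrow> is_sum A X \<one>\<^bsub>A\<^esub> \<longrightarrow> is_sum B X \<one>\<^bsub>B\<^esub>)"

text \<open>The neat reduct to dimension \<open>n\<close> of an \<open>m\<close>-dimensional algebra (\<open>n \<le> m\<close>).\<close>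

definition Nr :: "nat \<Rightarrow> nat \<Rightarrow> 'a cyl_alg \<Rightarrow> 'a cyl_alg" where
  "Nr n m B = B\<lparr>carrier := {b \<in> carrier B. \<forall>i. n \<le> i \<and> i < m \<longrightarrow> cyl B i b = b}\<rparr>"

definition NrCA :: "nat \<Rightarrow> nat \<Rightarrow> 'a cyl_alg set" where
  "NrCA n m = Nr n m ` CA m"

text \<open>
  The members of \<open>L\<close> have elements in \<open>'b\<close>, their isomorphic copies in \<open>'a\<close>, so the size of
  the algebras in \<open>L\<close> is not bounded by that of \<open>'a\<close>.
\<close>

definition Sc :: "nat \<Rightarrow> 'b cyl_alg set \<Rightarrow> 'a cyl_alg set" where
  "Sc n L = {A. cyl_structure n A \<and>
     (\<exists>B\<in>L. \<exists>A'. strong_subalgebra n A' B \<and> cyl_iso n A A' \<noteq> {})}"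

text \<open>
  The cartesian square \<open>\<^sup>nU\<close>; an \<open>n\<close>-tuple is an extensional function on \<open>{..<n}\<close>.
\<close>

definition square :: "nat \<Rightarrow> 'u set \<Rightarrow> (nat \<Rightarrow> 'u) set" where
  "square n U = ({..<n} \<rightarrow>\<^sub>E U)"

definition full_set_algebra :: "(nat \<Rightarrow> 'u) set \<Rightarrow> (nat \<Rightarrow> 'u) set cyl_alg" where
  "full_set_algebra V = \<lparr>
     carrier = Pow V,
     join = (\<union>),
     meet = (\<inter>),
     compl = (\<lambda>X. V - X),
     zero = {},
     one = V,
     cyl = (\<lambda>i X. {s \<in> V. \<exists>t\<in>X. \<forall>j. j \<noteq> i \<longrightarrow> s j = t j}),
     diag = (\<lambda>i j. {s \<in> V. s i = s j})\<rparr>"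

definition complete_representation ::
  "nat \<Rightarrow> 'a cyl_alg \<Rightarrow> 'u set set \<Rightarrow> ('a \<Rightarrow> (nat \<Rightarrow> 'u) set) \<Rightarrow> bool" where
  "complete_representation n A \<U> f \<longleftrightarrow>
     disjoint \<U> \<and>
     f \<in> cyl_hom n A (full_set_algebra (\<Union>U\<in>\<U>. square n U)) \<and>
     inj_on f (carrier A) \<and>
     (\<forall>X s. X \<subseteq> carrier A \<longrightarrow> is_sum A X s \<longrightarrow> f s = \<Union> (f ` X))"

text \<open>Complete representability on bases whose points are taken from the type \<open>'u\<close>.\<close>

definition CRA :: "nat \<Rightarrow> 'u itself \<Rightarrow> 'a cyl_alg set" where
  "CRA n (_ :: 'u itself) =
     {A \<in> CA n. \<exists>(\<U> :: 'u set set) f. complete_representation n A \<U> f}"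

datatype cyl_term =
    Var nat
  | Join cyl_term cyl_term
  | Meet cyl_term cyl_term
  | Compl cyl_term
  | Zero
  | One
  | Cyl nat cyl_term
  | Diag nat nat

datatype cyl_fm =
    Eq cyl_term cyl_term
  | Neg cyl_fm
  | Conj cyl_fm cyl_fm
  | Ex nat cyl_fm

primrec term_vars :: "cyl_term \<Rightarrow> nat set" where
  "term_vars (Var v) = {v}"
| "term_vars (Join s t) = term_vars s \<union> term_vars t"
| "term_vars (Meet s t) = term_vars s \<union> term_vars t"
| "term_vars (Compl t) = term_vars t"
| "term_vars Zero = {}"
| "term_vars One = {}"
| "term_vars (Cyl i t) = term_vars t"
| "term_vars (Diag i j) = {}"

primrec free_vars :: "cyl_fm \<Rightarrow> nat set" where
  "free_vars (Eq s t) = term_vars s \<union> term_vars t"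
| "free_vars (Neg \<phi>) = free_vars \<phi>"
| "free_vars (Conj \<phi> \<psi>) = free_vars \<phi> \<union> free_vars \<psi>"
| "free_vars (Ex v \<phi>) = free_vars \<phi> - {v}"

text \<open>Membership in the language of dimension \<open>n\<close>: only indices below \<open>n\<close> occur.\<close>

primrec term_lang :: "nat \<Rightarrow> cyl_term \<Rightarrow> bool" where
  "term_lang n (Var v) = True"
| "term_lang n (Join s t) = (term_lang n s \<and> term_lang n t)"
| "term_lang n (Meet s t) = (term_lang n s \<and> term_lang n t)"
| "term_lang n (Compl t) = term_lang n t"
| "term_lang n Zero = True"
| "term_lang n One = True"
| "term_lang n (Cyl i t) = (i < n \<and> term_lang n t)"
| "term_lang n (Diag i j) = (i < n \<and> j < n)"

primrec fm_lang :: "nat \<Rightarrow> cyl_fm \<Rightarrow> bool" where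
  "fm_lang n (Eq s t) = (term_lang n s \<and> term_lang n t)"
| "fm_lang n (Neg \<phi>) = fm_lang n \<phi>"
| "fm_lang n (Conj \<phi> \<psi>) = (fm_lang n \<phi> \<and> fm_lang n \<psi>)"
| "fm_lang n (Ex v \<phi>) = fm_lang n \<phi>"

definition sentences :: "nat \<Rightarrow> cyl_fm set" where
  "sentences n = {\<phi>. fm_lang n \<phi> \<and> free_vars \<phi> = {}}"

primrec eval_term :: "'a cyl_alg \<Rightarrow> (nat \<Rightarrow> 'a) \<Rightarrow> cyl_term \<Rightarrow> 'a" where
  "eval_term A e (Var v) = e v"
| "eval_term A e (Join s t) = eval_term A e s \<oplus>\<^bsub>A\<^esub> eval_term A e t"
| "eval_term A e (Meet s t) = eval_term A e s \<odot>\<^bsub>A\<^esub> eval_term A e t"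
| "eval_term A e (Compl t) = \<ominus>\<^bsub>A\<^esub> eval_term A e t"
| "eval_term A e Zero = \<zero>\<^bsub>A\<^esub>"
| "eval_term A e One = \<one>\<^bsub>A\<^esub>"
| "eval_term A e (Cyl i t) = cyl A i (eval_term A e t)"
| "eval_term A e (Diag i j) = diag A i j"

primrec satisfies :: "'a cyl_alg \<Rightarrow> (nat \<Rightarrow> 'a) \<Rightarrow> cyl_fm \<Rightarrow> bool" where
  "satisfies A e (Eq s t) \<longleftrightarrow> eval_term A e s = eval_term A e t"
| "satisfies A e (Neg \<phi>) \<longleftrightarrow> \<not> satisfies A e \<phi>"
| "satisfies A e (Conj \<phi> \<psi>) \<longleftrightarrow> satisfies A e \<phi> \<and> satisfies A e \<psi>"
| "satisfies A e (Ex v \<phi>) \<longleftrightarrow> (\<exists>x\<in>carrier A. satisfies A (e(v := x)) \<phi>)"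

definition Mod :: "nat \<Rightarrow> cyl_fm set \<Rightarrow> 'a cyl_alg set" where
  "Mod n T = {A. cyl_structure n A \<and>
     (\<forall>\<phi>\<in>T. \<forall>e. range e \<subseteq> carrier A \<longrightarrow> satisfies A e \<phi>)}"

text \<open>
  A class of algebras is represented by its members with elements in a type \<open>'a\<close>, and
  elementarity is tested on these. A class that is elementary in the absolute sense has an
  elementary trace on every type, so failure on one type \<open>'a\<close> is enough for failure outright.
\<close>

definition elementary :: "nat \<Rightarrow> 'a cyl_alg set \<Rightarrow> bool" where
  "elementary n K \<longleftrightarrow> (\<exists>T. T \<subseteq> sentences n \<and> K = Mod n T)"

end

theory Submission
  imports Defs "HOL-Library.Countable_Set"
begin

text \<open>
  The atoms of \<open>Alg n\<close> are the isomorphism types of \<open>n\<close> coloured points. A point is plain, is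
  one of \<open>SX0\<close>, \<open>SX1\<close>, or carries a tint \<open>SZ i\<close>, and a set of \<open>n - 1\<close> points exactly two of which are
  not plain carries a label. Points \<open>SX0\<close>, \<open>SX1\<close> span a cone with an apex of tint \<open>SZ i\<close> when both facets
  through the apex are green. Two apexes of one base cannot be joined by a white facet, so
  they are joined by a red one, and red labels carry a rank that drops strictly along
  \<open>SZ i\<close>, \<open>SZ (i + 1)\<close>, \<open>SZ (i + 2)\<close>. The spare dimensions leave room for successive apexes over
  the same base, and since suprema are preserved each red facet has a definite rank; so a dilation
  would produce an infinite descent of natural numbers. Hence \<open>Alg n\<close> lies in no class
  \<open>S\<^sub>c Nr\<^sub>n CA\<^sub>n\<^sub>+\<^sub>3\<close>.

  In an ultrapower ranks become nonstandard and descend forever without harm. A countable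
  elementary subalgebra of the ultrapower is completely represented on a free model whose points
  are finite trees, each storing the earlier points to which it is attached together with the
  labels of the facets it completes; facets left open get a default label. Every point tuple
  lies in an atom of the subalgebra, which makes the representation complete.
\<close>

section \<open>Arithmetic of cylindric algebras\<close>

text \<open>The colouring is of rainbow type. There are two whites because a facet joining two
  apexes is judged from both ends of the base: \<open>SX0\<close> forbids one white and
  \<open>SX1\<close> the other. The difficult half is the free model. A default label is a function
  of the trees alone, so it cannot react to points built later. A simplex either has a node whose
  children are all its other points, and then its rules were checked with that node, or one of its
  labels is a default. Default base labels must admit exactly a given finite set of tints, whence
  the labels \<open>LY\<close>. Default red labels need a rank for every tint that drops along all
  successors; natural numbers cannot provide it, infinite ranks can. The case analyses end in a
  cycle of children, impossible by tree size, or in a count against the bound of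
  \<open>n - 1\<close> children per node.\<close>

context cylindric_algebra
begin

definition le :: "'a \<Rightarrow> 'a \<Rightarrow> bool" where "le x y \<longleftrightarrow> x \<odot> y = x"

lemmas closed [simp] = join_closed meet_closed compl_closed zero_closed one_closed cyl_closed diag_closed

lemma one_meet [simp]: "x \<in> carrier A \<Longrightarrow> \<one> \<odot> x = x"
  using meet_one meet_comm by force

lemma meet_one' [simp]: "x \<in> carrier A \<Longrightarrow> x \<odot> \<one> = x"
  using meet_one by force

lemma join_zero' [simp]: "x \<in> carrier A \<Longrightarrow> x \<oplus> \<zero> = x"
  using join_zero by force

lemma zero_join [simp]: "x \<in> carrier A \<Longrightarrow> \<zero> \<oplus> x = x"
  using join_zero join_comm by force

lemma meet_idem [simp]: "x \<in> carrier A \<Longrightarrow> x \<odot> x = x"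
  by (metis meet_join_distrib join_compl meet_compl meet_one' join_zero' closed)

lemma join_one [simp]: "x \<in> carrier A \<Longrightarrow> x \<oplus> \<one> = \<one>"
  by (metis join_meet_distrib join_compl one_meet meet_one' closed)

lemma meet_zero [simp]: "x \<in> carrier A \<Longrightarrow> x \<odot> \<zero> = \<zero>"
  by (metis meet_join_distrib meet_compl zero_join join_zero' closed)

lemma zero_meet [simp]: "x \<in> carrier A \<Longrightarrow> \<zero> \<odot> x = \<zero>"
  using meet_zero meet_comm by force

lemma absorb_join: "x \<in> carrier A \<Longrightarrow> y \<in> carrier A \<Longrightarrow> x \<oplus> (x \<odot> y) = x"
  by (metis meet_join_distrib meet_one' join_one join_comm closed)

lemma absorb_meet: "x \<in> carrier A \<Longrightarrow> y \<in> carrier A \<Longrightarrow> x \<odot> (x \<oplus> y) = x"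
  by (metis join_meet_distrib join_zero' meet_zero meet_comm closed)

text \<open>Associativity is not among Huntington's postulates. Its derivation needs each summand to
  be absorbed by a three-term sum in either bracketing.\<close>

lemma absorb_meet_sum:
  assumes "x \<in> carrier A" "y \<in> carrier A" "z \<in> carrier A"
  shows "x \<odot> (x \<oplus> y) = x" "x \<odot> (y \<oplus> x) = x"
    "x \<odot> ((x \<oplus> y) \<oplus> z) = x" "x \<odot> ((y \<oplus> x) \<oplus> z) = x"
    "x \<odot> (z \<oplus> (x \<oplus> y)) = x" "x \<odot> (z \<oplus> (y \<oplus> x)) = x"
proof -
  show 1: "x \<odot> (x \<oplus> y) = x" using assms by (simp add: absorb_meet)
  show 2: "x \<odot> (y \<oplus> x) = x" using 1 assms by (simp add: join_comm)
  have 3: "x \<oplus> (x \<odot> z) = x" "(x \<odot> z) \<oplus> x = x"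
    using assms absorb_join[of x z] join_comm[of x "x \<odot> z"] by simp_all
  show "x \<odot> ((x \<oplus> y) \<oplus> z) = x" "x \<odot> ((y \<oplus> x) \<oplus> z) = x"
    "x \<odot> (z \<oplus> (x \<oplus> y)) = x" "x \<odot> (z \<oplus> (y \<oplus> x)) = x"
    using 1 2 3 assms meet_join_distrib[of x "x \<oplus> y" z] meet_join_distrib[of x "y \<oplus> x" z]
      meet_join_distrib[of x z "x \<oplus> y"] meet_join_distrib[of x z "y \<oplus> x"] by simp_all
qed

text \<open>Each bracketing absorbs all three summands, so distributing either one over the other
  gives the other back; both therefore equal their meet.\<close>

lemma join_assoc:
  assumes "x \<in> carrier A" "y \<in> carrier A" "z \<in> carrier A"
  shows "(x \<oplus> y) \<oplus> z = x \<oplus> (y \<oplus> z)"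
proof -
  let ?a = "x \<oplus> (y \<oplus> z)" and ?b = "(x \<oplus> y) \<oplus> z"
  have a: "x \<odot> ?a = x" "y \<odot> ?a = y" "z \<odot> ?a = z"
    using assms by (simp_all add: absorb_meet_sum)
  have b: "x \<odot> ?b = x" "y \<odot> ?b = y" "z \<odot> ?b = z"
    using assms by (simp_all add: absorb_meet_sum)
  have [simp]: "?a \<in> carrier A" "?b \<in> carrier A" "x \<oplus> y \<in> carrier A" "y \<oplus> z \<in> carrier A" using assms by simp_all
  have "?a \<odot> ?b = (?a \<odot> (x \<oplus> y)) \<oplus> (?a \<odot> z)"
    using assms meet_join_distrib[of ?a "x \<oplus> y" z] by simp
  also have "?a \<odot> (x \<oplus> y) = (?a \<odot> x) \<oplus> (?a \<odot> y)"
    using assms meet_join_distrib[of ?a x y] by simp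
  finally have 1: "?a \<odot> ?b = ?b"
    using a assms meet_comm[of ?a x] meet_comm[of ?a y] meet_comm[of ?a z] by simp
  have "?b \<odot> ?a = (?b \<odot> x) \<oplus> (?b \<odot> (y \<oplus> z))"
    using assms meet_join_distrib[of ?b x "y \<oplus> z"] by simp
  also have "?b \<odot> (y \<oplus> z) = (?b \<odot> y) \<oplus> (?b \<odot> z)"
    using assms meet_join_distrib[of ?b y z] by simp
  finally have 2: "?b \<odot> ?a = ?a"
    using b assms meet_comm[of ?b x] meet_comm[of ?b y] meet_comm[of ?b z] by simp
  show ?thesis using 1 2 meet_comm[of ?a ?b] by simp
qed

lemma le_join_iff: "x \<in> carrier A \<Longrightarrow> y \<in> carrier A \<Longrightarrow> le x y \<longleftrightarrow> x \<oplus> y = y"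
  unfolding le_def using absorb_join[of y x] absorb_meet[of x y] join_comm[of x y] meet_comm[of x y]
    join_comm[of "x \<odot> y" y] by (metis meet_closed)

lemma le_trans: "le x y \<Longrightarrow> le y z \<Longrightarrow> x \<in> carrier A \<Longrightarrow> y \<in> carrier A \<Longrightarrow> z \<in> carrier A \<Longrightarrow> le x z"
  by (metis join_assoc le_join_iff)

lemma le_antisym: "le x y \<Longrightarrow> le y x \<Longrightarrow> x \<in> carrier A \<Longrightarrow> y \<in> carrier A \<Longrightarrow> x = y"
  unfolding le_def by (metis meet_comm)

lemma meet_le1: "x \<in> carrier A \<Longrightarrow> y \<in> carrier A \<Longrightarrow> le (x \<odot> y) x"
  using absorb_join[of x y] join_comm[of x "x \<odot> y"] by (simp add: le_join_iff)

lemma meet_le2: "x \<in> carrier A \<Longrightarrow> y \<in> carrier A \<Longrightarrow> le (x \<odot> y) y"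
  by (metis meet_le1 meet_comm)

lemma join_le1: "x \<in> carrier A \<Longrightarrow> y \<in> carrier A \<Longrightarrow> le x (x \<oplus> y)"
  by (simp add: le_def absorb_meet)

lemma join_le2: "x \<in> carrier A \<Longrightarrow> y \<in> carrier A \<Longrightarrow> le y (x \<oplus> y)"
  by (metis join_le1 join_comm)

lemma le_meetI:
  assumes "le x y" "le x z" "x \<in> carrier A" "y \<in> carrier A" "z \<in> carrier A"
  shows "le x (y \<odot> z)"
proof -
  have "x \<oplus> (y \<odot> z) = y \<odot> z" using assms by (simp add: le_join_iff join_meet_distrib)
  then show ?thesis using assms by (simp add: le_join_iff)
qed

lemma meet_assoc:
  assumes "x \<in> carrier A" "y \<in> carrier A" "z \<in> carrier A"
  shows "(x \<odot> y) \<odot> z = x \<odot> (y \<odot> z)"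
proof (rule le_antisym)
  have m: "x \<odot> y \<in> carrier A" "y \<odot> z \<in> carrier A" "(x \<odot> y) \<odot> z \<in> carrier A" "x \<odot> (y \<odot> z) \<in> carrier A"
    using assms by simp_all
  have "le ((x \<odot> y) \<odot> z) x" "le ((x \<odot> y) \<odot> z) y" "le ((x \<odot> y) \<odot> z) z"
    using assms m le_trans[OF meet_le1[of "x \<odot> y" z] meet_le1[of x y]]
      le_trans[OF meet_le1[of "x \<odot> y" z] meet_le2[of x y]] meet_le2[of "x \<odot> y" z] by simp_all
  then show "le ((x \<odot> y) \<odot> z) (x \<odot> (y \<odot> z))" using assms m by (simp add: le_meetI)
  have "le (x \<odot> (y \<odot> z)) x" "le (x \<odot> (y \<odot> z)) y" "le (x \<odot> (y \<odot> z)) z"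
    using assms m le_trans[OF meet_le2[of x "y \<odot> z"] meet_le1[of y z]]
      le_trans[OF meet_le2[of x "y \<odot> z"] meet_le2[of y z]] meet_le1[of x "y \<odot> z"] by simp_all
  then show "le (x \<odot> (y \<odot> z)) ((x \<odot> y) \<odot> z)" using assms m by (simp add: le_meetI)
qed (use assms in simp_all)

lemma meet_left_comm:
  "x \<in> carrier A \<Longrightarrow> y \<in> carrier A \<Longrightarrow> z \<in> carrier A \<Longrightarrow> x \<odot> (y \<odot> z) = y \<odot> (x \<odot> z)"
  by (metis meet_assoc meet_comm)

lemmas meet_ac = meet_assoc meet_comm meet_left_comm

lemma le_refl [simp]: "x \<in> carrier A \<Longrightarrow> le x x"
  by (simp add: le_def)

lemma meet_mono: "le x y \<Longrightarrow> le z w \<Longrightarrow> x \<in> carrier A \<Longrightarrow> y \<in> carrier A \<Longrightarrow> z \<in> carrier A \<Longrightarrow> w \<in> carrier A \<Longrightarrow> le (x \<odot> z) (y \<odot> w)"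
  by (meson le_meetI le_trans meet_le1 meet_le2 meet_closed)

lemma le_zero: "le x \<zero> \<Longrightarrow> x \<in> carrier A \<Longrightarrow> x = \<zero>"
  by (simp add: le_def)

lemma le_zero_meet: "le x y \<Longrightarrow> y \<odot> z = \<zero> \<Longrightarrow> x \<in> carrier A \<Longrightarrow> y \<in> carrier A \<Longrightarrow> z \<in> carrier A \<Longrightarrow> x \<odot> z = \<zero>"
  by (metis le_def meet_assoc meet_zero)

lemma split_meet: "x \<in> carrier A \<Longrightarrow> y \<in> carrier A \<Longrightarrow> x = (x \<odot> y) \<oplus> (x \<odot> \<ominus> y)"
  by (metis meet_join_distrib join_compl meet_one' closed)

lemma le_iff_meet_compl:
  assumes "x \<in> carrier A" "y \<in> carrier A"
  shows "le x y \<longleftrightarrow> x \<odot> \<ominus> y = \<zero>"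
proof
  show "le x y \<Longrightarrow> x \<odot> \<ominus> y = \<zero>"
    using assms by (simp add: le_zero_meet meet_compl)
  assume "x \<odot> \<ominus> y = \<zero>"
  then show "le x y" using split_meet[of x y] assms by (simp add: le_def)
qed

lemma le_compl_iff:
  assumes "x \<in> carrier A" "y \<in> carrier A"
  shows "le x (\<ominus> y) \<longleftrightarrow> x \<odot> y = \<zero>"
proof
  show "le x (\<ominus> y) \<Longrightarrow> x \<odot> y = \<zero>"
    using assms meet_compl[of y] meet_comm[of y "\<ominus> y"] by (simp add: le_zero_meet)
  assume "x \<odot> y = \<zero>"
  then show "le x (\<ominus> y)" using split_meet[of x y] assms by (simp add: le_def)
qed

lemma cyl_le: "i < n \<Longrightarrow> x \<in> carrier A \<Longrightarrow> le x (cyl A i x)"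
  by (simp add: le_join_iff cyl_increasing)

lemma cyl_one [simp]: "i < n \<Longrightarrow> cyl A i \<one> = \<one>"
  using cyl_le[of i \<one>] by (simp add: le_def)

lemma cyl_idem [simp]: "i < n \<Longrightarrow> x \<in> carrier A \<Longrightarrow> cyl A i (cyl A i x) = cyl A i x"
  using cyl_meet_cyl[of i \<one> x] by simp

text \<open>Cylindrifications are self-conjugate: applying \<open>cyl A i\<close> to the hypothesis
  gives two disjoint cylinders, and \<open>y\<close> lies below the second.\<close>

lemma cyl_meet_zero_imp:
  assumes "i < n" "x \<in> carrier A" "y \<in> carrier A" "x \<odot> cyl A i y = \<zero>"
  shows "cyl A i x \<odot> y = \<zero>"
proof -
  have "cyl A i y \<odot> cyl A i x = \<zero>"
    using assms cyl_meet_cyl[of i x y] meet_comm[of "cyl A i x" "cyl A i y"] by (simp add: cyl_zero)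
  then have "y \<odot> cyl A i x = \<zero>"
    using assms le_zero_meet[OF cyl_le] by simp
  then show ?thesis using assms meet_comm[of y "cyl A i x"] by simp
qed

lemma cyl_meet_zero_iff:
  "i < n \<Longrightarrow> x \<in> carrier A \<Longrightarrow> y \<in> carrier A \<Longrightarrow> x \<odot> cyl A i y = \<zero> \<longleftrightarrow> cyl A i x \<odot> y = \<zero>"
  using cyl_meet_zero_imp[of i x y] cyl_meet_zero_imp[of i y x]
    meet_comm[of x "cyl A i y"] meet_comm[of "cyl A i x" y] by auto

lemma cyl_mono:
  assumes "le x y" "i < n" "x \<in> carrier A" "y \<in> carrier A"
  shows "le (cyl A i x) (cyl A i y)"
proof -
  have "le x (cyl A i y)" using assms cyl_le[of i y] le_trans[of x y "cyl A i y"] by simp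
  then have "cyl A i (x \<odot> cyl A i y) = cyl A i x" by (simp add: le_def)
  then show ?thesis using assms by (simp add: cyl_meet_cyl le_def)
qed

lemma meet_join_zero: "x \<odot> z = \<zero> \<Longrightarrow> y \<odot> z = \<zero> \<Longrightarrow> x \<in> carrier A \<Longrightarrow> y \<in> carrier A \<Longrightarrow> z \<in> carrier A \<Longrightarrow> (x \<oplus> y) \<odot> z = \<zero>"
  using meet_join_distrib[of z x y] meet_comm[of z x] meet_comm[of z y] meet_comm[of z "x \<oplus> y"] by simp

text \<open>Additivity from conjugacy: the complement of the right-hand side is disjoint from both
  cylinders, disjointness moves onto \<open>x\<close> and \<open>y\<close>, is joined there, and
  moves back.\<close>

lemma cyl_join_le:
  assumes "i < n" "x \<in> carrier A" "y \<in> carrier A"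
  shows "le (cyl A i (x \<oplus> y)) (cyl A i x \<oplus> cyl A i y)"
proof -
  let ?w = "\<ominus> (cyl A i x \<oplus> cyl A i y)"
  have "cyl A i x \<odot> ?w = \<zero>" "cyl A i y \<odot> ?w = \<zero>"
    using assms le_zero_meet[OF join_le1[of "cyl A i x" "cyl A i y"], of ?w]
      le_zero_meet[OF join_le2[of "cyl A i x" "cyl A i y"], of ?w] by (simp_all add: meet_compl)
  then have "x \<odot> cyl A i ?w = \<zero>" "y \<odot> cyl A i ?w = \<zero>"
    using assms by (simp_all add: cyl_meet_zero_iff)
  then have "(x \<oplus> y) \<odot> cyl A i ?w = \<zero>" using assms by (simp add: meet_join_zero)
  then show ?thesis using assms by (simp add: cyl_meet_zero_iff le_iff_meet_compl)
qed

lemma cyl_meet_left: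
  "i < n \<Longrightarrow> x \<in> carrier A \<Longrightarrow> y \<in> carrier A \<Longrightarrow> cyl A i y = y \<Longrightarrow> cyl A i (x \<odot> y) = cyl A i x \<odot> y"
  by (metis cyl_meet_cyl)

lemma cyl_meet_right:
  "i < n \<Longrightarrow> x \<in> carrier A \<Longrightarrow> y \<in> carrier A \<Longrightarrow> cyl A i x = x \<Longrightarrow> cyl A i (x \<odot> y) = x \<odot> cyl A i y"
  by (metis cyl_meet_left meet_comm cyl_closed)

lemma cyl_meet_fix:
  "i < n \<Longrightarrow> x \<in> carrier A \<Longrightarrow> y \<in> carrier A \<Longrightarrow> cyl A i x = x \<Longrightarrow> cyl A i y = y \<Longrightarrow> cyl A i (x \<odot> y) = x \<odot> y"
  by (simp add: cyl_meet_left)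

lemma cyl_diag_fix: "i < n \<Longrightarrow> j < n \<Longrightarrow> k < n \<Longrightarrow> k \<noteq> i \<Longrightarrow> k \<noteq> j \<Longrightarrow> cyl A k (diag A i j) = diag A i j"
  by (metis diag_cyl cyl_idem closed)

lemma cyl_diag1: "i < n \<Longrightarrow> j < n \<Longrightarrow> i \<noteq> j \<Longrightarrow> cyl A i (diag A i j) = \<one>"
proof -
  assume a: "i < n" "j < n" "i \<noteq> j"
  then have "\<one> = cyl A i (diag A j i \<odot> diag A i j)" using diag_cyl[of j j i] diag_refl by simp
  then have "le \<one> (cyl A i (diag A i j))" using a cyl_mono[OF meet_le2, of "diag A j i" "diag A i j" i] by simp
  then show ?thesis using a by (simp add: le_def)
qed

lemma cyl_diag2: "i < n \<Longrightarrow> j < n \<Longrightarrow> i \<noteq> j \<Longrightarrow> cyl A j (diag A i j) = \<one>"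
proof -
  assume a: "i < n" "j < n" "i \<noteq> j"
  then have "\<one> = cyl A j (diag A i j \<odot> diag A j i)" using diag_cyl[of i i j] diag_refl by simp
  then have "le \<one> (cyl A j (diag A i j))" using a cyl_mono[OF meet_le1, of "diag A i j" "diag A j i" j] by simp
  then show ?thesis using a by (simp add: le_def)
qed

text \<open>The substitution operator commonly written s^i_j: the content of place \<open>i\<close>
  is read at place \<open>j\<close>, and place \<open>i\<close> becomes free.\<close>

definition sub :: "nat \<Rightarrow> nat \<Rightarrow> 'a \<Rightarrow> 'a" where
  "sub i j x = cyl A i (diag A i j \<odot> x)"

lemma sub_closed [simp]: "i < n \<Longrightarrow> j < n \<Longrightarrow> x \<in> carrier A \<Longrightarrow> sub i j x \<in> carrier A"
  by (simp add: sub_def)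

lemma sub_mono: "le x y \<Longrightarrow> i < n \<Longrightarrow> j < n \<Longrightarrow> x \<in> carrier A \<Longrightarrow> y \<in> carrier A \<Longrightarrow> le (sub i j x) (sub i j y)"
  unfolding sub_def by (intro cyl_mono meet_mono) auto

lemma sub_zero [simp]: "i < n \<Longrightarrow> j < n \<Longrightarrow> sub i j \<zero> = \<zero>"
  by (simp add: sub_def cyl_zero)

lemma sub_fix: "i < n \<Longrightarrow> j < n \<Longrightarrow> i \<noteq> j \<Longrightarrow> x \<in> carrier A \<Longrightarrow> cyl A i x = x \<Longrightarrow> sub i j x = x"
  by (simp add: sub_def cyl_meet_left cyl_diag1)

lemma sub_join_le: "i < n \<Longrightarrow> j < n \<Longrightarrow> x \<in> carrier A \<Longrightarrow> y \<in> carrier A \<Longrightarrow> le (sub i j (x \<oplus> y)) (sub i j x \<oplus> sub i j y)"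
  unfolding sub_def by (simp add: meet_join_distrib cyl_join_le)

lemma sub_compl: "i < n \<Longrightarrow> j < n \<Longrightarrow> i \<noteq> j \<Longrightarrow> x \<in> carrier A \<Longrightarrow> sub i j x \<odot> sub i j (\<ominus> x) = \<zero>"
  by (simp add: sub_def cyl_diag_compl)

text \<open>The axiom \<open>cyl_diag_compl\<close> enters here through \<open>sub_compl\<close>:
  after splitting \<open>x\<close> by \<open>y\<close>, the part outside \<open>y\<close> has an
  image disjoint from \<open>sub i j y\<close>. This makes substitutions multiplicative.\<close>

lemma sub_meet_le:
  assumes "i < n" "j < n" "i \<noteq> j" "x \<in> carrier A" "y \<in> carrier A"
  shows "le (sub i j x \<odot> sub i j y) (sub i j (x \<odot> y))"
proof -
  let ?P = "sub i j (x \<odot> y)" and ?Q = "sub i j (x \<odot> \<ominus> y)"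
  have 1: "le (sub i j x) (?P \<oplus> ?Q)"
    using sub_join_le[of i j "x \<odot> y" "x \<odot> \<ominus> y"] split_meet[of x y] assms by simp
  have 2: "sub i j y \<odot> ?Q = \<zero>"
    using assms sub_compl[of i j y] sub_mono[OF meet_le2, of x "\<ominus> y" i j]
      le_zero_meet[of ?Q "sub i j (\<ominus> y)" "sub i j y"]
      meet_comm[of "sub i j y" ?Q] meet_comm[of "sub i j y" "sub i j (\<ominus> y)"] by simp
  have "le (sub i j x \<odot> sub i j y) ((?P \<oplus> ?Q) \<odot> sub i j y)"
    using 1 assms by (intro meet_mono) auto
  also have "(?P \<oplus> ?Q) \<odot> sub i j y = (sub i j y \<odot> ?P) \<oplus> (sub i j y \<odot> ?Q)"
    using assms meet_join_distrib[of "sub i j y" ?P ?Q] meet_comm[of "sub i j y" "?P \<oplus> ?Q"] by simp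
  finally have "le (sub i j x \<odot> sub i j y) (sub i j y \<odot> ?P)"
    using 2 assms by simp
  then show ?thesis by (rule le_trans[OF _ meet_le2]) (use assms in auto)
qed

lemma sub_meet:
  assumes "i < n" "j < n" "i \<noteq> j" "x \<in> carrier A" "y \<in> carrier A"
  shows "sub i j (x \<odot> y) = sub i j x \<odot> sub i j y"
proof (rule le_antisym)
  show "le (sub i j (x \<odot> y)) (sub i j x \<odot> sub i j y)"
    using assms by (intro le_meetI sub_mono[OF meet_le1] sub_mono[OF meet_le2]) auto
  show "le (sub i j x \<odot> sub i j y) (sub i j (x \<odot> y))"
    using assms by (rule sub_meet_le)
qed (use assms in auto)

lemma cyl_sub_same [simp]: "i < n \<Longrightarrow> j < n \<Longrightarrow> x \<in> carrier A \<Longrightarrow> cyl A i (sub i j x) = sub i j x"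
  by (simp add: sub_def)

lemma cyl_sub_fix:
  assumes "i < n" "j < n" "k < n" "k \<noteq> i" "k \<noteq> j" "x \<in> carrier A" "cyl A k x = x"
  shows "cyl A k (sub i j x) = sub i j x"
  using assms by (simp add: sub_def cyl_commute[of k i] cyl_meet_fix cyl_diag_fix)

text \<open>Place \<open>j\<close> is free in \<open>y\<close> and serves as a relay;
  \<open>diag_cyl\<close> composes the two equalities into one between \<open>a\<close> and
  \<open>b\<close>.\<close>

lemma sub_sub_chain:
  assumes "a < n" "j < n" "b < n" "a \<noteq> j" "j \<noteq> b" "a \<noteq> b" "y \<in> carrier A" "cyl A j y = y"
  shows "sub j b (sub a j y) = sub a b y"
proof -
  have "sub j b (sub a j y) = cyl A j (cyl A a (diag A j b \<odot> (diag A a j \<odot> y)))"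
    using assms by (simp add: sub_def cyl_meet_right cyl_diag_fix)
  also have "\<dots> = cyl A a (cyl A j (diag A j b \<odot> (diag A a j \<odot> y)))"
    using assms by (simp add: cyl_commute)
  also have "diag A j b \<odot> (diag A a j \<odot> y) = (diag A a j \<odot> diag A j b) \<odot> y"
    using assms by (simp add: meet_ac)
  also have "cyl A j \<dots> = diag A a b \<odot> y"
    using assms by (simp add: cyl_meet_left diag_cyl[of a b j])
  finally show ?thesis by (simp add: sub_def)
qed

lemma sub_sub_commute:
  assumes "i < n" "j < n" "k < n" "l < n" "i \<noteq> k" "i \<noteq> l" "k \<noteq> j" "x \<in> carrier A"
  shows "sub i j (sub k l x) = sub k l (sub i j x)"
proof -
  have "sub i j (sub k l x) = cyl A i (cyl A k (diag A i j \<odot> (diag A k l \<odot> x)))"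
    using assms by (simp add: sub_def cyl_meet_right cyl_diag_fix)
  also have "\<dots> = cyl A k (cyl A i (diag A k l \<odot> (diag A i j \<odot> x)))"
    using assms by (simp add: cyl_commute meet_left_comm)
  also have "\<dots> = sub k l (sub i j x)"
    using assms by (simp add: sub_def cyl_meet_right cyl_diag_fix)
  finally show ?thesis .
qed

text \<open>Renaming of a bound variable: quantifying place \<open>i\<close> is the same as moving
  it to the free place \<open>j\<close> and quantifying there.\<close>

lemma cyl_sub_target:
  assumes "i < n" "j < n" "i \<noteq> j" "x \<in> carrier A" "cyl A j x = x"
  shows "cyl A j (sub i j x) = cyl A i x"
proof -
  have "cyl A j (sub i j x) = cyl A i (cyl A j (diag A i j \<odot> x))"
    using assms by (simp add: sub_def cyl_commute)
  then show ?thesis using assms by (simp add: cyl_meet_left cyl_diag2)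
qed

text \<open>The conjugate of a substitution sends \<open>x\<close> to
  \<open>cyl A i x \<odot> diag A i j\<close>; it comes from self-conjugacy of the
  cylindrification.\<close>

lemma sub_meet_zero_iff:
  assumes "i < n" "j < n" "x \<in> carrier A" "y \<in> carrier A"
  shows "x \<odot> sub i j y = \<zero> \<longleftrightarrow> (cyl A i x \<odot> diag A i j) \<odot> y = \<zero>"
  using assms by (simp add: sub_def cyl_meet_zero_iff meet_assoc)

end

context cylindric_algebra
begin

text \<open>This is how a spare place is filled. Below \<open>x\<close> some value of place
  \<open>i\<close> satisfies \<open>y\<close>; as neither element depends on \<open>j\<close>, that
  value can be stored in \<open>j\<close> while \<open>x\<close> keeps its own value at
  \<open>i\<close>.\<close>

lemma meet_sub_nonzero:
  assumes "i < n" "j < n" "i \<noteq> j" "x \<in> carrier A" "y \<in> carrier A" "cyl A j x = x" "cyl A j y = y"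
    and "le x (cyl A i y)" "x \<noteq> \<zero>"
  shows "x \<odot> sub i j y \<noteq> \<zero>"
proof
  assume "x \<odot> sub i j y = \<zero>"
  then have "x \<odot> cyl A i y = \<zero>"
    using assms cyl_meet_right[of j x "sub i j y"] by (simp add: cyl_sub_target cyl_zero)
  then show False using assms by (simp add: le_def)
qed

text \<open>A family that is jointly dense in the nonzero elements stays so after a substitution,
  because a substitution has a conjugate.\<close>

lemma sub_meets_dense:
  assumes ij: "i < n" "j < n" "i \<noteq> j" and Y: "Y \<subseteq> carrier A" and x: "x \<in> carrier A" "x \<noteq> \<zero>"
    and dense: "\<And>z. z \<in> carrier A \<Longrightarrow> z \<noteq> \<zero> \<Longrightarrow> \<exists>y\<in>Y. z \<odot> y \<noteq> \<zero>"
  shows "\<exists>y\<in>Y. x \<odot> sub i j y \<noteq> \<zero>"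
proof -
  let ?z = "cyl A i x \<odot> diag A i j"
  have "x \<odot> sub i j \<one> = x" using ij x by (simp add: sub_def cyl_diag1)
  then have "?z \<odot> \<one> \<noteq> \<zero>"
    using ij x sub_meet_zero_iff[of i j x \<one>] by simp
  then have "?z \<noteq> \<zero>" using ij x by simp
  then obtain y where "y \<in> Y" "?z \<odot> y \<noteq> \<zero>" using dense[of ?z] ij x by auto
  then show ?thesis using Y sub_meet_zero_iff[OF ij(1,2) x(1), of y] by auto
qed

text \<open>Both sides of the conclusion speak of the same points: \<open>y\<close> describes
  \<open>x\<close> with place \<open>a\<close> renamed to \<open>j\<close>, and renaming
  \<open>j\<close> to \<open>b\<close> finishes the journey from \<open>a\<close> to
  \<open>b\<close>.\<close>

lemma le_sub_transfer:
  assumes "a < n" "j < n" "b < n" "a \<noteq> j" "j \<noteq> b" "a \<noteq> b" "x \<in> carrier A" "y \<in> carrier A" "cyl A j x = x"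
    and "le (sub a j x) y"
  shows "le (sub a b x) (sub j b y)"
  using sub_mono[OF assms(10), of j b] sub_sub_chain[of a j b x] assms by simp

text \<open>Carries a rule about points in ordinary places, \<open>le (x \<odot> y') z\<close>, to a
  configuration whose last point sits in the spare place \<open>b\<close>: \<open>sub j b\<close> is
  multiplicative, fixes \<open>x\<close>, and sends \<open>y'\<close> above
  \<open>sub a b y\<close>.\<close>

lemma sub_meet_sub_le:
  assumes "a < n" "j < n" "b < n" "a \<noteq> j" "j \<noteq> b" "a \<noteq> b"
    and "x \<in> carrier A" "y \<in> carrier A" "y' \<in> carrier A" "z \<in> carrier A"
    and "cyl A j x = x" "cyl A j y = y" "le (sub a j y) y'" "le (x \<odot> y') z"
  shows "le (x \<odot> sub a b y) (sub j b z)"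
proof -
  have "le (x \<odot> sub a b y) (sub j b x \<odot> sub j b y')"
    using assms le_sub_transfer[of a j b y y'] sub_fix[of j b x] by (intro meet_mono) auto
  also have "sub j b x \<odot> sub j b y' = sub j b (x \<odot> y')"
    using assms by (simp add: sub_meet)
  finally show ?thesis
    by (rule le_trans[OF _ sub_mono[OF assms(14)]]) (use assms in auto)
qed

end

section \<open>Descent of ranks in a dilation\<close>

text \<open>The letters stand for images in a dilation. \<open>C i\<close> is a cone with apex of
  tint \<open>SZ i\<close> in place 2, \<open>Ga i\<close> and \<open>Gb i\<close> are its green
  facets omitting places 1 and 0, and \<open>Ga' i\<close>, \<open>Gb' i\<close> the same facets
  with the apex moved to place 1 or 0. With tint \<open>i\<close> in place 2 and tint
  \<open>j\<close> in place 1, the facet omitting place 0 is red in \<open>R i j\<close>, of the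
  second white in \<open>W i j\<close>, and one of these in \<open>V i j\<close>. \<open>R'\<close>
  and \<open>W'\<close> are their copies with tint \<open>j\<close> in place 0, but
  \<open>V'\<close> stands for red or the first white. \<open>E\<close> and \<open>F\<close> fix a
  rank. Places \<open>b\<close> and \<open>g\<close> are spare.\<close>

locale rank_descent = cylindric_algebra +
  fixes b g :: nat and C Ga Ga' Gb Gb' :: "nat \<Rightarrow> 'a" and R R' W W' V V' :: "nat \<Rightarrow> nat \<Rightarrow> 'a"
    and E F :: "nat \<Rightarrow> nat \<Rightarrow> nat \<Rightarrow> 'a"
  assumes dims: "2 < b" "2 < g" "b \<noteq> g" "b < n" "g < n"
    and car: "C i \<in> carrier A" "Ga i \<in> carrier A" "Ga' i \<in> carrier A" "Gb i \<in> carrier A" "Gb' i \<in> carrier A"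
      "R i j \<in> carrier A" "R' i j \<in> carrier A" "W i j \<in> carrier A" "W' i j \<in> carrier A"
      "V i j \<in> carrier A" "V' i j \<in> carrier A" "E i j p \<in> carrier A" "F i j p \<in> carrier A"
    and dimb: "k = b \<or> k = g \<Longrightarrow> cyl A k (C i) = C i"
      "k = b \<or> k = g \<Longrightarrow> cyl A k (E i j p) = E i j p"
    and cone: "C 0 \<noteq> \<zero>" "cyl A 2 (C i) = cyl A 2 (C j)" "le (C i) (Ga i)" "le (C i) (Gb i)"
    and fix01: "cyl A 1 (Ga i) = Ga i" "cyl A 0 (Gb i) = Gb i" "cyl A 0 (W i j) = W i j"
      "cyl A 0 (R i j) = R i j" "cyl A 0 (E i j p) = E i j p" "cyl A 1 (R' i j) = R' i j"
    and shift: "le (sub 2 1 (Ga i)) (Ga' i)" "le (sub 2 0 (Gb i)) (Gb' i)"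
      "le (sub 1 0 (W i j)) (W' i j)" "le (sub 1 0 (R i j)) (R' i j)"
      "le (sub 2 1 (sub 1 0 (E i j p))) (F i j p)"
    and gg: "i \<noteq> j \<Longrightarrow> le (Ga i \<odot> Ga' j) (V i j)" "i \<noteq> j \<Longrightarrow> le (Gb i \<odot> Gb' j) (V' i j)"
    and VRW: "le (V i j) (R i j \<oplus> W i j)" "W' i j \<odot> V' i j = \<zero>"
    and rank: "\<not> q < p \<Longrightarrow> E i (Suc i) p \<odot> (F (Suc i) (Suc (Suc i)) q \<odot> R' i (Suc (Suc i))) = \<zero>"
    and dense: "z \<in> carrier A \<Longrightarrow> z \<noteq> \<zero> \<Longrightarrow> \<exists>y \<in> insert (\<ominus> R i j) (range (E i j)). z \<odot> y \<noteq> \<zero>"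
begin

lemma dims' [simp]: "0 < n" "Suc 0 < n" "1 < n" "2 < n" "b < n" "g < n" "b \<noteq> 0" "b \<noteq> Suc 0" "b \<noteq> 1" "b \<noteq> 2"
  "g \<noteq> 0" "g \<noteq> 1" "g \<noteq> Suc 0" "g \<noteq> 2" "b \<noteq> g" "g \<noteq> b" "0 \<noteq> b" "Suc 0 \<noteq> b" "1 \<noteq> b" "2 \<noteq> b" "0 \<noteq> g" "Suc 0 \<noteq> g" "1 \<noteq> g" "2 \<noteq> g"
  using dims by auto

lemmas car' [simp] = car

text \<open>The facet joining the apexes in places 2 and \<open>c\<close> is seen from both base
  points. From place 0 it is red or of the second white; from place 1 the second white is excluded,
  because \<open>W\<close> renamed lies below \<open>W'\<close> and \<open>W'\<close> is disjoint
  from \<open>V'\<close>.\<close>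

lemma apexes_red:
  assumes c: "c = b \<or> c = g" and "i \<noteq> j"
  shows "le (C i \<odot> sub 2 c (C j)) (sub 1 c (R i j))"
proof -
  have [simp]: "c < n" "c \<noteq> 0" "c \<noteq> 1" "c \<noteq> Suc 0" "c \<noteq> 2" "0 \<noteq> c" "1 \<noteq> c" "Suc 0 \<noteq> c" "2 \<noteq> c" using c dims by auto
  let ?x = "C i \<odot> sub 2 c (C j)"
  have xa: "le ?x (Ga i \<odot> sub 2 c (Ga j))" and xb: "le ?x (Gb i \<odot> sub 2 c (Gb j))"
    using cone(3,4) by (auto intro!: meet_mono sub_mono)
  have "le (Ga i \<odot> sub 2 c (Ga j)) (sub 1 c (V i j))"
    using fix01(1) shift(1) gg(1)[OF assms(2)] by (intro sub_meet_sub_le[where y' = "Ga' j"]) auto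
  then have 1: "le ?x (sub 1 c (V i j))" by (rule le_trans[OF xa]) auto
  have "le (Gb i \<odot> sub 2 c (Gb j)) (sub 0 c (V' i j))"
    using fix01(2) shift(2) gg(2)[OF assms(2)] by (intro sub_meet_sub_le[where y' = "Gb' j"]) auto
  then have 2: "le ?x (sub 0 c (V' i j))" by (rule le_trans[OF xb]) auto
  have W: "le (sub 1 c (W i j)) (sub 0 c (W' i j))"
    using fix01(3) shift(3) by (intro le_sub_transfer) auto
  have "sub 0 c (W' i j) \<odot> sub 0 c (V' i j) = \<zero>"
    using VRW(2) by (simp flip: sub_meet)
  then have "sub 1 c (W i j) \<odot> sub 0 c (V' i j) = \<zero>"
    by (intro le_zero_meet[OF W]) auto
  then have "sub 0 c (V' i j) \<odot> sub 1 c (W i j) = \<zero>"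
    by (subst meet_comm) auto
  then have xw: "?x \<odot> sub 1 c (W i j) = \<zero>"
    by (intro le_zero_meet[OF 2]) auto
  have "le ?x (sub 1 c (R i j \<oplus> W i j))"
    by (rule le_trans[OF 1 sub_mono[OF VRW(1)]]) auto
  then have "le ?x (sub 1 c (R i j) \<oplus> sub 1 c (W i j))"
    by (rule le_trans[OF _ sub_join_le]) auto
  then have "?x = ?x \<odot> (sub 1 c (R i j) \<oplus> sub 1 c (W i j))" by (simp add: le_def)
  also have "\<dots> = ?x \<odot> sub 1 c (R i j)" using xw by (simp add: meet_join_distrib)
  finally show ?thesis by (simp add: le_def)
qed

definition ranked :: "nat \<Rightarrow> nat \<Rightarrow> 'a" where
  "ranked i p = (C i \<odot> sub 2 b (C (Suc i))) \<odot> sub 1 b (E i (Suc i) p)"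

lemma ranked_car [simp]: "ranked i p \<in> carrier A"
  by (simp add: ranked_def)

text \<open>A third apex enters place \<open>g\<close>. Its facet with the second apex is red and,
  by density, has a definite rank \<open>q\<close> on some nonzero part; the rule for three
  successive tints forces \<open>q < p\<close>. Then the first apex is forgotten.\<close>

lemma ranked_descends:
  assumes nz: "ranked i p \<noteq> \<zero>"
  shows "\<exists>q<p. ranked (Suc i) q \<noteq> \<zero>"
proof -
  let ?j = "Suc i" and ?k = "Suc (Suc i)"
  let ?e = "ranked i p"
  have eC: "le ?e (C i)" and eCj: "le ?e (sub 2 b (C ?j))" and eE: "le ?e (sub 1 b (E i ?j p))"
  proof -
    have 1: "le ?e (C i \<odot> sub 2 b (C ?j))" unfolding ranked_def by (rule meet_le1) auto
    show "le ?e (C i)" by (rule le_trans[OF 1 meet_le1]) auto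
    show "le ?e (sub 2 b (C ?j))" by (rule le_trans[OF 1 meet_le2]) auto
    show "le ?e (sub 1 b (E i ?j p))" unfolding ranked_def by (rule meet_le2) auto
  qed
  \<comment> \<open>The place \<open>g\<close> is still free here, so it can receive the next
    apex.\<close>
  have ge: "cyl A g ?e = ?e"
    using dimb unfolding ranked_def by (intro cyl_meet_fix cyl_sub_fix) auto
  have "le ?e (cyl A 2 (C i))" by (rule le_trans[OF eC cyl_le]) auto
  then have "le ?e (cyl A 2 (C ?k))" using cone(2)[of i ?k] by simp
  then have f0: "?e \<odot> sub 2 g (C ?k) \<noteq> \<zero>"
    using ge nz dimb by (intro meet_sub_nonzero) auto
  let ?f = "?e \<odot> sub 2 g (C ?k)"
  have fe: "le ?f ?e" and fk: "le ?f (sub 2 g (C ?k))" by (auto intro: meet_le1 meet_le2)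
  have fi: "le ?f (C i)" and fj: "le ?f (sub 2 b (C ?j))" and fE: "le ?f (sub 1 b (E i ?j p))"
    using eC eCj eE by (auto intro: le_trans[OF fe])
  have "le ?f (C i \<odot> sub 2 g (C ?k))" using fi fk by (intro le_meetI) auto
  then have fR1: "le ?f (sub 1 g (R i ?k))" by (rule le_trans[OF _ apexes_red]) auto
  \<comment> \<open>Renaming 2 to \<open>b\<close> turns statements about an apex in place 2 into
    statements about the one stored in \<open>b\<close>; the apex in \<open>g\<close> is not
    affected.\<close>
  have s2: "sub 2 b (sub 2 g (C ?k)) = sub 2 g (C ?k)"
    by (rule sub_fix) auto
  have "le ?f (sub 2 b (C ?j) \<odot> sub 2 b (sub 2 g (C ?k)))"
    unfolding s2 using fj fk by (intro le_meetI) auto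
  then have "le ?f (sub 2 b (C ?j \<odot> sub 2 g (C ?k)))" by (simp add: sub_meet)
  then have fR2: "le ?f (sub 2 b (sub 1 g (R ?j ?k)))"
    by (rule le_trans[OF _ sub_mono[OF apexes_red]]) auto
  \<comment> \<open>The wanted facet is reached by two renamings, so the density of ranks has to be
    carried through both.\<close>
  have "\<exists>y \<in> sub 1 g ` insert (\<ominus> R ?j ?k) (range (E ?j ?k)). ?f \<odot> sub 2 b y \<noteq> \<zero>"
  proof (rule sub_meets_dense)
    show "\<exists>y\<in>sub 1 g ` insert (\<ominus> R ?j ?k) (range (E ?j ?k)). z \<odot> y \<noteq> \<zero>"
      if z: "z \<in> carrier A" "z \<noteq> \<zero>" for z
    proof -
      have "\<exists>y \<in> insert (\<ominus> R ?j ?k) (range (E ?j ?k)). z \<odot> sub 1 g y \<noteq> \<zero>"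
        by (rule sub_meets_dense[OF _ _ _ _ z dense]) auto
      then show ?thesis by blast
    qed
  qed (use f0 in auto)
  then obtain y where y: "y \<in> insert (\<ominus> R ?j ?k) (range (E ?j ?k))"
    and fy: "?f \<odot> sub 2 b (sub 1 g y) \<noteq> \<zero>" by blast
  have "sub 1 g (R ?j ?k) \<odot> sub 1 g (\<ominus> R ?j ?k) = \<zero>" by (rule sub_compl) auto
  then have "sub 2 b (sub 1 g (R ?j ?k)) \<odot> sub 2 b (sub 1 g (\<ominus> R ?j ?k)) = \<zero>" by (simp flip: sub_meet)
  then have "?f \<odot> sub 2 b (sub 1 g (\<ominus> R ?j ?k)) = \<zero>"
    by (intro le_zero_meet[OF fR2]) auto
  then obtain q where yq: "y = E ?j ?k q" using y fy by auto
  let ?Eq = "sub 2 b (sub 1 g (E ?j ?k q))"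
  let ?h = "?f \<odot> ?Eq"
  have h0: "?h \<noteq> \<zero>" using fy yq by simp
  have hf: "le ?h ?f" and hE: "le ?h ?Eq" by (auto intro: meet_le1 meet_le2)
  \<comment> \<open>The rank rule is about places 0, 1, 2. All three red facets are therefore
    brought to the form \<open>sub 1 b (sub 0 g _)\<close>, which reads place 1 at \<open>b\<close>
    and place 0 at \<open>g\<close>.\<close>
  have E1: "sub 1 g (E ?j ?k q) = sub 0 g (sub 1 0 (E ?j ?k q))"
    using fix01(5) by (simp add: sub_sub_chain)
  have "le (sub 2 b (sub 1 g (E ?j ?k q))) (sub 1 b (sub 0 g (F ?j ?k q)))"
  proof (rule le_sub_transfer)
    have "sub 2 1 (sub 1 g (E ?j ?k q)) = sub 0 g (sub 2 1 (sub 1 0 (E ?j ?k q)))"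
      unfolding E1 by (rule sub_sub_commute) auto
    then show "le (sub 2 1 (sub 1 g (E ?j ?k q))) (sub 0 g (F ?j ?k q))"
      using shift(5) by (simp add: sub_mono)
  qed auto
  then have hF: "le ?h (sub 1 b (sub 0 g (F ?j ?k q)))" by (rule le_trans[OF hE]) auto
  have hEp: "le ?h (sub 1 b (sub 0 g (E i ?j p)))"
  proof -
    have "sub 0 g (E i ?j p) = E i ?j p" using fix01(5) by (intro sub_fix) auto
    moreover have "le ?h (sub 1 b (E i ?j p))" by (rule le_trans[OF hf fE]) auto
    ultimately show ?thesis by simp
  qed
  have "le (sub 1 g (R i ?k)) (sub 0 g (R' i ?k))"
    using fix01(4) shift(4) by (intro le_sub_transfer) auto
  then have "le ?h (sub 0 g (R' i ?k))"
    by (rule le_trans[OF le_trans[OF hf fR1], rotated 3]) auto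
  moreover have "sub 1 b (sub 0 g (R' i ?k)) = sub 0 g (R' i ?k)"
    using fix01(6) by (intro sub_fix cyl_sub_fix) auto
  ultimately have hR: "le ?h (sub 1 b (sub 0 g (R' i ?k)))" by simp
  have "le ?h (sub 1 b (sub 0 g (E i ?j p)) \<odot> (sub 1 b (sub 0 g (F ?j ?k q)) \<odot> sub 1 b (sub 0 g (R' i ?k))))"
    using hF hEp hR by (intro le_meetI) auto
  then have "le ?h (sub 1 b (sub 0 g (E i ?j p \<odot> (F ?j ?k q \<odot> R' i ?k))))"
    by (simp add: sub_meet)
  then have "?h = \<zero>" if "\<not> q < p"
    using rank[OF that, of i] by (intro le_zero) auto
  then have qp: "q < p" using h0 by blast
  note h0
  \<comment> \<open>Reading place \<open>b\<close> at \<open>g\<close> and place 2 at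
    \<open>b\<close> presents the two later apexes as an instance of \<open>ranked\<close>, without
    the apex in place 2.\<close>
  moreover have "le ?h (sub 2 b (sub b g (ranked ?j q)))"
  proof -
    have "sub b g (ranked ?j q) = (C ?j \<odot> sub 2 g (C ?k)) \<odot> sub 1 g (E ?j ?k q)"
      using dimb by (simp add: ranked_def sub_meet sub_fix sub_sub_chain)
    then have "sub 2 b (sub b g (ranked ?j q)) = (sub 2 b (C ?j) \<odot> sub 2 g (C ?k)) \<odot> ?Eq"
      by (simp add: sub_meet s2)
    moreover have "le ?h ((sub 2 b (C ?j) \<odot> sub 2 g (C ?k)) \<odot> ?Eq)"
      by (intro le_meetI le_trans[OF hf fj] le_trans[OF hf fk] hE) auto
    ultimately show ?thesis by simp
  qed
  ultimately have "ranked ?j q \<noteq> \<zero>" using le_zero[of ?h] by fastforce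
  then show ?thesis using qp by blast
qed

lemma ranked_zero: "ranked i p = \<zero>"
  using ranked_descends by (induction p arbitrary: i rule: less_induct) blast

theorem absurd: False
proof -
  have "le (C 0) (cyl A 2 (C 1))" unfolding cone(2)[of 1 0] by (rule cyl_le) auto
  then have nz: "C 0 \<odot> sub 2 b (C 1) \<noteq> \<zero>"
    using cone(1) dimb by (intro meet_sub_nonzero) auto
  let ?x = "C 0 \<odot> sub 2 b (C 1)"
  have r: "le ?x (sub 1 b (R 0 1))" by (rule apexes_red) auto
  have "\<exists>y \<in> insert (\<ominus> R 0 1) (range (E 0 1)). ?x \<odot> sub 1 b y \<noteq> \<zero>"
    by (rule sub_meets_dense[OF _ _ _ _ _ nz dense]) auto
  moreover have "sub 1 b (R 0 1) \<odot> sub 1 b (\<ominus> R 0 1) = \<zero>" by (rule sub_compl) auto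
  then have "?x \<odot> sub 1 b (\<ominus> R 0 1) = \<zero>" by (intro le_zero_meet[OF r]) auto
  ultimately obtain p where "?x \<odot> sub 1 b (E 0 1 p) \<noteq> \<zero>" by auto
  then show False using ranked_zero[of 0 p] by (simp add: ranked_def)
qed

end

section \<open>The algebra of coloured types\<close>

text \<open>The consistency rules are stated over an arbitrary frame of colours so that they apply both
  to the standard colours and to those of the ultrapower. \<open>lt\<close> is the successor relation
  on tints, \<open>sm\<close> compares ranks, and \<open>mem k l\<close> says that a base labelled \<open>l\<close> admits apexes
  of tint \<open>k\<close>.\<close>

record ('k, 'l) frame =
  pp :: 'k
  x0 :: 'k
  x1 :: 'k
  w0 :: 'l
  w1 :: 'l
  gr :: 'l
  red :: "'l \<Rightarrow> bool"
  lt :: "'k \<Rightarrow> 'k \<Rightarrow> bool"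
  sm :: "'l \<Rightarrow> 'l \<Rightarrow> bool"
  mem :: "'k \<Rightarrow> 'l \<Rightarrow> bool"

definition isZ :: "('k, 'l) frame \<Rightarrow> 'k \<Rightarrow> bool" where
  "isZ F k \<longleftrightarrow> k \<noteq> pp F \<and> k \<noteq> x0 F \<and> k \<noteq> x1 F"

text \<open>Each label belongs to the facet opposite the point of the same letter. Hence the chain
  clause compares the facet of the two later tints with that of the two earlier ones, and the last
  clause constrains the base, opposite the apex.\<close>

definition simplex :: "('k, 'l) frame \<Rightarrow> 'k \<Rightarrow> 'k \<Rightarrow> 'k \<Rightarrow> 'l \<Rightarrow> 'l \<Rightarrow> 'l \<Rightarrow> bool" where
  "simplex F ka kb kc la lb lc \<longleftrightarrow>
     (ka = x0 F \<and> isZ F kb \<and> isZ F kc \<and> lb = gr F \<and> lc = gr F \<longrightarrow> la \<noteq> w0 F) \<and>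
     (ka = x1 F \<and> isZ F kb \<and> isZ F kc \<and> lb = gr F \<and> lc = gr F \<longrightarrow> la \<noteq> w1 F) \<and>
     (lt F ka kb \<and> lt F kb kc \<and> red F la \<and> red F lb \<and> red F lc \<longrightarrow> sm F la lc) \<and>
     (ka = x0 F \<and> kb = x1 F \<and> isZ F kc \<and> la = gr F \<and> lb = gr F \<longrightarrow> mem F kc lc)"

text \<open>\<open>lab a i\<close> is the label of the facet omitting the point \<open>i\<close>.\<close>

datatype ('k, 'l) atom = Atom (kd: "nat \<Rightarrow> 'k") (eqv: "nat \<Rightarrow> nat \<Rightarrow> bool") (lab: "nat \<Rightarrow> 'l")

definition apart :: "nat \<Rightarrow> ('k, 'l) atom \<Rightarrow> nat \<Rightarrow> bool" where
  "apart n a i \<longleftrightarrow> (\<forall>j<n. \<forall>j'<n. j \<noteq> i \<longrightarrow> j' \<noteq> i \<longrightarrow> eqv a j j' \<longrightarrow> j = j')"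

lemma apartD: "apart n a i \<Longrightarrow> eqv a j j' \<Longrightarrow> j < n \<Longrightarrow> j' < n \<Longrightarrow> j \<noteq> i \<Longrightarrow> j' \<noteq> i \<Longrightarrow> j = j'"
  unfolding apart_def by blast

definition facet :: "('k, 'l) frame \<Rightarrow> nat \<Rightarrow> ('k, 'l) atom \<Rightarrow> nat \<Rightarrow> bool" where
  "facet F n a i \<longleftrightarrow> apart n a i \<and> card {j. j < n \<and> j \<noteq> i \<and> kd a j \<noteq> pp F} = 2"

text \<open>Labels of sets that are not facets are pinned to \<open>w0\<close>, so a type is
  determined by its meaningful labels. The simplex rules are required only for distinct points with
  exactly three not plain; the facets opposite those three are then the labelled ones.\<close>

definition ok :: "('k, 'l) frame \<Rightarrow> nat \<Rightarrow> ('k, 'l) atom \<Rightarrow> bool" where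
  "ok F n a \<longleftrightarrow>
     (\<forall>i<n. eqv a i i) \<and>
     (\<forall>i<n. \<forall>j<n. eqv a i j \<longrightarrow> eqv a j i) \<and>
     (\<forall>i<n. \<forall>j<n. \<forall>m<n. eqv a i j \<longrightarrow> eqv a j m \<longrightarrow> eqv a i m) \<and>
     (\<forall>i<n. \<forall>j<n. eqv a i j \<longrightarrow> kd a i = kd a j) \<and>
     (\<forall>i<n. \<forall>j<n. i \<noteq> j \<longrightarrow> eqv a i j \<longrightarrow> lab a i = lab a j) \<and>
     (\<forall>i<n. \<not> facet F n a i \<longrightarrow> lab a i = w0 F) \<and>
     (\<forall>i<n. \<forall>b<n. \<forall>c<n. facet F n a i \<longrightarrow> i \<noteq> b \<longrightarrow> i \<noteq> c \<longrightarrow> b \<noteq> c \<longrightarrow> isZ F (kd a b) \<longrightarrow> isZ F (kd a c) \<longrightarrow>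
        lab a i = w0 F \<or> lab a i = w1 F \<or> red F (lab a i)) \<and>
     ((\<forall>i<n. \<forall>j<n. eqv a i j \<longrightarrow> i = j) \<longrightarrow> card {j. j < n \<and> kd a j \<noteq> pp F} = 3 \<longrightarrow>
       (\<forall>i<n. \<forall>b<n. \<forall>c<n. i \<noteq> b \<longrightarrow> i \<noteq> c \<longrightarrow> b \<noteq> c \<longrightarrow>
         simplex F (kd a i) (kd a b) (kd a c) (lab a i) (lab a b) (lab a c)))"

lemma okD:
  assumes ok: "ok F n a" and "i < n" "j < n"
  shows "eqv a i i" "eqv a i j \<Longrightarrow> eqv a j i" "m < n \<Longrightarrow> eqv a i j \<Longrightarrow> eqv a j m \<Longrightarrow> eqv a i m"
    "eqv a i j \<Longrightarrow> kd a i = kd a j" "i \<noteq> j \<Longrightarrow> eqv a i j \<Longrightarrow> lab a i = lab a j"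
    "\<not> facet F n a i \<Longrightarrow> lab a i = w0 F"
    "b < n \<Longrightarrow> c < n \<Longrightarrow> facet F n a i \<Longrightarrow> i \<noteq> b \<Longrightarrow> i \<noteq> c \<Longrightarrow> b \<noteq> c \<Longrightarrow> isZ F (kd a b) \<Longrightarrow> isZ F (kd a c) \<Longrightarrow>
        lab a i = w0 F \<or> lab a i = w1 F \<or> red F (lab a i)"
    "\<lbrakk>\<forall>i<n. \<forall>j<n. eqv a i j \<longrightarrow> i = j; card {j. j < n \<and> kd a j \<noteq> pp F} = 3; b < n; c < n; i \<noteq> b; i \<noteq> c; b \<noteq> c\<rbrakk> \<Longrightarrow>
        simplex F (kd a i) (kd a b) (kd a c) (lab a i) (lab a b) (lab a c)"
  using assms(2,3) ok[unfolded ok_def, THEN conjunct1]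
    ok[unfolded ok_def, THEN conjunct2, THEN conjunct1]
    ok[unfolded ok_def, THEN conjunct2, THEN conjunct2, THEN conjunct1]
    ok[unfolded ok_def, THEN conjunct2, THEN conjunct2, THEN conjunct2, THEN conjunct1]
    ok[unfolded ok_def, THEN conjunct2, THEN conjunct2, THEN conjunct2, THEN conjunct2, THEN conjunct1]
    ok[unfolded ok_def, THEN conjunct2, THEN conjunct2, THEN conjunct2, THEN conjunct2, THEN conjunct2, THEN conjunct1]
    ok[unfolded ok_def, THEN conjunct2, THEN conjunct2, THEN conjunct2, THEN conjunct2, THEN conjunct2, THEN conjunct2, THEN conjunct1]
    ok[unfolded ok_def, THEN conjunct2, THEN conjunct2, THEN conjunct2, THEN conjunct2, THEN conjunct2, THEN conjunct2, THEN conjunct2]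
  by meson+

text \<open>Among the facets only the one omitting \<open>i\<close> avoids the point in place
  \<open>i\<close>, so it is the only label that must be shared.\<close>

definition agree :: "nat \<Rightarrow> ('k, 'l) atom \<Rightarrow> ('k, 'l) atom \<Rightarrow> bool" where
  "agree i a b \<longleftrightarrow> (\<forall>j. j \<noteq> i \<longrightarrow> kd a j = kd b j) \<and>
     (\<forall>j j'. j \<noteq> i \<longrightarrow> j' \<noteq> i \<longrightarrow> eqv a j j' = eqv b j j') \<and> lab a i = lab b i"

datatype sort = SP | SX0 | SX1 | SZ nat
text \<open>\<open>LB\<close> and \<open>LY ks\<close> are meant for bases. \<open>LB\<close> admits
  every tint, so that all cones can stand over one base; \<open>LY ks\<close> admits only the listed
  tints, so that a base can record which apexes it has.\<close>

datatype label = LW0 | LW1 | LG | LB | LY "sort list" | LR nat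

instance sort :: countable by countable_datatype
instance label :: countable by countable_datatype

definition std :: "(sort, label) frame" where
  "std = \<lparr>pp = SP, x0 = SX0, x1 = SX1, w0 = LW0, w1 = LW1, gr = LG, red = (\<lambda>l. l \<in> range LR),
     lt = (\<lambda>k k'. \<exists>i. k = SZ i \<and> k' = SZ (Suc i)),
     sm = (\<lambda>l l'. \<exists>q p. l = LR q \<and> l' = LR p \<and> q < p),
     mem = (\<lambda>k l. l = LB \<or> (\<exists>ks. l = LY ks \<and> k \<in> set ks))\<rparr>"

lemma std_simps [simp]: "pp std = SP" "x0 std = SX0" "x1 std = SX1" "w0 std = LW0" "w1 std = LW1" "gr std = LG"
  by (simp_all add: std_def)

lemma std_rel: "red std l \<longleftrightarrow> l \<in> range LR" "lt std k k' \<longleftrightarrow> (\<exists>i. k = SZ i \<and> k' = SZ (Suc i))"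
  "sm std l l' \<longleftrightarrow> (\<exists>q p. l = LR q \<and> l' = LR p \<and> q < p)"
  "mem std k l \<longleftrightarrow> l = LB \<or> (\<exists>ks. l = LY ks \<and> k \<in> set ks)"
  by (simp_all add: std_def)

lemma std_isZ: "isZ std k \<longleftrightarrow> (\<exists>i. k = SZ i)"
  by (cases k) (auto simp: isZ_def)

definition At :: "nat \<Rightarrow> (sort, label) atom set" where
  "At n = {a. ok std n a \<and> (\<forall>i\<ge>n. kd a i = SP \<and> lab a i = LW0) \<and> (\<forall>i j. eqv a i j \<longrightarrow> i < n \<and> j < n)}"

definition Cm :: "nat \<Rightarrow> (sort, label) atom set cyl_alg" where
  "Cm n = \<lparr>carrier = Pow (At n), join = (\<union>), meet = (\<inter>), compl = (\<lambda>X. At n - X), zero = {}, one = At n,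
     cyl = (\<lambda>i X. {a \<in> At n. \<exists>b\<in>X. agree i a b}), diag = (\<lambda>i j. {a \<in> At n. eqv a i j})\<rparr>"

definition edges :: "nat \<Rightarrow> nat \<Rightarrow> (nat \<Rightarrow> sort) \<Rightarrow> label set \<Rightarrow> (sort, label) atom set" where
  "edges n o' K Q = {a \<in> At n. apart n a o' \<and> (\<forall>j<n. j \<noteq> o' \<longrightarrow> kd a j = K j) \<and> lab a o' \<in> Q}"

definition pat :: "sort list \<Rightarrow> nat \<Rightarrow> sort" where
  "pat ks j = (if j < length ks then ks ! j else SP)"

definition palette :: "label set set" where
  "palette = {{LG}, {LB}, {LW1}, range LR, insert LW1 (range LR), insert LW0 (range LR)} \<union> range (\<lambda>p. {LR p})"

definition gens :: "nat \<Rightarrow> (sort, label) atom set set" where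
  "gens n = (\<lambda>a. {a}) ` At n \<union> (\<lambda>(o', ks, Q). edges n o' (pat ks) Q) ` (UNIV \<times> UNIV \<times> palette)"

text \<open>In place of the full complex algebra this takes the subalgebra generated by the atoms
  and by the sets of facets used in the descent. Being the set of values of terms under one
  enumeration of generators, it is countable and has a copy in every infinite type.\<close>

definition Alg :: "nat \<Rightarrow> (sort, label) atom set cyl_alg" where
  "Alg n = (Cm n)\<lparr>carrier := range (eval_term (Cm n) (from_nat_into (gens n)))\<rparr>"

lemma countable_At: "countable (At n)"
proof -
  let ?f = "\<lambda>(ks, es, ls). Atom (\<lambda>i. if i < n then ks ! i else SP) (\<lambda>i j. (i, j) \<in> set es)
    (\<lambda>i. if i < n then ls ! i else LW0)"
  have "At n \<subseteq> range (?f :: sort list \<times> (nat \<times> nat) list \<times> label list \<Rightarrow> _)"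
  proof
    fix a assume a: "a \<in> At n"
    have "{(i, j). eqv a i j} \<subseteq> {..<n} \<times> {..<n}" using a by (auto simp: At_def)
    then have "finite {(i, j). eqv a i j}" by (rule finite_subset) simp
    then obtain es where es: "set es = {(i, j). eqv a i j}" using finite_list by metis
    have "a = ?f (map (kd a) [0..<n], es, map (lab a) [0..<n])"
      using a es by (cases a) (auto simp: At_def fun_eq_iff)
    then show "a \<in> range ?f" by (rule range_eqI)
  qed
  then show ?thesis by (rule countable_subset) simp
qed

lemma countable_gens: "countable (gens n)"
proof -
  have "countable palette" by (simp add: palette_def)
  then show ?thesis by (simp add: gens_def countable_At)
qed

lemma gens_nonempty: "gens n \<noteq> {}"
  by (auto simp: gens_def palette_def)

lemma gens_subset: "X \<in> gens n \<Longrightarrow> X \<subseteq> At n"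
  by (auto simp: gens_def edges_def)

lemma carrier_Alg_subset: "X \<in> carrier (Alg n) \<Longrightarrow> X \<subseteq> At n"
proof -
  have "eval_term (Cm n) (from_nat_into (gens n)) t \<subseteq> At n" for t
    using from_nat_into[OF gens_nonempty] gens_subset by (induction t) (auto simp: Cm_def)
  then show "X \<in> carrier (Alg n) \<Longrightarrow> X \<subseteq> At n" by (auto simp: Alg_def)
qed

instance cyl_term :: countable by countable_datatype

lemma countable_Alg: "countable (carrier (Alg n))"
  by (simp add: Alg_def)

lemma gens_Alg: "X \<in> gens n \<Longrightarrow> X \<in> carrier (Alg n)"
proof -
  assume "X \<in> gens n"
  then obtain m where "X = from_nat_into (gens n) m"
    using range_from_nat_into[OF gens_nonempty countable_gens] by (metis rangeE)
  then have "X = eval_term (Cm n) (from_nat_into (gens n)) (Var m)" by simp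
  then have "X \<in> range (eval_term (Cm n) (from_nat_into (gens n)))" by (rule range_eqI)
  then show ?thesis by (simp add: Alg_def)
qed

lemma edges_Alg: "Q \<in> palette \<Longrightarrow> edges n o' (pat ks) Q \<in> carrier (Alg n)"
  by (rule gens_Alg) (auto simp: gens_def)

lemma atom_Alg: "a \<in> At n \<Longrightarrow> {a} \<in> carrier (Alg n)"
  by (rule gens_Alg) (auto simp: gens_def)

lemma Alg_simps [simp]:
  "X \<oplus>\<^bsub>Alg n\<^esub> Y = X \<union> Y" "X \<odot>\<^bsub>Alg n\<^esub> Y = X \<inter> Y" "\<ominus>\<^bsub>Alg n\<^esub> X = At n - X" "\<zero>\<^bsub>Alg n\<^esub> = {}"
  "\<one>\<^bsub>Alg n\<^esub> = At n" "cyl (Alg n) i X = {a \<in> At n. \<exists>b\<in>X. agree i a b}" "diag (Alg n) i j = {a \<in> At n. eqv a i j}"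
  by (simp_all add: Alg_def Cm_def)

lemma Alg_closed:
  "X \<in> carrier (Alg n) \<Longrightarrow> Y \<in> carrier (Alg n) \<Longrightarrow> X \<union> Y \<in> carrier (Alg n)"
  "X \<in> carrier (Alg n) \<Longrightarrow> Y \<in> carrier (Alg n) \<Longrightarrow> X \<inter> Y \<in> carrier (Alg n)"
  "X \<in> carrier (Alg n) \<Longrightarrow> At n - X \<in> carrier (Alg n)"
  "{} \<in> carrier (Alg n)" "At n \<in> carrier (Alg n)"
  "X \<in> carrier (Alg n) \<Longrightarrow> {a \<in> At n. \<exists>b\<in>X. agree i a b} \<in> carrier (Alg n)"
  "{a \<in> At n. eqv a i j} \<in> carrier (Alg n)"
proof -
  have *: "X \<in> carrier (Alg n) \<longleftrightarrow> (\<exists>t. X = eval_term (Cm n) (from_nat_into (gens n)) t)" for X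
    by (auto simp: Alg_def)
  show "X \<in> carrier (Alg n) \<Longrightarrow> Y \<in> carrier (Alg n) \<Longrightarrow> X \<union> Y \<in> carrier (Alg n)"
    unfolding * by (elim exE, rule_tac x = "Join t ta" in exI) (simp add: Cm_def)
  show "X \<in> carrier (Alg n) \<Longrightarrow> Y \<in> carrier (Alg n) \<Longrightarrow> X \<inter> Y \<in> carrier (Alg n)"
    unfolding * by (elim exE, rule_tac x = "Meet t ta" in exI) (simp add: Cm_def)
  show "X \<in> carrier (Alg n) \<Longrightarrow> At n - X \<in> carrier (Alg n)"
    unfolding * by (elim exE, rule_tac x = "Compl t" in exI) (simp add: Cm_def)
  show "{} \<in> carrier (Alg n)" unfolding * by (rule exI[of _ Zero]) (simp add: Cm_def)
  show "At n \<in> carrier (Alg n)" unfolding * by (rule exI[of _ One]) (simp add: Cm_def)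
  show "X \<in> carrier (Alg n) \<Longrightarrow> {a \<in> At n. \<exists>b\<in>X. agree i a b} \<in> carrier (Alg n)"
    unfolding * by (elim exE, rule_tac x = "Cyl i t" in exI) (simp add: Cm_def)
  show "{a \<in> At n. eqv a i j} \<in> carrier (Alg n)"
    unfolding * by (rule exI[of _ "Diag i j"]) (simp add: Cm_def)
qed

lemma cyl_structure_Alg: "cyl_structure n (Alg n)"
  by unfold_locales (simp_all add: Alg_closed)

lemma agree_sym: "agree i a b \<Longrightarrow> agree i b a"
  by (auto simp: agree_def)

lemma agree_refl [simp]: "agree i a a"
  by (auto simp: agree_def)

lemma agree_apart: "agree i a b \<Longrightarrow> apart n a i \<longleftrightarrow> apart n b i"
  unfolding apart_def by (rule all_cong1, rule imp_cong, rule refl, rule all_cong1) (auto simp: agree_def)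

lemma cyl_edges: "cyl (Alg n) i (edges n i K Q) = edges n i K Q"
proof -
  have "a \<in> edges n i K Q" if "a \<in> At n" "b \<in> edges n i K Q" "agree i a b" for a b
    using that agree_apart[OF that(3)] by (auto simp: edges_def agree_def)
  moreover have "edges n i K Q \<subseteq> At n" by (auto simp: edges_def)
  ultimately show ?thesis by (auto intro: agree_refl)
qed

text \<open>In a type that identifies places \<open>x\<close> and \<open>y\<close>, the facets
  omitting \<open>x\<close> and omitting \<open>y\<close> are the same set of points and carry the
  same label. What remains is that the points off \<open>x\<close> are again distinct.\<close>

lemma sub_edges:
  assumes "x \<noteq> y" "x < n" "y < n"
  shows "cyl (Alg n) x (diag (Alg n) x y \<odot>\<^bsub>Alg n\<^esub> edges n y K Q) \<subseteq> edges n x (K(y := K x)) Q"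
proof
  fix a assume "a \<in> cyl (Alg n) x (diag (Alg n) x y \<odot>\<^bsub>Alg n\<^esub> edges n y K Q)"
  then obtain b where ab: "a \<in> At n" "agree x a b" and e: "eqv b x y" and b: "b \<in> edges n y K Q" by auto
  have bA: "b \<in> At n" and apb: "apart n b y" and kb: "\<And>j. j < n \<Longrightarrow> j \<noteq> y \<Longrightarrow> kd b j = K j" and lb: "lab b y \<in> Q"
    using b by (auto simp: edges_def)
  have ok: "ok std n b" using bA by (simp add: At_def)
  have kxy: "kd b x = kd b y" and lxy: "lab b x = lab b y"
    using okD(4,5)[OF ok] e assms by blast+
  have tr: "eqv b x m" if "eqv b y m" "m < n" for m
    using okD(3)[OF ok] e that assms by blast
  have sy: "eqv b j i" if "eqv b i j" "i < n" "j < n" for i j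
    using okD(2)[OF ok] that by blast
  have "apart n b x" unfolding apart_def
  proof (intro allI impI)
    fix j j' assume j: "j < n" "j' < n" "j \<noteq> x" "j' \<noteq> x" "eqv b j j'"
    show "j = j'"
    proof (rule ccontr)
      assume "j \<noteq> j'"
      then consider "j = y" "j' \<noteq> y" | "j' = y" "j \<noteq> y" using apartD[OF apb j(5)] j by blast
      then show False
      proof cases
        case 1
        then have "eqv b x j'" using tr j by blast
        then show False using apartD[OF apb, of x j'] 1 j assms by blast
      next
        case 2
        then have "eqv b x j" using tr sy j by blast
        then show False using apartD[OF apb, of x j] 2 j assms by blast
      qed
    qed
  qed
  then have "apart n a x" using agree_apart[OF ab(2)] by blast
  moreover have "kd a j = (K(y := K x)) j" if "j < n" "j \<noteq> x" for j
  proof -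
    have "kd a j = kd b j" using ab(2) that by (simp add: agree_def)
    then show ?thesis using kb[of j] kb[of x] kxy that assms by simp
  qed
  moreover have "lab a x \<in> Q" using ab(2) lb lxy by (simp add: agree_def)
  ultimately show "a \<in> edges n x (K(y := K x)) Q" using ab(1) by (simp add: edges_def)
qed

section \<open>Cones and the colour rules as inclusions between elements\<close>

definition cone :: "nat \<Rightarrow> nat \<Rightarrow> (sort, label) atom set" where
  "cone n i = edges n 1 (pat [SX0, SP, SZ i]) {LG} \<inter> edges n 0 (pat [SP, SX1, SZ i]) {LG} \<inter> edges n 2 (pat [SX0, SX1]) {LB}"

definition cone_atom :: "nat \<Rightarrow> nat \<Rightarrow> (sort, label) atom" where
  "cone_atom n i = Atom (pat [SX0, SX1, SZ i]) (\<lambda>i j. i = j \<and> i < n) (\<lambda>j. if j = 0 \<or> j = 1 then LG else if j = 2 then LB else LW0)"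

lemma pat_simps: "pat [a, b, c] j = (if j = 0 then a else if j = 1 then b else if j = 2 then c else SP)"
  "pat [a, b] j = (if j = 0 then a else if j = 1 then b else SP)"
  by (auto simp: pat_def nth_Cons split: nat.splits)

lemma cone_atom_At: assumes "2 < n" shows "cone_atom n i \<in> At n"
proof -
  have ap: "apart n (cone_atom n i) j" for j by (simp add: apart_def cone_atom_def)
  have k: "kd (cone_atom n i) j \<noteq> SP \<longleftrightarrow> j = 0 \<or> j = 1 \<or> j = 2" for j
    by (simp add: cone_atom_def pat_simps)
  have "{j. j < n \<and> j \<noteq> 0 \<and> kd (cone_atom n i) j \<noteq> SP} = {1, 2}"
    "{j. j < n \<and> j \<noteq> 1 \<and> kd (cone_atom n i) j \<noteq> SP} = {0, 2}"
    "{j. j < n \<and> j \<noteq> 2 \<and> kd (cone_atom n i) j \<noteq> SP} = {0, 1}"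
    using assms by (auto simp: k)
  then have "facet std n (cone_atom n i) 0" "facet std n (cone_atom n i) 1" "facet std n (cone_atom n i) 2"
    by (simp_all add: facet_def ap)
  then have f: "facet std n (cone_atom n i) j" if "j = 0 \<or> j = 1 \<or> j = 2" for j using that by blast
  have l: "lab (cone_atom n i) j = LW0" if "\<not> (j = 0 \<or> j = 1 \<or> j = 2)" for j
    using that by (simp add: cone_atom_def)
  have "ok std n (cone_atom n i)"
    unfolding ok_def
  proof (intro conjI)
    show "\<forall>j<n. \<not> facet std n (cone_atom n i) j \<longrightarrow> lab (cone_atom n i) j = w0 std"
      using f l std_simps(4) by metis
    show "(\<forall>j<n. \<forall>m<n. eqv (cone_atom n i) j m \<longrightarrow> j = m) \<longrightarrow> card {j. j < n \<and> kd (cone_atom n i) j \<noteq> pp std} = 3 \<longrightarrow>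
      (\<forall>j<n. \<forall>b<n. \<forall>c<n. j \<noteq> b \<longrightarrow> j \<noteq> c \<longrightarrow> b \<noteq> c \<longrightarrow>
         simplex std (kd (cone_atom n i) j) (kd (cone_atom n i) b) (kd (cone_atom n i) c)
           (lab (cone_atom n i) j) (lab (cone_atom n i) b) (lab (cone_atom n i) c))"
      by (auto simp: simplex_def cone_atom_def pat_simps std_isZ std_rel)
  qed (auto simp: cone_atom_def std_isZ pat_simps split: if_splits)
  then show ?thesis using assms by (auto simp: At_def cone_atom_def pat_simps)
qed

text \<open>The three labels leave no freedom. A facet omitting a place beyond 2 would contain three
  points that are not plain, so its label is the default one, and the sort of place 0 keeps it apart
  from all other points.\<close>

lemma cone_eq: assumes "2 < n" shows "a \<in> cone n i \<longleftrightarrow> a = cone_atom n i"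
proof
  assume a: "a \<in> cone n i"
  then have At: "a \<in> At n" and ap: "apart n a 0" "apart n a 1" "apart n a 2"
    and k: "\<And>j. j < n \<Longrightarrow> kd a j = pat [SX0, SX1, SZ i] j" and l: "lab a 0 = LG" "lab a 1 = LG" "lab a 2 = LB"
    using assms by (auto simp: cone_def edges_def pat_simps)
  have ok: "ok std n a" using At by (simp add: At_def)
  have e: "eqv a j m \<longleftrightarrow> j = m \<and> j < n" for j m
  proof
    assume e: "eqv a j m"
    then have jm: "j < n" "m < n" using At by (auto simp: At_def)
    have "kd a j = kd a m" using okD(4)[OF ok] e jm by blast
    then have "(j = 0 \<longleftrightarrow> m = 0)" using k jm by (auto simp: pat_simps split: if_splits)
    then have "j = m" using apartD[OF ap(1) e] jm by blast
    then show "j = m \<and> j < n" using jm by simp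
  qed (use okD(1)[OF ok] in auto)
  have "\<not> facet std n a j" if "j < n" "j \<noteq> 0" "j \<noteq> 1" "j \<noteq> 2" for j
  proof -
    have "{m. m < n \<and> m \<noteq> j \<and> kd a m \<noteq> SP} = {0, 1, 2}" using that k assms by (auto simp: pat_simps split: if_splits)
    then show ?thesis by (simp add: facet_def)
  qed
  then have l': "lab a j = LW0" if "j < n" "j \<noteq> 0" "j \<noteq> 1" "j \<noteq> 2" for j
    using okD(6)[OF ok] that by simp
  have kn: "kd a j = pat [SX0, SX1, SZ i] j" for j
    using k[of j] At assms by (cases "j < n") (auto simp: At_def pat_simps)
  have ln: "lab a j = lab (cone_atom n i) j" for j
    using l l'[of j] At assms by (cases "j < n") (auto simp: At_def cone_atom_def)
  show "a = cone_atom n i"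
    using kn ln e by (cases a) (simp add: cone_atom_def fun_eq_iff)
next
  assume "a = cone_atom n i"
  then show "a \<in> cone n i"
    using cone_atom_At[OF assms, of i] assms by (auto simp: cone_def edges_def apart_def pat_simps) (auto simp: cone_atom_def pat_simps)
qed

text \<open>The label \<open>LB\<close> of the base does not depend on the tint, so all cone atoms
  agree off place 2. This puts apexes of every tint over one base.\<close>

lemma cyl_cone: assumes "2 < n" shows "cyl (Alg n) 2 (cone n i) = cyl (Alg n) 2 (cone n j)"
proof -
  have "agree 2 a (cone_atom n i) \<longleftrightarrow> agree 2 a (cone_atom n j)" for a
    by (auto simp: agree_def cone_atom_def pat_simps)
  then show ?thesis using cone_eq[OF assms] by auto
qed

text \<open>A facet with two tinted points is white or red by \<open>ok\<close>; the base point
  opposite to it, joined to both apexes by green facets, removes one of the whites.\<close>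

lemma green_green:
  assumes n: "2 < n" and ij: "i \<noteq> j"
  shows "edges n 1 (pat [SX0, SP, SZ i]) {LG} \<inter> edges n 2 (pat [SX0, SZ j]) {LG} \<subseteq>
      edges n 0 (pat [SP, SZ j, SZ i]) (insert LW1 (range LR))" (is ?A)
    "edges n 0 (pat [SP, SX1, SZ i]) {LG} \<inter> edges n 2 (pat [SZ j, SX1]) {LG} \<subseteq>
      edges n 1 (pat [SZ j, SP, SZ i]) (insert LW0 (range LR))" (is ?B)
proof -
  have inj: "\<forall>x<n. \<forall>y<n. eqv a x y \<longrightarrow> x = y" if "a \<in> At n" "apart n a o'" "apart n a 2" "o' \<noteq> 2"
    "kd a o' \<noteq> kd a 2" "o' < n" for a o'
  proof (intro allI impI)
    fix x y assume xy: "x < n" "y < n" "eqv a x y"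
    have e: "eqv a y x" "kd a x = kd a y" using okD(2,4)[of std n a x y] that(1) xy by (auto simp: At_def)
    show "x = y"
    proof (rule ccontr)
      assume "x \<noteq> y"
      then have "x = 2 \<and> y = o' \<or> x = o' \<and> y = 2" using apartD[OF that(2) xy(3)] apartD[OF that(3) xy(3)] xy that(4) by blast
      then show False using e that by auto
    qed
  qed
  \<comment> \<open>One argument serves both inclusions: \<open>z\<close> is the place of the base
    point and \<open>x\<close> that of the second apex, the first being in place 2.\<close>
  have key: "lab a z \<in> insert (if z = 0 then LW1 else LW0) (range LR) \<and> apart n a z"
    if a: "a \<in> At n" and inj: "\<forall>x<n. \<forall>y<n. eqv a x y \<longrightarrow> x = y"
      and k: "\<forall>y<n. kd a y = pat ks y" and gl: "lab a x = LG" "lab a 2 = LG"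
      and ks: "ks = [SX0, SZ j, SZ i] \<and> z = 0 \<and> x = 1 \<or> ks = [SZ j, SX1, SZ i] \<and> z = 1 \<and> x = 0" for a ks z x
  proof -
    have ok: "ok std n a" using a by (simp add: At_def)
    have ap: "apart n a y" for y using inj by (auto simp: apart_def)
    have kP: "kd a y \<noteq> SP \<longleftrightarrow> y = 0 \<or> y = 1 \<or> y = 2" if "y < n" for y
    proof -
      have "kd a y = pat ks y" using k that by blast
      then show ?thesis using ks by (elim disjE conjE) (simp_all add: pat_simps)
    qed
    have "{y. y < n \<and> y \<noteq> z \<and> kd a y \<noteq> SP} = {y. y < n \<and> y \<noteq> z \<and> (y = 0 \<or> y = 1 \<or> y = 2)}"
      using kP by blast
    also have "\<dots> = {x, 2}"
    proof -
      have "z = 0 \<and> x = 1 \<or> z = 1 \<and> x = 0" using ks by blast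
      then show ?thesis using n by (elim disjE) auto
    qed
    finally have S: "{y. y < n \<and> y \<noteq> z \<and> kd a y \<noteq> SP} = {x, 2}" .
    have "x \<noteq> 2" using ks by (elim disjE) simp_all
    then have "card {y. y < n \<and> y \<noteq> z \<and> kd a y \<noteq> SP} = 2" unfolding S by simp
    then have f: "facet std n a z" by (simp add: facet_def ap)
    have "{y. y < n \<and> kd a y \<noteq> SP} = {y. y < n \<and> (y = 0 \<or> y = 1 \<or> y = 2)}"
      using kP by blast
    also have "\<dots> = {0, 1, 2}" using n by auto
    finally have c3: "card {y. y < n \<and> kd a y \<noteq> pp std} = 3" by simp
    have lt: "x < n" "z < n" "z \<noteq> x" "z \<noteq> 2" "x \<noteq> 2" using ks n by (elim disjE; simp)+
    have k': "kd a x = pat ks x" "kd a 2 = pat ks 2" "kd a z = pat ks z" using k lt n by simp_all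
    have Z: "isZ std (kd a x)" "isZ std (kd a 2)" using k' ks n by (elim disjE; simp add: std_isZ pat_simps)+
    have 1: "lab a z = LW0 \<or> lab a z = LW1 \<or> red std (lab a z)"
      using okD(7)[OF ok, of z z x 2] f Z lt n by simp
    have 2: "simplex std (kd a z) (kd a x) (kd a 2) (lab a z) (lab a x) (lab a 2)"
      using okD(8)[OF ok lt(2) lt(2) inj c3, of x 2] lt n by simp
    have 3: "lab a z \<noteq> LW0" if "z = 0" using 2 Z gl k' ks that by (simp add: simplex_def pat_simps)
    have 4: "lab a z \<noteq> LW1" if "z = 1" using 2 Z gl k' ks that by (simp add: simplex_def pat_simps)
    show ?thesis using 1 3 4 ks ap by (auto simp: std_rel)
  qed
  show ?A
  proof
    fix a assume "a \<in> edges n 1 (pat [SX0, SP, SZ i]) {LG} \<inter> edges n 2 (pat [SX0, SZ j]) {LG}"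
    then have At: "a \<in> At n" and ap: "apart n a 1" "apart n a 2" and l: "lab a 1 = LG" "lab a 2 = LG"
      and k: "\<forall>y<n. kd a y = pat [SX0, SZ j, SZ i] y" by (auto simp: edges_def pat_simps)
    have "kd a 1 \<noteq> kd a 2" using k ij n by (simp add: pat_simps)
    then have "\<forall>x<n. \<forall>y<n. eqv a x y \<longrightarrow> x = y" using inj[OF At ap] n by simp
    then have "lab a 0 \<in> insert (if (0::nat) = 0 then LW1 else LW0) (range LR) \<and> apart n a 0"
      using At k l by (intro key) auto
    then show "a \<in> edges n 0 (pat [SP, SZ j, SZ i]) (insert LW1 (range LR))"
      using At k by (simp add: edges_def pat_simps)
  qed
  show ?B
  proof
    fix a assume "a \<in> edges n 0 (pat [SP, SX1, SZ i]) {LG} \<inter> edges n 2 (pat [SZ j, SX1]) {LG}"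
    then have At: "a \<in> At n" and ap: "apart n a 0" "apart n a 2" and l: "lab a 0 = LG" "lab a 2 = LG"
      and k: "\<forall>y<n. kd a y = pat [SZ j, SX1, SZ i] y" by (auto simp: edges_def pat_simps)
    have "kd a 0 \<noteq> kd a 2" using k ij n by (simp add: pat_simps)
    then have "\<forall>x<n. \<forall>y<n. eqv a x y \<longrightarrow> x = y" using inj[OF At ap] n by simp
    then have "lab a 1 \<in> insert (if (1::nat) = 0 then LW1 else LW0) (range LR) \<and> apart n a 1"
      using At k l by (intro key) auto
    then show "a \<in> edges n 1 (pat [SZ j, SP, SZ i]) (insert LW0 (range LR))"
      using At k by (simp add: edges_def pat_simps)
  qed
qed

lemma red_triangle:
  assumes n: "2 < n" and qp: "\<not> q < p"
  shows "edges n 0 (pat [SP, SZ (Suc i), SZ i]) {LR p} \<inter> edges n 2 (pat [SZ (Suc (Suc i)), SZ (Suc i)]) {LR q} \<inter>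
    edges n 1 (pat [SZ (Suc (Suc i)), SP, SZ i]) (range LR) = {}"
proof (rule ccontr)
  assume "\<not> ?thesis"
  then obtain a where a: "a \<in> edges n 0 (pat [SP, SZ (Suc i), SZ i]) {LR p}"
    "a \<in> edges n 2 (pat [SZ (Suc (Suc i)), SZ (Suc i)]) {LR q}"
    "a \<in> edges n 1 (pat [SZ (Suc (Suc i)), SP, SZ i]) (range LR)" by auto
  then have At: "a \<in> At n" and ap: "apart n a 0" "apart n a 1" "apart n a 2"
    and l: "lab a 0 = LR p" "lab a 2 = LR q" "lab a 1 \<in> range LR"
    unfolding edges_def by blast+
  have k: "kd a y = pat [SZ (Suc (Suc i)), SZ (Suc i), SZ i] y" if "y < n" for y
    using a(1,3) that by (cases "y = 0") (simp_all add: edges_def pat_simps)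
  have ok: "ok std n a" using At by (simp add: At_def)
  have inj: "\<forall>x<n. \<forall>y<n. eqv a x y \<longrightarrow> x = y"
  proof (intro allI impI)
    fix x y assume xy: "x < n" "y < n" "eqv a x y"
    have "kd a x = kd a y" using okD(4)[OF ok] xy by blast
    then have "x = 0 \<longleftrightarrow> y = 0" using k xy by (auto simp: pat_simps split: if_splits)
    then show "x = y" using apartD[OF ap(1) xy(3)] xy by blast
  qed
  have "{y. y < n \<and> kd a y \<noteq> SP} = {y. y < n \<and> (y = 0 \<or> y = 1 \<or> y = 2)}"
    using k by (intro Collect_cong conj_cong) (simp_all add: pat_simps)
  also have "\<dots> = {0, 1, 2}" using n by auto
  finally have c3: "card {y. y < n \<and> kd a y \<noteq> pp std} = 3" by simp
  \<comment> \<open>Successive tints sit in places 2, 1, 0, so the chain rule is read in this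
    order.\<close>
  have "simplex std (kd a 2) (kd a 1) (kd a 0) (lab a 2) (lab a 1) (lab a 0)"
    using okD(8)[OF ok n n inj c3, of 1 0] n by simp
  then have "q < p" using l k n by (auto simp: simplex_def std_rel pat_simps)
  then show False using qp by blast
qed

text \<open>Interprets the descent with \<open>n\<close> and \<open>n + 1\<close> as spare places.
  Preservation of sums is what yields density; every other assumption of the descent comes from the
  embedding and from inclusions in \<open>Alg n\<close>.\<close>

lemma no_dilation:
  assumes n: "2 < n" and B: "cylindric_algebra (n + 3) B" and g: "g \<in> cyl_hom n (Alg n) B"
    and inj: "inj_on g (carrier (Alg n))"
    and dim: "\<And>x i. x \<in> carrier (Alg n) \<Longrightarrow> n \<le> i \<Longrightarrow> i < n + 3 \<Longrightarrow> cyl B i (g x) = g x"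
    and sums: "\<And>X. X \<subseteq> carrier (Alg n) \<Longrightarrow> is_sum (Alg n) X (At n) \<Longrightarrow> is_sum B (g ` X) \<one>\<^bsub>B\<^esub>"
  shows False
proof -
  interpret B: cylindric_algebra "n + 3" B by (rule B)
  note cl = Alg_closed
  have hom: "x \<in> carrier (Alg n) \<Longrightarrow> g x \<in> carrier B"
    "x \<in> carrier (Alg n) \<Longrightarrow> y \<in> carrier (Alg n) \<Longrightarrow> g (x \<union> y) = g x \<oplus>\<^bsub>B\<^esub> g y"
    "x \<in> carrier (Alg n) \<Longrightarrow> y \<in> carrier (Alg n) \<Longrightarrow> g (x \<inter> y) = g x \<odot>\<^bsub>B\<^esub> g y"
    "x \<in> carrier (Alg n) \<Longrightarrow> g (At n - x) = \<ominus>\<^bsub>B\<^esub> g x" "g {} = \<zero>\<^bsub>B\<^esub>" "g (At n) = \<one>\<^bsub>B\<^esub>"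
    "i < n \<Longrightarrow> x \<in> carrier (Alg n) \<Longrightarrow> g (cyl (Alg n) i x) = cyl B i (g x)"
    "i < n \<Longrightarrow> j < n \<Longrightarrow> g {a \<in> At n. eqv a i j} = diag B i j" for x y i j
    using g unfolding cyl_hom_def by (auto simp: Pi_def)
  have mono: "B.le (g x) (g y)" if "x \<in> carrier (Alg n)" "y \<in> carrier (Alg n)" "x \<subseteq> y" for x y
    using hom(3)[of x y] that by (simp add: B.le_def Int_absorb2)
  define ed where "ed o' ks Q = g (edges n o' (pat ks) Q)" for o' ks Q
  have edA [simp]: "ed o' ks Q \<in> carrier B" if "Q \<in> palette" for o' ks Q
    using that by (simp add: ed_def hom edges_Alg)
  have edA': "edges n o' (pat ks) Q \<in> carrier (Alg n)" if "Q \<in> palette" for o' ks Q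
    using that by (simp add: edges_Alg)
  have ed_sub: "B.le (B.sub x y (ed y ks Q)) (ed x ks' Q)"
    if "x \<noteq> y" "x < n" "y < n" "Q \<in> palette" "\<And>j. j \<noteq> x \<Longrightarrow> j < n \<Longrightarrow> pat ks' j = ((pat ks)(y := pat ks x)) j"
    for x y ks ks' Q
  proof -
    let ?e = "edges n y (pat ks) Q"
    let ?d = "{a \<in> At n. eqv a x y}"
    have d: "?d \<in> carrier (Alg n)" by (rule cl(7))
    have m: "?d \<inter> ?e \<in> carrier (Alg n)" using d edA' that by (intro cl(2))
    have c: "cyl (Alg n) x (?d \<inter> ?e) \<in> carrier (Alg n)" using cl(6)[OF m] by simp
    have "B.sub x y (ed y ks Q) = g (cyl (Alg n) x (?d \<inter> ?e))"
      unfolding B.sub_def ed_def hom(8)[OF that(2,3), symmetric]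
      by (subst hom(7)[OF that(2) m]) (simp only: hom(3)[OF d edA'[OF that(4)]])
    moreover have "edges n x ((pat ks)(y := pat ks x)) Q = edges n x (pat ks') Q"
      using that(5) unfolding edges_def by auto
    then have "cyl (Alg n) x (?d \<inter> ?e) \<subseteq> edges n x (pat ks') Q"
      using sub_edges[OF that(1-3), of "pat ks" Q] by simp
    ultimately show ?thesis using mono[OF c edA'[OF that(4)]] by (simp add: ed_def)
  qed
  have ed_cyl: "cyl B i (ed i ks Q) = ed i ks Q" if "i < n" "Q \<in> palette" for i ks Q
    using hom(7)[OF that(1) edA'[OF that(2)], of i ks] cyl_edges[of n i "pat ks" Q] by (simp add: ed_def)
  have pal [simp]: "{LG} \<in> palette" "{LB} \<in> palette" "{LW1} \<in> palette" "{LR p} \<in> palette" "range LR \<in> palette"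
    "insert LW1 (range LR) \<in> palette" "insert LW0 (range LR) \<in> palette" for p
    by (auto simp: palette_def)
  have coneA: "cone n i \<in> carrier (Alg n)" for i
    unfolding cone_def by (intro cl(2) edA') simp_all
  have meet_mono: "B.le (ed a ks Q \<odot>\<^bsub>B\<^esub> ed b ks' Q') (ed c ks'' Q'')"
    if "edges n a (pat ks) Q \<inter> edges n b (pat ks') Q' \<subseteq> edges n c (pat ks'') Q''"
      "Q \<in> palette" "Q' \<in> palette" "Q'' \<in> palette" for a b c ks ks' ks'' Q Q' Q''
    using mono[OF cl(2)[OF edA' edA'] edA' that(1)] that by (simp add: ed_def hom edA')
  have dense: "\<exists>y \<in> insert (\<ominus>\<^bsub>B\<^esub> ed 0 ks (range LR)) (range (\<lambda>p. ed 0 ks {LR p})). z \<odot>\<^bsub>B\<^esub> y \<noteq> \<zero>\<^bsub>B\<^esub>"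
    if z: "z \<in> carrier B" "z \<noteq> \<zero>\<^bsub>B\<^esub>" for z ks
  proof (rule ccontr)
    assume neg: "\<not> ?thesis"
    \<comment> \<open>Every red facet in \<open>Alg n\<close> has a standard rank, so the sets of
      fixed rank together with the complement of the red set cover all atoms. Their sum is the unit,
      and a nonzero \<open>z\<close> disjoint from all their images would contradict its
      preservation.\<close>
    define Y where Y: "Y = insert (At n - edges n 0 (pat ks) (range LR)) (range (\<lambda>p. edges n 0 (pat ks) {LR p}))"
    have X: "Y \<subseteq> carrier (Alg n)" unfolding Y using edA' cl(3) by auto
    have "edges n 0 (pat ks) (range LR) = (\<Union>p. edges n 0 (pat ks) {LR p})" by (auto simp: edges_def)
    then have U: "At n \<subseteq> \<Union>Y" unfolding Y by auto
    have "is_sum (Alg n) Y (At n)"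
      unfolding is_sum_def
    proof (intro conjI ballI impI)
      show "At n \<in> carrier (Alg n)" by (rule cl(5))
      show "x \<oplus>\<^bsub>Alg n\<^esub> At n = At n" if "x \<in> Y" for x
      proof -
        have "x \<subseteq> At n" using carrier_Alg_subset X that by blast
        then show ?thesis by (simp add: Un_absorb1)
      qed
      show "At n \<oplus>\<^bsub>Alg n\<^esub> t = t" if "\<forall>x\<in>Y. x \<oplus>\<^bsub>Alg n\<^esub> t = t" for t
      proof -
        have "x \<subseteq> t" if "x \<in> Y" for x
          using bspec[OF \<open>\<forall>x\<in>Y. x \<oplus>\<^bsub>Alg n\<^esub> t = t\<close> that] unfolding Alg_simps by blast
        then have "At n \<subseteq> t" using U by blast
        then show ?thesis by auto
      qed
    qed
    then have "is_sum B (g ` Y) \<one>\<^bsub>B\<^esub>" using sums X by blast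
    moreover have "y \<oplus>\<^bsub>B\<^esub> \<ominus>\<^bsub>B\<^esub> z = \<ominus>\<^bsub>B\<^esub> z" if "y \<in> g ` Y" for y
    proof -
      have "y \<in> insert (\<ominus>\<^bsub>B\<^esub> ed 0 ks (range LR)) (range (\<lambda>p. ed 0 ks {LR p}))"
        using that unfolding ed_def Y by (auto simp: hom(4)[OF edA'])
      then have "z \<odot>\<^bsub>B\<^esub> y = \<zero>\<^bsub>B\<^esub>" "y \<in> carrier B" using neg by auto
      then have "B.le y (\<ominus>\<^bsub>B\<^esub> z)" using z B.meet_comm[of y z] by (simp add: B.le_compl_iff)
      then show ?thesis using z \<open>y \<in> carrier B\<close> by (simp add: B.le_join_iff)
    qed
    ultimately have "\<one>\<^bsub>B\<^esub> \<oplus>\<^bsub>B\<^esub> \<ominus>\<^bsub>B\<^esub> z = \<ominus>\<^bsub>B\<^esub> z" using z by (auto simp: is_sum_def)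
    then have "B.le \<one>\<^bsub>B\<^esub> (\<ominus>\<^bsub>B\<^esub> z)" using z by (simp add: B.le_join_iff)
    then show False using z by (simp add: B.le_compl_iff)
  qed
  have "rank_descent (n + 3) B n (n + 1) (\<lambda>i. g (cone n i))
    (\<lambda>i. ed 1 [SX0, SP, SZ i] {LG}) (\<lambda>i. ed 2 [SX0, SZ i] {LG})
    (\<lambda>i. ed 0 [SP, SX1, SZ i] {LG}) (\<lambda>i. ed 2 [SZ i, SX1] {LG})
    (\<lambda>i j. ed 0 [SP, SZ j, SZ i] (range LR)) (\<lambda>i j. ed 1 [SZ j, SP, SZ i] (range LR))
    (\<lambda>i j. ed 0 [SP, SZ j, SZ i] {LW1}) (\<lambda>i j. ed 1 [SZ j, SP, SZ i] {LW1})
    (\<lambda>i j. ed 0 [SP, SZ j, SZ i] (insert LW1 (range LR))) (\<lambda>i j. ed 1 [SZ j, SP, SZ i] (insert LW0 (range LR)))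
    (\<lambda>i j p. ed 0 [SP, SZ j, SZ i] {LR p}) (\<lambda>i j q. ed 2 [SZ j, SZ i] {LR q})"
  proof (intro rank_descent.intro rank_descent_axioms.intro B)
    show "cyl B k (g (cone n i)) = g (cone n i)" if "k = n \<or> k = n + 1" for k i
      using dim[OF coneA] that by auto
    show "cyl B k (ed 0 [SP, SZ j, SZ i] {LR p}) = ed 0 [SP, SZ j, SZ i] {LR p}" if "k = n \<or> k = n + 1" for k i j p
      using dim[OF edA'] that by (auto simp: ed_def)
    have "cone n 0 \<noteq> {}" using cone_eq[OF n] by blast
    then have "g (cone n 0) \<noteq> g {}" using inj_onD[OF inj _ coneA cl(4)] by blast
    then show "g (cone n 0) \<noteq> \<zero>\<^bsub>B\<^esub>" by (simp add: hom)
    show "cyl B 2 (g (cone n i)) = cyl B 2 (g (cone n j))" for i j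
      using hom(7)[OF n coneA] cyl_cone[OF n] by metis
    show "B.le (g (cone n i)) (ed 1 [SX0, SP, SZ i] {LG})" "B.le (g (cone n i)) (ed 0 [SP, SX1, SZ i] {LG})" for i
      unfolding ed_def by (rule mono[OF coneA edA']; simp add: cone_def; blast)+
    have V: "edges n 0 (pat [SP, SZ j, SZ i]) (insert LW1 (range LR)) =
       edges n 0 (pat [SP, SZ j, SZ i]) (range LR) \<union> edges n 0 (pat [SP, SZ j, SZ i]) {LW1}" for i j
      by (auto simp: edges_def)
    show "B.le (ed 0 [SP, SZ j, SZ i] (insert LW1 (range LR)))
       (ed 0 [SP, SZ j, SZ i] (range LR) \<oplus>\<^bsub>B\<^esub> ed 0 [SP, SZ j, SZ i] {LW1})" for i j
      by (simp add: ed_def V hom edA')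
    have W: "edges n 1 (pat [SZ j, SP, SZ i]) {LW1} \<inter> edges n 1 (pat [SZ j, SP, SZ i]) (insert LW0 (range LR)) = {}" for i j
      by (auto simp: edges_def)
    show "ed 1 [SZ j, SP, SZ i] {LW1} \<odot>\<^bsub>B\<^esub> ed 1 [SZ j, SP, SZ i] (insert LW0 (range LR)) = \<zero>\<^bsub>B\<^esub>" for i j
      using W[of j i] by (simp add: ed_def edA' hom(5) flip: hom(3))
    show "ed 0 [SP, SZ (Suc i), SZ i] {LR p} \<odot>\<^bsub>B\<^esub>
       (ed 2 [SZ (Suc (Suc i)), SZ (Suc i)] {LR q} \<odot>\<^bsub>B\<^esub> ed 1 [SZ (Suc (Suc i)), SP, SZ i] (range LR)) = \<zero>\<^bsub>B\<^esub>"
      if "\<not> q < p" for i p q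
      using red_triangle[OF n that, of i] by (simp add: ed_def edA' cl(2) hom(5) Int_assoc flip: hom(3))
    show "B.le (ed 1 [SX0, SP, SZ i] {LG} \<odot>\<^bsub>B\<^esub> ed 2 [SX0, SZ j] {LG}) (ed 0 [SP, SZ j, SZ i] (insert LW1 (range LR)))"
      "B.le (ed 0 [SP, SX1, SZ i] {LG} \<odot>\<^bsub>B\<^esub> ed 2 [SZ j, SX1] {LG}) (ed 1 [SZ j, SP, SZ i] (insert LW0 (range LR)))"
      if "i \<noteq> j" for i j
      using green_green[OF n that] by (intro meet_mono; simp)+
    show "B.le (B.sub 2 1 (ed 1 [SX0, SP, SZ i] {LG})) (ed 2 [SX0, SZ i] {LG})" for i
      using n by (intro ed_sub) (auto simp: pat_simps)
    show "B.le (B.sub 2 0 (ed 0 [SP, SX1, SZ i] {LG})) (ed 2 [SZ i, SX1] {LG})" for i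
      using n by (intro ed_sub) (auto simp: pat_simps)
    show "B.le (B.sub 1 0 (ed 0 [SP, SZ j, SZ i] {LW1})) (ed 1 [SZ j, SP, SZ i] {LW1})" for i j
      using n by (intro ed_sub) (auto simp: pat_simps)
    show "B.le (B.sub 1 0 (ed 0 [SP, SZ j, SZ i] (range LR))) (ed 1 [SZ j, SP, SZ i] (range LR))" for i j
      using n by (intro ed_sub) (auto simp: pat_simps)
    have "B.le (B.sub 1 0 (ed 0 [SP, SZ j, SZ i] {LR p})) (ed 1 [SZ j, SP, SZ i] {LR p})" for i j p
      using n by (intro ed_sub) (auto simp: pat_simps)
    then have 1: "B.le (B.sub 2 1 (B.sub 1 0 (ed 0 [SP, SZ j, SZ i] {LR p}))) (B.sub 2 1 (ed 1 [SZ j, SP, SZ i] {LR p}))" for i j p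
      by (intro B.sub_mono) auto
    have 2: "B.le (B.sub 2 1 (ed 1 [SZ j, SP, SZ i] {LR p})) (ed 2 [SZ j, SZ i] {LR p})" for i j p
      using n by (intro ed_sub) (auto simp: pat_simps)
    show "B.le (B.sub 2 1 (B.sub 1 0 (ed 0 [SP, SZ j, SZ i] {LR p}))) (ed 2 [SZ j, SZ i] {LR p})" for i j p
      by (rule B.le_trans[OF 1 2]) auto
    show "\<exists>y\<in>insert (\<ominus>\<^bsub>B\<^esub> ed 0 [SP, SZ j, SZ i] (range LR)) (range (\<lambda>p. ed 0 [SP, SZ j, SZ i] {LR p})). z \<odot>\<^bsub>B\<^esub> y \<noteq> \<zero>\<^bsub>B\<^esub>"
      if "z \<in> carrier B" "z \<noteq> \<zero>\<^bsub>B\<^esub>" for z i j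
      using dense[OF that] .
  qed (use n in \<open>simp_all add: ed_cyl hom coneA\<close>)
  then show False by (rule rank_descent.absurd)
qed

section \<open>Dilations\<close>

text \<open>The common core of the two memberships to be refuted, freed of isomorphic copies and of
  any bond between the element types of \<open>A\<close> and \<open>B\<close>.\<close>

definition dilates :: "nat \<Rightarrow> 'a cyl_alg \<Rightarrow> 'b cyl_alg \<Rightarrow> ('a \<Rightarrow> 'b) \<Rightarrow> bool" where
  "dilates n A B g \<longleftrightarrow> cylindric_algebra (n + 3) B \<and> g \<in> cyl_hom n A B \<and> inj_on g (carrier A) \<and>
     (\<forall>x\<in>carrier A. \<forall>i. n \<le> i \<longrightarrow> i < n + 3 \<longrightarrow> cyl B i (g x) = g x) \<and>
     (\<forall>X. X \<subseteq> carrier A \<longrightarrow> is_sum A X \<one>\<^bsub>A\<^esub> \<longrightarrow> is_sum B (g ` X) \<one>\<^bsub>B\<^esub>)"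

lemma cyl_homD:
  assumes "f \<in> cyl_hom n A B"
  shows "x \<in> carrier A \<Longrightarrow> f x \<in> carrier B"
    "x \<in> carrier A \<Longrightarrow> y \<in> carrier A \<Longrightarrow> f (x \<oplus>\<^bsub>A\<^esub> y) = f x \<oplus>\<^bsub>B\<^esub> f y"
    "x \<in> carrier A \<Longrightarrow> y \<in> carrier A \<Longrightarrow> f (x \<odot>\<^bsub>A\<^esub> y) = f x \<odot>\<^bsub>B\<^esub> f y"
    "x \<in> carrier A \<Longrightarrow> f (\<ominus>\<^bsub>A\<^esub> x) = \<ominus>\<^bsub>B\<^esub> f x" "f \<zero>\<^bsub>A\<^esub> = \<zero>\<^bsub>B\<^esub>" "f \<one>\<^bsub>A\<^esub> = \<one>\<^bsub>B\<^esub>"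
    "i < n \<Longrightarrow> x \<in> carrier A \<Longrightarrow> f (cyl A i x) = cyl B i (f x)"
    "i < n \<Longrightarrow> j < n \<Longrightarrow> f (diag A i j) = diag B i j"
  using assms unfolding cyl_hom_def by blast+

lemma cyl_hom_comp:
  assumes "f \<in> cyl_hom n A B" "g \<in> cyl_hom n B C"
  shows "g \<circ> f \<in> cyl_hom n A C"
  unfolding cyl_hom_def using cyl_homD[OF assms(1)] cyl_homD[OF assms(2)] by simp

lemma is_sum_iso:
  assumes A: "cyl_structure n A" and f: "f \<in> cyl_iso n A B" and X: "X \<subseteq> carrier A" and s: "is_sum A X s"
  shows "is_sum B (f ` X) (f s)"
proof -
  have h: "f \<in> cyl_hom n A B" and b: "bij_betw f (carrier A) (carrier B)" using f by (auto simp: cyl_iso_def)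
  have inj: "inj_on f (carrier A)" using b by (rule bij_betw_imp_inj_on)
  have sA: "s \<in> carrier A" using s by (simp add: is_sum_def)
  have eq: "f x \<oplus>\<^bsub>B\<^esub> f y = f y \<longleftrightarrow> x \<oplus>\<^bsub>A\<^esub> y = y" if "x \<in> carrier A" "y \<in> carrier A" for x y
  proof -
    have "x \<oplus>\<^bsub>A\<^esub> y \<in> carrier A" using A that by (simp add: cyl_structure.join_closed)
    then show ?thesis using inj_on_eq_iff[OF inj, of "x \<oplus>\<^bsub>A\<^esub> y" y] that cyl_homD(2)[OF h that] by simp
  qed
  show ?thesis unfolding is_sum_def
  proof (intro conjI ballI impI)
    show "f s \<in> carrier B" using cyl_homD(1)[OF h sA] .
    fix x assume "x \<in> f ` X"
    then obtain y where y: "x = f y" "y \<in> X" by (rule imageE)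
    have "y \<oplus>\<^bsub>A\<^esub> s = s" using s y(2) unfolding is_sum_def by blast
    then show "x \<oplus>\<^bsub>B\<^esub> f s = f s" using eq[OF _ sA, of y] X y by blast
  next
    fix t assume "t \<in> carrier B" and ub: "\<forall>x\<in>f ` X. x \<oplus>\<^bsub>B\<^esub> t = t"
    then obtain u where u: "t = f u" "u \<in> carrier A" using bij_betw_imp_surj_on[OF b] by blast
    have "x \<oplus>\<^bsub>A\<^esub> u = u" if "x \<in> X" for x using eq[OF _ u(2), of x] ub u(1) that X by blast
    then have "s \<oplus>\<^bsub>A\<^esub> u = u" using s u(2) unfolding is_sum_def by blast
    then show "f s \<oplus>\<^bsub>B\<^esub> t = t" using eq[OF sA u(2)] u(1) by simp
  qed
qed

lemma dilates_iso:
  assumes A: "cyl_structure n A" and h: "h \<in> cyl_iso n A A'" and d: "dilates n A' B g"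
  shows "dilates n A B (g \<circ> h)"
proof -
  have hh: "h \<in> cyl_hom n A A'" and b: "bij_betw h (carrier A) (carrier A')" using h by (auto simp: cyl_iso_def)
  have g: "g \<in> cyl_hom n A' B" "inj_on g (carrier A')" using d by (auto simp: dilates_def)
  show ?thesis unfolding dilates_def
  proof (intro conjI allI ballI impI)
    show "cylindric_algebra (n + 3) B" using d by (simp add: dilates_def)
    show "g \<circ> h \<in> cyl_hom n A B" by (rule cyl_hom_comp[OF hh g(1)])
    show "inj_on (g \<circ> h) (carrier A)" using b g(2) by (auto simp: bij_betw_def intro!: comp_inj_on)
    show "cyl B i ((g \<circ> h) x) = (g \<circ> h) x" if "x \<in> carrier A" "n \<le> i" "i < n + 3" for x i
      using d cyl_homD(1)[OF hh that(1)] that by (simp add: dilates_def)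
    fix X assume X: "X \<subseteq> carrier A" "is_sum A X \<one>\<^bsub>A\<^esub>"
    have "is_sum A' (h ` X) \<one>\<^bsub>A'\<^esub>" using is_sum_iso[OF A h X] cyl_homD(6)[OF hh] by simp
    moreover have "h ` X \<subseteq> carrier A'" using X(1) cyl_homD(1)[OF hh] by blast
    ultimately have "is_sum B (g ` h ` X) \<one>\<^bsub>B\<^esub>" using d unfolding dilates_def by blast
    then show "is_sum B ((g \<circ> h) ` X) \<one>\<^bsub>B\<^esub>" by (simp add: image_comp)
  qed
qed

text \<open>An upper bound \<open>t\<close> in the dilation of a set of \<open>n\<close>-dimensional elements may be replaced by
  the \<open>n\<close>-dimensional element \<open>- c\<^sub>n c\<^sub>n\<^sub>+\<^sub>1 c\<^sub>n\<^sub>+\<^sub>2 (- t)\<close>.\<close>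

lemma sum_Nr:
  assumes B: "cylindric_algebra (n + 3) B" and X: "X \<subseteq> carrier (Nr n (n + 3) B)"
    and s: "is_sum (Nr n (n + 3) B) X \<one>\<^bsub>Nr n (n + 3) B\<^esub>"
  shows "is_sum B X \<one>\<^bsub>B\<^esub>"
proof -
  interpret B: cylindric_algebra "n + 3" B by (rule B)
  have one: "\<one>\<^bsub>Nr n (n + 3) B\<^esub> = \<one>\<^bsub>B\<^esub>" and join: "join (Nr n (n + 3) B) = join B" by (simp_all add: Nr_def)
  have Xc: "x \<in> carrier B \<and> (\<forall>i. n \<le> i \<and> i < n + 3 \<longrightarrow> cyl B i x = x)" if "x \<in> X" for x
    using X that by (auto simp: Nr_def)
  show ?thesis unfolding is_sum_def
  proof (intro conjI ballI impI)
    show "x \<oplus>\<^bsub>B\<^esub> \<one>\<^bsub>B\<^esub> = \<one>\<^bsub>B\<^esub>" if "x \<in> X" for x using Xc[OF that] by simp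
    fix t assume t: "t \<in> carrier B" and ub: "\<forall>x\<in>X. x \<oplus>\<^bsub>B\<^esub> t = t"
    let ?y = "cyl B n (cyl B (n + 1) (cyl B (n + 2) (\<ominus>\<^bsub>B\<^esub> t)))"
    have y: "?y \<in> carrier B" using t by simp
    have fy: "cyl B i ?y = ?y" if "n \<le> i" "i < n + 3" for i
    proof -
      have "i = n \<or> i = n + 1 \<or> i = n + 2" using that by auto
      then show ?thesis using t by (elim disjE) (simp_all add: B.cyl_commute)
    qed
    have fc: "cyl B i (\<ominus>\<^bsub>B\<^esub> ?y) = \<ominus>\<^bsub>B\<^esub> ?y" if "n \<le> i" "i < n + 3" for i
    proof (rule B.le_antisym)
      have "\<ominus>\<^bsub>B\<^esub> ?y \<odot>\<^bsub>B\<^esub> cyl B i ?y = \<zero>\<^bsub>B\<^esub>" using fy[OF that] y B.meet_compl[of ?y] B.meet_comm[of ?y "\<ominus>\<^bsub>B\<^esub> ?y"] by simp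
      then have "cyl B i (\<ominus>\<^bsub>B\<^esub> ?y) \<odot>\<^bsub>B\<^esub> ?y = \<zero>\<^bsub>B\<^esub>" using B.cyl_meet_zero_iff[of i "\<ominus>\<^bsub>B\<^esub> ?y" ?y] that y by simp
      then show "B.le (cyl B i (\<ominus>\<^bsub>B\<^esub> ?y)) (\<ominus>\<^bsub>B\<^esub> ?y)" using B.le_compl_iff that y by simp
      show "B.le (\<ominus>\<^bsub>B\<^esub> ?y) (cyl B i (\<ominus>\<^bsub>B\<^esub> ?y))" using that y by (intro B.cyl_le) auto
    qed (use that y in auto)
    have "x \<oplus>\<^bsub>B\<^esub> \<ominus>\<^bsub>B\<^esub> ?y = \<ominus>\<^bsub>B\<^esub> ?y" if "x \<in> X" for x
    proof -
      have x: "x \<in> carrier B" "cyl B n x = x" "cyl B (n + 1) x = x" "cyl B (n + 2) x = x" using Xc[OF that] by simp_all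
      have "B.le x (\<ominus>\<^bsub>B\<^esub> (\<ominus>\<^bsub>B\<^esub> t))"
      proof -
        have "B.le x t" using ub that x t by (simp add: B.le_join_iff)
        then have "x \<odot>\<^bsub>B\<^esub> \<ominus>\<^bsub>B\<^esub> t = \<zero>\<^bsub>B\<^esub>" using B.le_iff_meet_compl x t by simp
        then show ?thesis using B.le_compl_iff[of x "\<ominus>\<^bsub>B\<^esub> t"] x t by simp
      qed
      then have "x \<odot>\<^bsub>B\<^esub> \<ominus>\<^bsub>B\<^esub> t = \<zero>\<^bsub>B\<^esub>" using B.le_compl_iff[of x "\<ominus>\<^bsub>B\<^esub> t"] x t by simp
      then have "x \<odot>\<^bsub>B\<^esub> ?y = \<zero>\<^bsub>B\<^esub>" using x t by (simp add: B.cyl_meet_zero_iff)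
      then have "B.le x (\<ominus>\<^bsub>B\<^esub> ?y)" using B.le_compl_iff x y by simp
      then show ?thesis using B.le_join_iff x y by simp
    qed
    moreover have "\<ominus>\<^bsub>B\<^esub> ?y \<in> carrier (Nr n (n + 3) B)" using y fc by (simp add: Nr_def)
    ultimately have "\<one>\<^bsub>B\<^esub> \<oplus>\<^bsub>B\<^esub> \<ominus>\<^bsub>B\<^esub> ?y = \<ominus>\<^bsub>B\<^esub> ?y" using s unfolding is_sum_def one join by blast
    then have "B.le \<one>\<^bsub>B\<^esub> (\<ominus>\<^bsub>B\<^esub> ?y)" using y by (simp add: B.le_join_iff)
    then have "\<one>\<^bsub>B\<^esub> \<odot>\<^bsub>B\<^esub> ?y = \<zero>\<^bsub>B\<^esub>" using B.le_compl_iff[of "\<one>\<^bsub>B\<^esub>" ?y] y by simp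
    then have "?y = \<zero>\<^bsub>B\<^esub>" using y by simp
    moreover have "B.le (\<ominus>\<^bsub>B\<^esub> t) ?y"
      using t by (intro B.le_trans[OF B.cyl_le B.le_trans[OF B.cyl_le B.cyl_le]]) auto
    ultimately have "B.le (\<ominus>\<^bsub>B\<^esub> t) \<zero>\<^bsub>B\<^esub>" by simp
    then have "\<ominus>\<^bsub>B\<^esub> t = \<zero>\<^bsub>B\<^esub>" using t by (intro B.le_zero) auto
    then have "t = \<one>\<^bsub>B\<^esub>" using B.join_compl[OF t] t by simp
    then show "\<one>\<^bsub>B\<^esub> \<oplus>\<^bsub>B\<^esub> t = t" by simp
  qed simp
qed

lemma Sc_dilates:
  assumes "A \<in> Sc n (NrCA n (n + 3) :: 'b cyl_alg set)"
  shows "\<exists>(B :: 'b cyl_alg) g. dilates n A B g"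
proof -
  obtain B :: "'b cyl_alg" and A' f where A: "cyl_structure n A" and B: "cylindric_algebra (n + 3) B"
    and st: "strong_subalgebra n A' (Nr n (n + 3) B)" and f: "f \<in> cyl_iso n A A'"
    using assms unfolding Sc_def NrCA_def CA_def by blast
  have id: "id \<in> cyl_hom n A' (Nr n (n + 3) B)" and sub: "carrier A' \<subseteq> carrier (Nr n (n + 3) B)"
    using st by (auto simp: strong_subalgebra_def subalgebra_def)
  have fh: "f \<in> cyl_hom n A A'" and bij: "bij_betw f (carrier A) (carrier A')" using f by (auto simp: cyl_iso_def)
  have "id \<circ> f \<in> cyl_hom n A (Nr n (n + 3) B)" by (rule cyl_hom_comp[OF fh id])
  moreover have "cyl_hom n A (Nr n (n + 3) B) \<subseteq> cyl_hom n A B" unfolding cyl_hom_def by (auto simp: Nr_def)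
  ultimately have fB: "f \<in> cyl_hom n A B" by auto
  have "dilates n A B f" unfolding dilates_def
  proof (intro conjI allI ballI impI)
    show "inj_on f (carrier A)" using bij by (simp add: bij_betw_def)
    show "cyl B i (f x) = f x" if "x \<in> carrier A" "n \<le> i" "i < n + 3" for x i
    proof -
      have "f x \<in> carrier (Nr n (n + 3) B)" using sub cyl_homD(1)[OF fh that(1)] by blast
      then show ?thesis using that by (simp add: Nr_def)
    qed
    fix X assume X: "X \<subseteq> carrier A" "is_sum A X \<one>\<^bsub>A\<^esub>"
    have "is_sum A' (f ` X) \<one>\<^bsub>A'\<^esub>" using is_sum_iso[OF A f X] cyl_homD(6)[OF fh] by simp
    moreover have fX: "f ` X \<subseteq> carrier A'" using X(1) cyl_homD(1)[OF fh] by blast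
    ultimately have "is_sum (Nr n (n + 3) B) (f ` X) \<one>\<^bsub>Nr n (n + 3) B\<^esub>" using st by (simp add: strong_subalgebra_def)
    moreover have "f ` X \<subseteq> carrier (Nr n (n + 3) B)" using fX sub by blast
    ultimately show "is_sum B (f ` X) \<one>\<^bsub>B\<^esub>" by (intro sum_Nr[OF B])
  qed (rule B fB)+
  then show ?thesis by blast
qed

section \<open>Set algebras and the dilation of complete representations\<close>

lemma square_upd: "s \<in> square n U \<Longrightarrow> i < n \<Longrightarrow> x \<in> U \<Longrightarrow> s(i := x) \<in> square n U"
  by (auto simp: square_def PiE_def extensional_def)

text \<open>With two places available there is one other than \<open>i\<close>, where the tuples
  share a point; disjoint bases that share a point are equal.\<close>

lemma same_square:
  assumes "disjoint \<U>" "2 \<le> n" "i < n" "U \<in> \<U>" "s \<in> square n U" "t \<in> (\<Union>U\<in>\<U>. square n U)" "\<forall>j. j \<noteq> i \<longrightarrow> s j = t j"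
  shows "t \<in> square n U"
proof -
  obtain W where W: "W \<in> \<U>" "t \<in> square n W" using assms(6) by blast
  define j :: nat where "j = (if i = 0 then 1 else 0)"
  have j: "j < n" "j \<noteq> i" using assms(2) by (auto simp: j_def)
  have "s j \<in> U" "t j \<in> W" using j(1) assms(5) W(2) by (auto simp: square_def)
  then have "U \<inter> W \<noteq> {}" using assms(7) j(2) by auto
  then have "U = W" using assms(1,4) W(1) by (auto dest: disjointD)
  then show ?thesis using W by simp
qed

lemma full_set_algebra_CA:
  assumes d: "disjoint \<U>" and n: "2 \<le> n"
  shows "cylindric_algebra n (full_set_algebra (\<Union>U\<in>\<U>. square n U))"
proof -
  define V where "V = (\<Union>U\<in>\<U>. square n U)"
  have sq: "t \<in> square n U" if "U \<in> \<U>" "s \<in> square n U" "t \<in> V" "i < n" "\<forall>j. j \<noteq> i \<longrightarrow> s j = t j" for s t U i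
    using same_square[OF d n that(4,1,2)] that(3,5) by (simp add: V_def)
  have upd: "s(i := t k) \<in> V" if st: "s \<in> V" "t \<in> V" "i < n" "k < n" "m < n" "\<forall>j. j \<noteq> m \<longrightarrow> s j = t j" for s t i k m
  proof -
    obtain U where U: "U \<in> \<U>" "s \<in> square n U" using st(1) by (auto simp: V_def)
    have "t \<in> square n U" using sq[OF U st(2,5,6)] .
    then have "t k \<in> U" using st(4) by (auto simp: square_def)
    then show ?thesis using square_upd[OF U(2) st(3)] U(1) by (auto simp: V_def)
  qed
  \<comment> \<open>For the opposite order of the two changes the intermediate tuple is
    \<open>s(j := r j)\<close>; it belongs to \<open>V\<close> because \<open>s\<close>,
    \<open>t\<close> and \<open>r\<close> lie in one square.\<close>
  have comm: "\<exists>t\<in>V. (\<exists>r\<in>X. \<forall>m. m \<noteq> i \<longrightarrow> t m = r m) \<and> (\<forall>m. m \<noteq> j \<longrightarrow> s m = t m)"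
    if h: "i < n" "j < n" "X \<subseteq> V" "s \<in> V" "t \<in> V" "r \<in> X" "\<forall>m. m \<noteq> j \<longrightarrow> t m = r m" "\<forall>m. m \<noteq> i \<longrightarrow> s m = t m"
    for i j X s t r
  proof (cases "i = j")
    case True
    then show ?thesis using h by (intro bexI[of _ t] conjI bexI[of _ r]) auto
  next
    case False
    obtain U where U: "U \<in> \<U>" "s \<in> square n U" using h(4) by (auto simp: V_def)
    have tU: "t \<in> square n U" using sq[OF U h(5,1,8)] .
    have "r \<in> square n U" using sq[OF U(1) tU _ h(2,7)] h(3,6) by blast
    then have "r j \<in> U" using h(2) by (auto simp: square_def)
    then have "s(j := r j) \<in> V" using square_upd[OF U(2) h(2)] U(1) by (auto simp: V_def)
    moreover have "\<forall>m. m \<noteq> i \<longrightarrow> (s(j := r j)) m = r m" using h(7,8) by simp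
    moreover have "\<forall>m. m \<noteq> j \<longrightarrow> s m = (s(j := r j)) m" by simp
    ultimately show ?thesis using h(6) by blast
  qed
  let ?c = "\<lambda>i X. {s \<in> V. \<exists>t\<in>X. \<forall>j. j \<noteq> i \<longrightarrow> s j = t j}"
  have ax_comm: "?c i (?c j X) \<subseteq> ?c j (?c i X)" if h: "i < n" "j < n" "X \<subseteq> V" for i j X
  proof
    fix s assume "s \<in> ?c i (?c j X)"
    then obtain t r where t: "s \<in> V" "t \<in> V" "r \<in> X" "\<forall>m. m \<noteq> j \<longrightarrow> t m = r m" "\<forall>m. m \<noteq> i \<longrightarrow> s m = t m" by blast
    then show "s \<in> ?c j (?c i X)" using comm[OF h t(1-3) t(4,5)] by blast
  qed
  have ax_meet: "?c i (X \<inter> ?c i Y) = ?c i X \<inter> ?c i Y" if "X \<subseteq> V" for i X Y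
  proof (intro equalityI subsetI IntI)
    fix s assume "s \<in> ?c i (X \<inter> ?c i Y)"
    then obtain t r where t: "s \<in> V" "t \<in> X" "r \<in> Y" "\<forall>j. j \<noteq> i \<longrightarrow> s j = t j" "\<forall>j. j \<noteq> i \<longrightarrow> t j = r j" by blast
    show "s \<in> ?c i X" using t by blast
    have "\<forall>j. j \<noteq> i \<longrightarrow> s j = r j" using t(4,5) by simp
    then show "s \<in> ?c i Y" using t by blast
  next
    fix s assume "s \<in> ?c i X \<inter> ?c i Y"
    then obtain t r where t: "s \<in> V" "t \<in> X" "r \<in> Y" "\<forall>j. j \<noteq> i \<longrightarrow> s j = t j" "\<forall>j. j \<noteq> i \<longrightarrow> s j = r j" by blast
    then have "\<forall>j. j \<noteq> i \<longrightarrow> t j = r j" by simp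
    then show "s \<in> ?c i (X \<inter> ?c i Y)" using t that by blast
  qed
  have ax_diag: "{s \<in> V. s i = s j} = ?c k ({s \<in> V. s i = s k} \<inter> {s \<in> V. s k = s j})"
    if h: "i < n" "j < n" "k < n" "k \<noteq> i" "k \<noteq> j" for i j k
  proof (intro equalityI subsetI)
    fix s assume s: "s \<in> {s \<in> V. s i = s j}"
    then have "s(k := s i) \<in> V" using upd[of s s k i k] h by simp
    then have "s(k := s i) \<in> {s \<in> V. s i = s k} \<inter> {s \<in> V. s k = s j}" using s h by simp
    moreover have "\<forall>m. m \<noteq> k \<longrightarrow> s m = (s(k := s i)) m" by simp
    ultimately show "s \<in> ?c k ({s \<in> V. s i = s k} \<inter> {s \<in> V. s k = s j})" using s by blast
  next
    fix s assume "s \<in> ?c k ({s \<in> V. s i = s k} \<inter> {s \<in> V. s k = s j})"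
    then obtain t where "s \<in> V" "t i = t k" "t k = t j" "\<forall>m. m \<noteq> k \<longrightarrow> s m = t m" by blast
    then show "s \<in> {s \<in> V. s i = s j}" using h by simp
  qed
  have ax_compl: "?c i ({s \<in> V. s i = s j} \<inter> X) \<inter> ?c i ({s \<in> V. s i = s j} \<inter> (V - X)) = {}" if "i \<noteq> j" for i j X
  proof (rule ccontr)
    assume "\<not> ?thesis"
    then obtain s t t' where t: "t i = t j" "t' i = t' j" "\<forall>m. m \<noteq> i \<longrightarrow> s m = t m" "\<forall>m. m \<noteq> i \<longrightarrow> s m = t' m" "t \<in> X" "t' \<notin> X"
      by blast
    have "t j = t' j" using t(3,4)[rule_format, of j] that by simp
    have "t m = t' m" for m
      using t(3,4)[rule_format, of m] \<open>t j = t' j\<close> t(1,2) by (cases "m = i") simp_all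
    then have "t = t'" by blast
    then show False using t by simp
  qed
  have "cylindric_algebra n (full_set_algebra V)"
  proof (unfold_locales, goal_cases)
    \<comment> \<open>Seven closure goals come first, so 18, 19, 21 and 22 are
      \<open>cyl_meet_cyl\<close>, \<open>cyl_commute\<close>, \<open>diag_cyl\<close> and
      \<open>cyl_diag_compl\<close>.\<close>
    case (18 i x y)
    then show ?case using ax_meet[where X = x and i = i and Y = y] by (simp add: full_set_algebra_def)
  next
    case (19 i j x)
    then show ?case using equalityI[OF ax_comm[of i j x] ax_comm[of j i x]] by (simp add: full_set_algebra_def)
  next
    case (21 i j k)
    then show ?case unfolding full_set_algebra_def cyl_alg.simps by (rule ax_diag)
  next
    case (22 i j x)
    then show ?case unfolding full_set_algebra_def cyl_alg.simps by (intro ax_compl)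
  qed (simp_all add: full_set_algebra_def, blast+)
  then show ?thesis by (simp add: V_def)
qed

text \<open>The axioms are equations, hence inherited backwards through an injective
  homomorphism.\<close>

lemma CA_of_embedding:
  assumes A: "cyl_structure n A" and f: "f \<in> cyl_hom n A B" "inj_on f (carrier A)" and B: "cylindric_algebra n B"
  shows "cylindric_algebra n A"
proof -
  interpret A: cyl_structure n A by (rule A)
  interpret B: cylindric_algebra n B by (rule B)
  note cl = A.join_closed A.meet_closed A.compl_closed A.zero_closed A.one_closed A.cyl_closed A.diag_closed
  note h = cyl_homD[OF f(1)]
  have eq: "x = y" if "f x = f y" "x \<in> carrier A" "y \<in> carrier A" for x y using inj_onD[OF f(2)] that by blast
  show ?thesis
  proof (unfold_locales, goal_cases)
    case (1 x y) then show ?case by (intro eq) (simp_all add: h cl B.join_comm)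
  next
    case (2 x y) then show ?case by (intro eq) (simp_all add: h cl B.meet_comm)
  next
    case (3 x y z) then show ?case by (intro eq) (simp_all add: h cl B.join_meet_distrib)
  next
    case (4 x y z) then show ?case by (intro eq) (simp_all add: h cl B.meet_join_distrib)
  next
    case (12 i j x)
    then have "f (cyl A i (cyl A j x)) = f (cyl A j (cyl A i x))" by (simp only: h cl B.cyl_commute[OF 12(1,2) h(1)])
    then show ?case using 12 by (intro eq) (simp_all add: cl)
  next
    case (14 i j k)
    then have "f (diag A i j) = f (cyl A k (diag A i k \<odot>\<^bsub>A\<^esub> diag A k j))" by (simp add: h cl B.diag_cyl[of i j k])
    then show ?case using 14 by (intro eq) (simp_all add: cl)
  qed (intro eq; simp add: h cl B.join_zero B.meet_one B.join_compl B.meet_compl B.cyl_zero B.cyl_increasing B.cyl_meet_cyl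
      B.diag_refl B.cyl_diag_compl)+
qed

text \<open>The same bases carry squares of dimension \<open>n + 3\<close>. An element is sent to
  the longer tuples whose first \<open>n\<close> places form a tuple in its image; unions are
  preserved, and the new places are not constrained.\<close>

lemma CRA_dilates:
  assumes A: "A \<in> CRA n TYPE('u)" and n: "2 < n"
  shows "\<exists>(B :: (nat \<Rightarrow> 'u) set cyl_alg) g. dilates n A B g"
proof -
  obtain \<U> :: "'u set set" and f where r: "complete_representation n A \<U> f"
    using A unfolding CRA_def by blast
  have d: "disjoint \<U>"
    and f: "f \<in> cyl_hom n A (full_set_algebra (\<Union>U\<in>\<U>. square n U))" "inj_on f (carrier A)"
    using r unfolding complete_representation_def by blast+
  have sums: "f s = \<Union> (f ` X)" if "X \<subseteq> carrier A" "is_sum A X s" for X s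
    using r[unfolded complete_representation_def, THEN conjunct2, THEN conjunct2, THEN conjunct2] that by simp
  define V where "V = (\<Union>U\<in>\<U>. square n U)"
  define W where "W = (\<Union>U\<in>\<U>. square (n + 3) U)"
  define g where "g x = {s \<in> W. restrict s {..<n} \<in> f x}" for x
  note h = cyl_homD[OF f(1), folded V_def]
  have sub: "f x \<subseteq> V" if "x \<in> carrier A" for x using h(1)[OF that] unfolding full_set_algebra_def by simp
  have rW: "restrict s {..<n} \<in> square n U" if "s \<in> square (n + 3) U" for s U
    unfolding square_def restrict_PiE_iff using PiE_mem[OF that[unfolded square_def]] by simp
  have rV: "restrict s {..<n} \<in> V" if sW: "s \<in> W" for s
  proof -
    obtain U where "U \<in> \<U>" "s \<in> square (n + 3) U" using sW unfolding W_def by blast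
    then show ?thesis using rW unfolding V_def by blast
  qed
  have ext: "t j = undefined" if "t \<in> V" "\<not> j < n" for t j
  proof -
    obtain U where "t \<in> square n U" using \<open>t \<in> V\<close> unfolding V_def by blast
    then have "t \<in> {..<n} \<rightarrow>\<^sub>E U" by (simp only: square_def)
    then show ?thesis by (rule PiE_arb) (use that(2) in simp)
  qed
  have B: "cylindric_algebra (n + 3) (full_set_algebra W)"
    unfolding W_def using n by (intro full_set_algebra_CA d) simp
  have surj: "\<exists>s\<in>W. restrict s {..<n} = t" if tV: "t \<in> V" for t
  proof -
    obtain U where U: "U \<in> \<U>" "t \<in> square n U" using tV by (auto simp: V_def)
    \<comment> \<open>The new places repeat the point \<open>t 0\<close>, which keeps the longer
      tuple in the square of the same base.\<close>
    let ?s = "\<lambda>j. if j < n then t j else if j < n + 3 then t 0 else undefined"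
    have tm: "t j \<in> U" if "j < n" for j using PiE_mem[OF U(2)[unfolded square_def]] that by simp
    have "?s \<in> square (n + 3) U" unfolding square_def using tm n by (intro PiE_I) simp_all
    moreover have "restrict ?s {..<n} = t" using ext[OF tV] by (simp add: restrict_def fun_eq_iff)
    ultimately show ?thesis using U(1) unfolding W_def by blast
  qed
  have ginW: "g x \<subseteq> W" for x by (auto simp: g_def)
  have hom: "g \<in> cyl_hom n A (full_set_algebra W)"
    unfolding cyl_hom_def
  proof (intro CollectI conjI ballI allI impI funcsetI)
    show "g x \<in> carrier (full_set_algebra W)" for x using ginW by (simp add: full_set_algebra_def)
    show "g (x \<oplus>\<^bsub>A\<^esub> y) = g x \<oplus>\<^bsub>full_set_algebra W\<^esub> g y" if "x \<in> carrier A" "y \<in> carrier A" for x y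
      using h(2)[OF that] by (auto simp: g_def full_set_algebra_def)
    show "g (x \<odot>\<^bsub>A\<^esub> y) = g x \<odot>\<^bsub>full_set_algebra W\<^esub> g y" if "x \<in> carrier A" "y \<in> carrier A" for x y
      using h(3)[OF that] by (auto simp: g_def full_set_algebra_def)
    show "g (\<ominus>\<^bsub>A\<^esub> x) = \<ominus>\<^bsub>full_set_algebra W\<^esub> g x" if "x \<in> carrier A" for x
      using h(4)[OF that] rV by (auto simp: g_def full_set_algebra_def)
    show "g \<zero>\<^bsub>A\<^esub> = \<zero>\<^bsub>full_set_algebra W\<^esub>" using h(5) by (simp add: g_def full_set_algebra_def)
    show "g \<one>\<^bsub>A\<^esub> = \<one>\<^bsub>full_set_algebra W\<^esub>" using h(6) rV by (auto simp: g_def full_set_algebra_def)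
    show "g (diag A i j) = diag (full_set_algebra W) i j" if "i < n" "j < n" for i j
      using h(8)[OF that] rV that by (auto simp: g_def full_set_algebra_def)
    fix i x assume i: "i < n" and x: "x \<in> carrier A"
    have fc: "f (cyl A i x) = {s \<in> V. \<exists>t\<in>f x. \<forall>j. j \<noteq> i \<longrightarrow> s j = t j}" using h(7)[OF i x] by (simp add: full_set_algebra_def)
    have "s \<in> g (cyl A i x) \<longleftrightarrow> (\<exists>t\<in>g x. \<forall>j. j \<noteq> i \<longrightarrow> s j = t j)" if sW: "s \<in> W" for s
    proof
      assume "s \<in> g (cyl A i x)"
      then obtain t where t: "t \<in> f x" "\<forall>j. j \<noteq> i \<longrightarrow> restrict s {..<n} j = t j" by (auto simp: g_def fc)
      obtain U where U: "U \<in> \<U>" "s \<in> square (n + 3) U" using sW by (auto simp: W_def)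
      have tV: "t \<in> V" using sub x t(1) by blast
      then have "t \<in> square n U" using same_square[OF d _ i U(1) rW[OF U(2)] _ t(2)] n by (simp add: V_def)
      then have "t i \<in> U" using i by (auto simp: square_def)
      then have "s(i := t i) \<in> W" using square_upd[OF U(2), of i "t i"] i U(1) unfolding W_def by auto
      moreover have "restrict (s(i := t i)) {..<n} = t"
      proof
        fix j show "restrict (s(i := t i)) {..<n} j = t j" using t(2)[rule_format, of j] ext[OF tV, of j] i by (cases "j < n") auto
      qed
      ultimately have "s(i := t i) \<in> g x" using t(1) by (simp add: g_def)
      then show "\<exists>t\<in>g x. \<forall>j. j \<noteq> i \<longrightarrow> s j = t j" by (intro bexI[of _ "s(i := t i)"]) auto
    next
      assume "\<exists>t\<in>g x. \<forall>j. j \<noteq> i \<longrightarrow> s j = t j"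
      then obtain t where t: "t \<in> g x" "\<forall>j. j \<noteq> i \<longrightarrow> s j = t j" by blast
      have "\<forall>j. j \<noteq> i \<longrightarrow> restrict s {..<n} j = restrict t {..<n} j" using t(2) by (simp add: restrict_def)
      then show "s \<in> g (cyl A i x)" using t(1) sW rV[OF sW] unfolding g_def fc by blast
    qed
    then show "g (cyl A i x) = cyl (full_set_algebra W) i (g x)"
      using ginW unfolding full_set_algebra_def by auto
  qed
  have "dilates n A (full_set_algebra W) g" unfolding dilates_def
  proof (intro conjI allI ballI impI)
    show "inj_on g (carrier A)"
    proof (rule inj_onI)
      fix x y assume xy: "x \<in> carrier A" "y \<in> carrier A" "g x = g y"
      have "t \<in> f x \<longleftrightarrow> t \<in> f y" if t: "t \<in> V" for t
      proof -
        obtain s where "s \<in> W" "restrict s {..<n} = t" using surj[OF t] by blast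
        then show ?thesis using xy(3) by (auto simp: g_def)
      qed
      then have "f x = f y" using sub xy by blast
      then show "x = y" using inj_onD[OF f(2)] xy by blast
    qed
    show "cyl (full_set_algebra W) i (g x) = g x" if "n \<le> i" for i x
    proof -
      have eq: "restrict s {..<n} = restrict t {..<n}" if "\<forall>j. j \<noteq> i \<longrightarrow> s j = t j" for s t :: "nat \<Rightarrow> 'u"
        using that \<open>n \<le> i\<close> by (auto simp: restrict_def fun_eq_iff)
      then have "s \<in> g x" if "s \<in> W" "t \<in> g x" "\<forall>j. j \<noteq> i \<longrightarrow> s j = t j" for s t
      proof -
        have "restrict s {..<n} = restrict t {..<n}" by (rule eq[OF that(3)])
        then show ?thesis using that(1,2) by (simp add: g_def)
      qed
      moreover have "s \<in> W" if "s \<in> g x" for s using ginW that by blast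
      ultimately show ?thesis unfolding full_set_algebra_def cyl_alg.simps by blast
    qed
    fix X assume X: "X \<subseteq> carrier A" "is_sum A X \<one>\<^bsub>A\<^esub>"
    have V: "V = \<Union> (f ` X)" using sums[OF X] h(6) by (simp add: full_set_algebra_def)
    have "W \<subseteq> \<Union> (g ` X)"
    proof
      fix s assume s: "s \<in> W"
      then have "restrict s {..<n} \<in> \<Union> (f ` X)" using rV V by blast
      then show "s \<in> \<Union> (g ` X)" using s by (auto simp: g_def)
    qed
    then show "is_sum (full_set_algebra W) (g ` X) \<one>\<^bsub>full_set_algebra W\<^esub>"
      using ginW unfolding is_sum_def full_set_algebra_def by (simp add: subset_Un_eq[symmetric]) blast
  qed (rule B hom)+
  then show ?thesis by blast
qed

section \<open>Isomorphic copies, satisfaction and complete representations\<close>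

definition transport :: "('a \<Rightarrow> 'b) \<Rightarrow> 'a cyl_alg \<Rightarrow> 'b cyl_alg" where
  "transport h A = (let i = inv_into (carrier A) h in
     \<lparr>carrier = h ` carrier A, join = (\<lambda>x y. h (i x \<oplus>\<^bsub>A\<^esub> i y)), meet = (\<lambda>x y. h (i x \<odot>\<^bsub>A\<^esub> i y)),
      compl = (\<lambda>x. h (\<ominus>\<^bsub>A\<^esub> i x)), zero = h \<zero>\<^bsub>A\<^esub>, one = h \<one>\<^bsub>A\<^esub>, cyl = (\<lambda>k x. h (cyl A k (i x))), diag = (\<lambda>k l. h (diag A k l))\<rparr>)"

lemma transport_iso:
  assumes A: "cyl_structure n A" and h: "inj_on h (carrier A)"
  shows "h \<in> cyl_iso n A (transport h A)" "cyl_structure n (transport h A)"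
proof -
  interpret cyl_structure n A by (rule A)
  have i: "inv_into (carrier A) h (h x) = x" if "x \<in> carrier A" for x using h that by simp
  have c: "inv_into (carrier A) h y \<in> carrier A" if "y \<in> h ` carrier A" for y using that by (rule inv_into_into)
  show "h \<in> cyl_iso n A (transport h A)"
    using h by (auto simp: cyl_iso_def cyl_hom_def transport_def Let_def i bij_betw_def)
  show "cyl_structure n (transport h A)"
    by unfold_locales (simp_all add: transport_def Let_def c join_closed meet_closed compl_closed zero_closed one_closed
      cyl_closed diag_closed)
qed

lemma iso_inv:
  assumes A: "cyl_structure n A" and h: "h \<in> cyl_iso n A B"
  shows "inv_into (carrier A) h \<in> cyl_iso n B A"
proof -
  interpret cyl_structure n A by (rule A)
  let ?i = "inv_into (carrier A) h"
  have hh: "h \<in> cyl_hom n A B" and b: "bij_betw h (carrier A) (carrier B)" using h by (auto simp: cyl_iso_def)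
  note hd = cyl_homD[OF hh]
  have bi: "bij_betw ?i (carrier B) (carrier A)" using b by (rule bij_betw_inv_into)
  have c: "?i y \<in> carrier A" if "y \<in> carrier B" for y using bi that by (auto simp: bij_betw_def)
  have hi: "h (?i y) = y" if "y \<in> carrier B" for y using b that by (simp add: bij_betw_inv_into_right)
  have e: "?i y = x" if "x \<in> carrier A" "h x = y" for x y using b that bij_betw_inv_into_left by fastforce
  show ?thesis unfolding cyl_iso_def cyl_hom_def
    using bi by (auto simp: c hi hd join_closed meet_closed compl_closed zero_closed one_closed cyl_closed diag_closed intro!: e)
qed

lemma eval_term_closed:
  assumes "cyl_structure n A" "range e \<subseteq> carrier A" "term_lang n t"
  shows "eval_term A e t \<in> carrier A"
proof -
  interpret cyl_structure n A by (rule assms)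
  show ?thesis using assms(2,3)
    by (induction t) (auto simp: join_closed meet_closed compl_closed zero_closed one_closed cyl_closed diag_closed)
qed

lemma eval_term_iso:
  assumes A: "cyl_structure n A" and h: "h \<in> cyl_hom n A B" and e: "range e \<subseteq> carrier A" and t: "term_lang n t"
  shows "eval_term B (h \<circ> e) t = h (eval_term A e t)"
  using t by (induction t) (simp_all add: cyl_homD[OF h] eval_term_closed[OF A e])

lemma satisfies_iso:
  assumes A: "cyl_structure n A" and h: "h \<in> cyl_iso n A B" and e: "range e \<subseteq> carrier A" and p: "fm_lang n \<phi>"
  shows "satisfies B (h \<circ> e) \<phi> \<longleftrightarrow> satisfies A e \<phi>"
proof -
  have hh: "h \<in> cyl_hom n A B" and b: "bij_betw h (carrier A) (carrier B)" using h by (auto simp: cyl_iso_def)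
  show ?thesis using p e
  proof (induction \<phi> arbitrary: e)
    case (Eq s t)
    then have l: "term_lang n s" "term_lang n t" and e: "range e \<subseteq> carrier A" by simp_all
    show ?case unfolding satisfies.simps eval_term_iso[OF A hh e l(1)] eval_term_iso[OF A hh e l(2)]
      by (rule inj_on_eq_iff[OF bij_betw_imp_inj_on[OF b] eval_term_closed[OF A e l(1)] eval_term_closed[OF A e l(2)]])
  next
    case (Ex v \<phi>)
    have "satisfies B ((h \<circ> e)(v := h x)) \<phi> \<longleftrightarrow> satisfies A (e(v := x)) \<phi>" if x: "x \<in> carrier A" for x
    proof -
      have "range (e(v := x)) \<subseteq> carrier A" using Ex.prems(2) x by auto
      then have "satisfies B (h \<circ> e(v := x)) \<phi> \<longleftrightarrow> satisfies A (e(v := x)) \<phi>"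
        by (rule Ex.IH[rotated]) (use Ex.prems(1) in simp)
      moreover have "(h \<circ> e)(v := h x) = h \<circ> e(v := x)" by (simp add: fun_eq_iff)
      ultimately show ?thesis by metis
    qed
    then have "(\<exists>x\<in>carrier A. satisfies B ((h \<circ> e)(v := h x)) \<phi>) \<longleftrightarrow> (\<exists>x\<in>carrier A. satisfies A (e(v := x)) \<phi>)"
      by (rule bex_cong[OF refl])
    moreover have "carrier B = h ` carrier A" using bij_betw_imp_surj_on[OF b] by simp
    ultimately show ?case by (simp only: satisfies.simps bex_simps)
  next
    case (Neg \<phi>)
    then show ?case by simp
  next
    case (Conj \<phi> \<psi>)
    then show ?case by simp
  qed
qed

lemma complete_representation_iso:
  assumes A: "cyl_structure n A" and h: "h \<in> cyl_iso n A B" and B: "cyl_structure n B"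
    and r: "complete_representation n A \<U> f"
  shows "complete_representation n B \<U> (f \<circ> inv_into (carrier A) h)"
proof -
  let ?i = "inv_into (carrier A) h"
  have i: "?i \<in> cyl_iso n B A" by (rule iso_inv[OF A h])
  then have ih: "?i \<in> cyl_hom n B A" and b: "bij_betw ?i (carrier B) (carrier A)" by (auto simp: cyl_iso_def)
  show ?thesis unfolding complete_representation_def
  proof (intro conjI allI impI)
    show "disjoint \<U>" using r by (simp add: complete_representation_def)
    show "f \<circ> ?i \<in> cyl_hom n B (full_set_algebra (\<Union>U\<in>\<U>. square n U))"
      using r by (intro cyl_hom_comp[OF ih]) (simp add: complete_representation_def)
    show "inj_on (f \<circ> ?i) (carrier B)" using b r
      by (auto simp: complete_representation_def bij_betw_def intro!: comp_inj_on)
    fix X s assume X: "X \<subseteq> carrier B" "is_sum B X s"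
    have "is_sum A (?i ` X) (?i s)" using is_sum_iso[OF B i X] .
    moreover have "?i ` X \<subseteq> carrier A" using X(1) cyl_homD(1)[OF ih] by blast
    ultimately have "f (?i s) = \<Union> (f ` ?i ` X)" using r unfolding complete_representation_def by blast
    then show "(f \<circ> ?i) s = \<Union> ((f \<circ> ?i) ` X)" by (simp add: image_comp)
  qed
qed

lemma CRA_intro:
  assumes A: "cyl_structure n A" and n: "2 < n" and r: "complete_representation n A (\<U> :: 'u set set) f"
  shows "A \<in> CRA n TYPE('u)"
proof -
  have d: "disjoint \<U>" and f: "f \<in> cyl_hom n A (full_set_algebra (\<Union>U\<in>\<U>. square n U))" "inj_on f (carrier A)"
    using r by (auto simp: complete_representation_def)
  have "cylindric_algebra n A" using CA_of_embedding[OF A f full_set_algebra_CA[OF d]] n by simp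
  then show ?thesis using r by (auto simp: CRA_def CA_def)
qed

section \<open>A countable elementary subalgebra of an ultrapower\<close>

text \<open>\<open>ev P\<close> says that \<open>P\<close> holds on a set of a fixed nonprincipal
  ultrafilter on the naturals. As a quantifier it commutes with the connectives.\<close>

locale ultra =
  fixes ev :: "(nat \<Rightarrow> bool) \<Rightarrow> bool"
  assumes ev_not: "ev (\<lambda>t. \<not> P t) \<longleftrightarrow> \<not> ev P"
    and ev_conj: "ev (\<lambda>t. P t \<and> Q t) \<longleftrightarrow> ev P \<and> ev Q"
    and ev_cofinite: "(\<And>t. m \<le> t \<Longrightarrow> P t) \<Longrightarrow> ev P"

text \<open>Zorn's lemma is applied to families whose finite intersections are all infinite; this
  puts every cofinite set into a maximal family.\<close>

lemma ex_ultra: "\<exists>ev. ultra ev"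
proof -
  define \<A> where "\<A> = {C :: nat set set. \<forall>F\<subseteq>C. finite F \<longrightarrow> infinite (\<Inter>F)}"
  have "\<Union>C \<in> \<A>" if C: "C \<in> chains \<A>" for C
  proof -
    have "infinite (\<Inter>F)" if F: "F \<subseteq> \<Union>C" "finite F" for F
    proof (cases "C = {}")
      case False
      have ch: "subset.chain \<A> C" using C by (simp add: chains_alt_def)
      obtain X where "X \<in> C" "F \<subseteq> X"
        using finite_subset_Union_chain[OF F(2,1) False ch] by blast
      then show ?thesis using C F(2) by (auto simp: \<A>_def chains_def)
    qed (use F in simp)
    then show ?thesis by (simp add: \<A>_def)
  qed
  then obtain M where M: "M \<in> \<A>" "\<And>X. X \<in> \<A> \<Longrightarrow> M \<subseteq> X \<Longrightarrow> X = M"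
    using Zorn_Lemma[of \<A>] by blast
  have inf: "infinite (\<Inter>F)" if "F \<subseteq> M" "finite F" for F using M(1) that by (simp add: \<A>_def)
  have out: "\<exists>F\<subseteq>M. finite F \<and> finite (\<Inter>F \<inter> S)" if S: "S \<notin> M" for S
  proof -
    have "insert S M \<notin> \<A>" using M(2)[of "insert S M"] S by blast
    then obtain F where F: "F \<subseteq> insert S M" "finite F" "finite (\<Inter>F)" by (auto simp: \<A>_def)
    have "\<Inter>(F - {S}) \<inter> S \<subseteq> \<Inter>F" by blast
    then have "finite (\<Inter>(F - {S}) \<inter> S)" using F(3) finite_subset by blast
    then show ?thesis using F(1,2) by (intro exI[of _ "F - {S}"]) auto
  qed
  \<comment> \<open>If neither a set nor its complement belonged to \<open>M\<close>, the two finite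
    traces given by \<open>out\<close> would together cover an intersection of finitely many members
    of \<open>M\<close>.\<close>
  have compl: "- S \<in> M \<longleftrightarrow> S \<notin> M" for S
  proof
    assume "- S \<in> M"
    then show "S \<notin> M" using inf[of "{S, - S}"] by auto
  next
    assume "S \<notin> M"
    show "- S \<in> M"
    proof (rule ccontr)
      assume "- S \<notin> M"
      obtain F where F: "F \<subseteq> M" "finite F" "finite (\<Inter>F \<inter> S)" using out[OF \<open>S \<notin> M\<close>] by blast
      obtain G where G: "G \<subseteq> M" "finite G" "finite (\<Inter>G \<inter> - S)" using out[OF \<open>- S \<notin> M\<close>] by blast
      have "\<Inter>(F \<union> G) \<subseteq> (\<Inter>F \<inter> S) \<union> (\<Inter>G \<inter> - S)" by blast
      then have "finite (\<Inter>(F \<union> G))" using F(3) G(3) by (meson finite_UnI finite_subset)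
      then show False using inf[of "F \<union> G"] F G by blast
    qed
  qed
  have empty: "\<not> (S \<in> M \<and> T \<in> M \<and> W \<in> M \<and> S \<inter> T \<inter> W = {})" for S T W
  proof
    assume h: "S \<in> M \<and> T \<in> M \<and> W \<in> M \<and> S \<inter> T \<inter> W = {}"
    then have "\<Inter>{S, T, W} = {}" by auto
    then show False using inf[of "{S, T, W}"] h by auto
  qed
  have up: "T \<in> M" if "S \<in> M" "S \<subseteq> T" for S T
    using empty[of S "- T" S] compl[of T] that by blast
  have meet: "S \<inter> T \<in> M" if "S \<in> M" "T \<in> M" for S T
    using empty[of S T "- (S \<inter> T)"] compl[of "S \<inter> T"] that by blast
  have cof: "S \<in> M" if S: "finite (- S)" for S
  proof -
    have "- S \<notin> M" using inf[of "{- S}"] S by auto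
    then show ?thesis using compl[of S] by blast
  qed
  have "ultra (\<lambda>P. {t. P t} \<in> M)"
  proof
    show "({t. \<not> P t} \<in> M) = ({t. P t} \<notin> M)" for P using compl[of "{t. P t}"] by (simp add: Collect_neg_eq)
    show "({t. P t \<and> Q t} \<in> M) = ({t. P t} \<in> M \<and> {t. Q t} \<in> M)" for P Q
      unfolding Collect_conj_eq using up[of "{t. P t} \<inter> {t. Q t}"] meet[of "{t. P t}" "{t. Q t}"] by blast
    show "{t. P t} \<in> M" if "\<And>t. m \<le> t \<Longrightarrow> P t" for m P
    proof -
      have "- {t. P t} \<subseteq> {..<m}" using that not_le by blast
      then have "finite (- {t. P t})" by (rule finite_subset) simp
      then show ?thesis by (rule cof)
    qed
  qed
  then show ?thesis by blast
qed

section \<open>A countable stock of sequences\<close>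

datatype 'o tree = Op 'o "'o tree list"
instance tree :: (countable) countable by countable_datatype
instance cyl_fm :: countable by countable_datatype

datatype obj = El "(sort, label) atom set" | So sort | La label

text \<open>Terms over these operations evaluate to a countable set of sequences closed under everything that
  is needed later: Skolem witnesses, atoms below elements, and the ranks and labels of new facets.\<close>

datatype oper = OJoin | OMeet | OCompl | OZero | OOne | OCyl nat | ODiag nat nat | OWit cyl_fm nat | OPick
  | OKd nat | OLab nat | OMk "(nat \<times> nat) list" | OSort sort | OLabel label | ORank nat nat | OList
instance oper :: countable by countable_datatype

definition unEl :: "nat \<Rightarrow> obj \<Rightarrow> (sort, label) atom set" where
  "unEl n x = (case x of El X \<Rightarrow> if X \<in> carrier (Alg n) then X else {} | _ \<Rightarrow> {})"

definition unSo :: "obj \<Rightarrow> sort" where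
  "unSo x = (case x of So k \<Rightarrow> k | _ \<Rightarrow> SP)"

definition unLa :: "obj \<Rightarrow> label" where
  "unLa x = (case x of La k \<Rightarrow> k | _ \<Rightarrow> LW0)"

lemma un_simps [simp]: "X \<in> carrier (Alg n) \<Longrightarrow> unEl n (El X) = X" "unSo (So k) = k" "unLa (La l) = l"
  by (simp_all add: unEl_def unSo_def unLa_def)

definition mk :: "nat \<Rightarrow> (nat \<Rightarrow> sort) \<Rightarrow> (nat \<Rightarrow> nat \<Rightarrow> bool) \<Rightarrow> (nat \<Rightarrow> label) \<Rightarrow> (sort, label) atom" where
  "mk n k e l = Atom (\<lambda>i. if i < n then k i else SP) (\<lambda>i j. i < n \<and> j < n \<and> e i j) (\<lambda>i. if i < n then l i else LW0)"

definition wit :: "nat \<Rightarrow> cyl_fm \<Rightarrow> nat \<Rightarrow> (nat \<Rightarrow> (sort, label) atom set) \<Rightarrow> (sort, label) atom set" where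
  "wit n \<phi> v e = (if \<exists>X\<in>carrier (Alg n). satisfies (Alg n) (e(v := X)) \<phi>
     then SOME X. X \<in> carrier (Alg n) \<and> satisfies (Alg n) (e(v := X)) \<phi> else {})"

definition pick :: "(sort, label) atom set \<Rightarrow> (sort, label) atom set" where
  "pick X = (if X = {} then {} else {SOME a. a \<in> X})"

text \<open>The index \<open>t\<close> itself enters only through \<open>ORank\<close>: the identity
  sequence, shifted by a standard amount, is the source of infinite ranks. \<open>OMk\<close>
  intersects with \<open>At n\<close> so that inconsistent colours give the zero element.\<close>

fun app :: "nat \<Rightarrow> oper \<Rightarrow> nat \<Rightarrow> obj list \<Rightarrow> obj" where
  "app n OJoin t xs = El (unEl n (xs ! 0) \<union> unEl n (xs ! 1))"
| "app n OMeet t xs = El (unEl n (xs ! 0) \<inter> unEl n (xs ! 1))"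
| "app n OCompl t xs = El (At n - unEl n (xs ! 0))"
| "app n OZero t xs = El {}"
| "app n OOne t xs = El (At n)"
| "app n (OCyl i) t xs = El (cyl (Alg n) i (unEl n (xs ! 0)))"
| "app n (ODiag i j) t xs = El (diag (Alg n) i j)"
| "app n (OWit \<phi> v) t xs = El (wit n \<phi> v (\<lambda>u. if u < length xs then unEl n (xs ! u) else {}))"
| "app n OPick t xs = El (pick (unEl n (xs ! 0)))"
| "app n (OKd j) t xs = So (kd (SOME a. a \<in> unEl n (xs ! 0)) j)"
| "app n (OLab j) t xs = La (lab (SOME a. a \<in> unEl n (xs ! 0)) j)"
| "app n (OMk es) t xs = El ({mk n (\<lambda>i. unSo (xs ! i)) (\<lambda>i j. (i, j) \<in> set es) (\<lambda>i. unLa (xs ! (n + i)))} \<inter> At n)"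
| "app n (OSort k) t xs = So k"
| "app n (OLabel l) t xs = La l"
| "app n (ORank a b) t xs = La (LR (t + a - b))"
| "app n OList t xs = La (LY (map unSo xs))"

fun tval :: "nat \<Rightarrow> oper tree \<Rightarrow> nat \<Rightarrow> obj" where
  "tval n (Op f ts) t = app n f t (map (\<lambda>x. tval n x t) ts)"

definition SS :: "nat \<Rightarrow> (nat \<Rightarrow> obj) set" where
  "SS n = range (tval n)"

definition SE :: "nat \<Rightarrow> (nat \<Rightarrow> (sort, label) atom set) set" where
  "SE n = {x. (\<lambda>t. El (x t)) \<in> SS n \<and> (\<forall>t. x t \<in> carrier (Alg n))}"

definition SK :: "nat \<Rightarrow> (nat \<Rightarrow> sort) set" where
  "SK n = {k. (\<lambda>t. So (k t)) \<in> SS n}"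

definition SL :: "nat \<Rightarrow> (nat \<Rightarrow> label) set" where
  "SL n = {l. (\<lambda>t. La (l t)) \<in> SS n}"

lemma SS_closed:
  assumes "set xs \<subseteq> SS n"
  shows "(\<lambda>t. app n f t (map (\<lambda>x. x t) xs)) \<in> SS n"
proof -
  have "\<exists>ts. xs = map (tval n) ts" using assms unfolding ex_map_conv SS_def by blast
  then obtain ts where "xs = map (tval n) ts" by blast
  then have "(\<lambda>t. app n f t (map (\<lambda>x. x t) xs)) = tval n (Op f ts)" by (auto simp: fun_eq_iff comp_def)
  then show ?thesis by (simp add: SS_def)
qed

lemma countable_S: "countable (SE n)" "countable (SK n)" "countable (SL n)"
proof -
  have c: "countable (SS n)" by (simp add: SS_def)
  have "x \<in> (\<lambda>s t. unEl n (s t)) ` SS n" if "x \<in> SE n" for x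
    using that by (intro image_eqI[of _ _ "\<lambda>t. El (x t)"]) (auto simp: SE_def)
  then show "countable (SE n)" using c by (meson countable_image countable_subset subsetI)
  have "x \<in> (\<lambda>s t. unSo (s t)) ` SS n" if "x \<in> SK n" for x
    using that by (intro image_eqI[of _ _ "\<lambda>t. So (x t)"]) (auto simp: SK_def)
  then show "countable (SK n)" using c by (meson countable_image countable_subset subsetI)
  have "x \<in> (\<lambda>s t. unLa (s t)) ` SS n" if "x \<in> SL n" for x
    using that by (intro image_eqI[of _ _ "\<lambda>t. La (x t)"]) (auto simp: SL_def)
  then show "countable (SL n)" using c by (meson countable_image countable_subset subsetI)
qed

lemma SE_carrier: "x \<in> SE n \<Longrightarrow> x t \<in> carrier (Alg n)"
  by (simp add: SE_def)

lemma SE_El: "x \<in> SE n \<Longrightarrow> (\<lambda>t. El (x t)) \<in> SS n"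
  by (simp add: SE_def)

lemma SE_intro:
  assumes "set xs \<subseteq> SS n" "\<And>t. app n f t (map (\<lambda>x. x t) xs) = El (y t)" "\<And>t. y t \<in> carrier (Alg n)"
  shows "y \<in> SE n"
  using SS_closed[OF assms(1), of f] assms(2,3) by (simp add: SE_def)

lemma pick_Alg: "X \<in> carrier (Alg n) \<Longrightarrow> pick X \<in> carrier (Alg n)"
proof (cases "X = {}")
  case False
  assume X: "X \<in> carrier (Alg n)"
  have "(SOME a. a \<in> X) \<in> X" using False by (simp add: some_in_eq)
  then show ?thesis using carrier_Alg_subset[OF X] atom_Alg False by (auto simp: pick_def)
qed (simp add: pick_def)

lemma wit_Alg: "wit n \<phi> v e \<in> carrier (Alg n)"
  and wit_sat: "\<exists>X\<in>carrier (Alg n). satisfies (Alg n) (e(v := X)) \<phi> \<Longrightarrow> satisfies (Alg n) (e(v := wit n \<phi> v e)) \<phi>"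
proof -
  let ?P = "\<lambda>X. X \<in> carrier (Alg n) \<and> satisfies (Alg n) (e(v := X)) \<phi>"
  have "?P (SOME X. ?P X)" if "\<exists>X\<in>carrier (Alg n). satisfies (Alg n) (e(v := X)) \<phi>"
    using that by (intro someI_ex[of ?P]) blast
  then show "wit n \<phi> v e \<in> carrier (Alg n)"
    "\<exists>X\<in>carrier (Alg n). satisfies (Alg n) (e(v := X)) \<phi> \<Longrightarrow> satisfies (Alg n) (e(v := wit n \<phi> v e)) \<phi>"
    unfolding wit_def using Alg_closed(4) by (simp_all split: if_splits)
qed

lemma SE_closed:
  "x \<in> SE n \<Longrightarrow> y \<in> SE n \<Longrightarrow> (\<lambda>t. x t \<union> y t) \<in> SE n"
  "x \<in> SE n \<Longrightarrow> y \<in> SE n \<Longrightarrow> (\<lambda>t. x t \<inter> y t) \<in> SE n"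
  "x \<in> SE n \<Longrightarrow> (\<lambda>t. At n - x t) \<in> SE n"
  "(\<lambda>t. {}) \<in> SE n" "(\<lambda>t. At n) \<in> SE n"
  "x \<in> SE n \<Longrightarrow> (\<lambda>t. cyl (Alg n) i (x t)) \<in> SE n"
  "(\<lambda>t. diag (Alg n) i j) \<in> SE n"
  "x \<in> SE n \<Longrightarrow> (\<lambda>t. pick (x t)) \<in> SE n"
  by (rule SE_intro[of "[\<lambda>t. El (x t), \<lambda>t. El (y t)]" n OJoin], use SE_carrier SE_El Alg_closed in auto)
    (rule SE_intro[of "[\<lambda>t. El (x t), \<lambda>t. El (y t)]" n OMeet], use SE_carrier SE_El Alg_closed in auto,
     rule SE_intro[of "[\<lambda>t. El (x t)]" n OCompl], use SE_carrier SE_El Alg_closed in auto,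
     rule SE_intro[of "[]" n OZero], use Alg_closed in auto,
     rule SE_intro[of "[]" n OOne], use Alg_closed in auto,
     rule SE_intro[of "[\<lambda>t. El (x t)]" n "OCyl i"], use SE_carrier SE_El Alg_closed in auto,
     rule SE_intro[of "[]" n "ODiag i j"], use Alg_closed in auto,
     rule SE_intro[of "[\<lambda>t. El (x t)]" n OPick], use SE_carrier SE_El pick_Alg in auto)

lemma SE_wit:
  assumes "set es \<subseteq> SE n"
  shows "(\<lambda>t. wit n \<phi> v (\<lambda>u. if u < length es then (es ! u) t else {})) \<in> SE n"
proof (rule SE_intro[of "map (\<lambda>x t. El (x t)) es" n "OWit \<phi> v"])
  have "unEl n (El ((es ! u) t)) = (es ! u) t" if "u < length es" for u t
  proof -
    have "es ! u \<in> SE n" using assms nth_mem[OF that] by blast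
    then show ?thesis by (simp add: SE_carrier)
  qed
  then show "app n (OWit \<phi> v) t (map (\<lambda>x. x t) (map (\<lambda>x t. El (x t)) es)) =
        El (wit n \<phi> v (\<lambda>u. if u < length es then (es ! u) t else {}))" for t
    by (simp cong: if_cong)
qed (use assms SE_El wit_Alg in auto)

lemma SK_kd: "x \<in> SE n \<Longrightarrow> (\<lambda>t. kd (SOME a. a \<in> x t) j) \<in> SK n"
  using SS_closed[of "[\<lambda>t. El (x t)]" n "OKd j"] SE_carrier SE_El by (simp add: SK_def)

lemma SL_lab: "x \<in> SE n \<Longrightarrow> (\<lambda>t. lab (SOME a. a \<in> x t) j) \<in> SL n"
  using SS_closed[of "[\<lambda>t. El (x t)]" n "OLab j"] SE_carrier SE_El by (simp add: SL_def)

lemma SK_const: "(\<lambda>t. k) \<in> SK n"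
  using SS_closed[of "[]" n "OSort k"] by (simp add: SK_def)

lemma SL_const: "(\<lambda>t. l) \<in> SL n"
  using SS_closed[of "[]" n "OLabel l"] by (simp add: SL_def)

lemma SL_rank: "(\<lambda>t. LR (t + a - b)) \<in> SL n"
  using SS_closed[of "[]" n "ORank a b"] by (simp add: SL_def)

lemma SL_list: "set ks \<subseteq> SK n \<Longrightarrow> (\<lambda>t. LY (map (\<lambda>k. k t) ks)) \<in> SL n"
proof -
  assume "set ks \<subseteq> SK n"
  then have "set (map (\<lambda>k t. So (k t)) ks) \<subseteq> SS n" by (auto simp: SK_def)
  from SS_closed[OF this, of OList] show ?thesis by (simp add: SL_def comp_def)
qed

text \<open>Completeness of the representation rests on this closure: a type with colours from the
  stock is, as a sequence of singletons, itself an element of the algebra of sequences.\<close>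

lemma SE_mk:
  assumes "\<And>i. i < n \<Longrightarrow> k i \<in> SK n" "\<And>i. i < n \<Longrightarrow> l i \<in> SL n"
  shows "(\<lambda>t. {mk n (\<lambda>i. k i t) e (\<lambda>i. l i t)} \<inter> At n) \<in> SE n"
proof -
  have "finite ({..<n} \<times> {..<n} \<inter> {(i, j). e i j})" by simp
  then obtain es where es: "set es = {..<n} \<times> {..<n} \<inter> {(i, j). e i j}" using finite_list by metis
  let ?xs = "map (\<lambda>i t. So (k i t)) [0..<n] @ map (\<lambda>i t. La (l i t)) [0..<n]"
  show ?thesis
  proof (rule SE_intro[of ?xs n "OMk es"])
    show "set ?xs \<subseteq> SS n" using assms by (auto simp: SK_def SL_def)
    show "app n (OMk es) t (map (\<lambda>x. x t) ?xs) = El ({mk n (\<lambda>i. k i t) e (\<lambda>i. l i t)} \<inter> At n)" for t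
    proof -
      have "mk n (\<lambda>i. unSo (map (\<lambda>x. x t) ?xs ! i)) (\<lambda>i j. (i, j) \<in> set es) (\<lambda>i. unLa (map (\<lambda>x. x t) ?xs ! (n + i))) =
          mk n (\<lambda>i. k i t) e (\<lambda>i. l i t)"
        unfolding mk_def by (auto simp: nth_append es fun_eq_iff)
      then show ?thesis by simp
    qed
    have "X = {} \<or> X \<in> (\<lambda>a. {a}) ` At n" if "X = {a} \<inter> At n" for X and a :: "(sort, label) atom" using that by auto
    then show "{mk n (\<lambda>i. k i t) e (\<lambda>i. l i t)} \<inter> At n \<in> carrier (Alg n)" for t
      using atom_Alg Alg_closed(4) by (metis (no_types, lifting) imageE)
  qed
qed

lemma eval_term_cong: "(\<And>u. u \<in> term_vars t \<Longrightarrow> e u = e' u) \<Longrightarrow> eval_term A e t = eval_term A e' t"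
  by (induction t) auto

lemma satisfies_cong: "(\<And>u. u \<in> free_vars \<phi> \<Longrightarrow> e u = e' u) \<Longrightarrow> satisfies A e \<phi> = satisfies A e' \<phi>"
proof (induction \<phi> arbitrary: e e')
  case (Eq s t)
  then show ?case using eval_term_cong[of s e e' A] eval_term_cong[of t e e' A] by simp
next
  case (Ex v \<phi>)
  have "satisfies A (e(v := x)) \<phi> = satisfies A (e'(v := x)) \<phi>" for x
    by (rule Ex.IH) (use Ex.prems in auto)
  then show ?case by (simp only: satisfies.simps)
next
  case (Neg \<phi>)
  have "satisfies A e \<phi> = satisfies A e' \<phi>" by (rule Neg.IH) (use Neg.prems in simp)
  then show ?case by (simp only: satisfies.simps)
next
  case (Conj \<phi> \<psi>)
  have "satisfies A e \<phi> = satisfies A e' \<phi>" by (rule Conj.IH(1)) (use Conj.prems in simp)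
  moreover have "satisfies A e \<psi> = satisfies A e' \<psi>" by (rule Conj.IH(2)) (use Conj.prems in simp)
  ultimately show ?case by (simp only: satisfies.simps)
qed

lemma finite_free_vars: "finite (free_vars \<phi>)"
proof -
  have "finite (term_vars t)" for t by (induction t) auto
  then show ?thesis by (induction \<phi>) auto
qed

section \<open>The quotient by the ultrafilter and the theorem of Los\<close>

context ultra
begin

lemma ev_mono: "ev P \<Longrightarrow> (\<And>t. P t \<Longrightarrow> Q t) \<Longrightarrow> ev Q"
proof -
  assume P: "ev P" and PQ: "\<And>t. P t \<Longrightarrow> Q t"
  have "(\<lambda>t. P t \<and> Q t) = P" using PQ by blast
  then show "ev Q" using ev_conj[of P Q] P by simp
qed

lemma ev_mono2: "ev P \<Longrightarrow> ev Q \<Longrightarrow> (\<And>t. P t \<Longrightarrow> Q t \<Longrightarrow> R t) \<Longrightarrow> ev R"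
  using ev_mono[of "\<lambda>t. P t \<and> Q t" R] ev_conj by blast

lemma ev_mono3: "ev P \<Longrightarrow> ev Q \<Longrightarrow> ev R \<Longrightarrow> (\<And>t. P t \<Longrightarrow> Q t \<Longrightarrow> R t \<Longrightarrow> S t) \<Longrightarrow> ev S"
  using ev_mono2[of "\<lambda>t. P t \<and> Q t" R S] ev_conj by blast

lemma ev_true: "(\<And>t. P t) \<Longrightarrow> ev P"
  by (rule ev_cofinite[of 0])

lemma ev_const [simp]: "ev (\<lambda>t. b) \<longleftrightarrow> b"
  using ev_not[of "\<lambda>t. True"] ev_true[of "\<lambda>t. True"] by (cases b) auto

lemma ev_disj: "ev (\<lambda>t. P t \<or> Q t) \<longleftrightarrow> ev P \<or> ev Q"
proof -
  have "ev (\<lambda>t. P t \<or> Q t) = ev (\<lambda>t. \<not> (\<not> P t \<and> \<not> Q t))" by simp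
  then show ?thesis unfolding ev_not ev_conj by blast
qed

lemma ev_all_less: "ev (\<lambda>t. \<forall>i<m. P i t) \<longleftrightarrow> (\<forall>i<m. ev (P i))" for m :: nat
proof (induction m)
  case (Suc m)
  have "(\<lambda>t. \<forall>i<Suc m. P i t) = (\<lambda>t. P m t \<and> (\<forall>i<m. P i t))" by (auto simp: less_Suc_eq)
  then show ?case using Suc ev_conj[of "P m" "\<lambda>t. \<forall>i<m. P i t"] by (auto simp: less_Suc_eq)
qed simp

lemma ev_bex: "finite Q \<Longrightarrow> ev (\<lambda>t. \<exists>q\<in>Q. P q t) \<longleftrightarrow> (\<exists>q\<in>Q. ev (P q))"
  by (induction Q rule: finite_induct) (simp_all add: ev_disj)

lemma ev_agree: "ev (\<lambda>t. P t \<longleftrightarrow> ev P)"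
proof (cases "ev P")
  case True
  then show ?thesis by simp
next
  case False
  then show ?thesis using ev_not[of P] by simp
qed

definition sim :: "(nat \<Rightarrow> 'x) \<Rightarrow> (nat \<Rightarrow> 'x) \<Rightarrow> bool" where
  "sim x y \<longleftrightarrow> ev (\<lambda>t. x t = y t)"

text \<open>Selects one representative in \<open>S\<close> from each class modulo \<open>ev\<close>.
  The selecting predicate depends only on the class, so equality in the quotient is plain equality
  of sequences.\<close>

definition canon :: "(nat \<Rightarrow> 'x) set \<Rightarrow> (nat \<Rightarrow> 'x) \<Rightarrow> nat \<Rightarrow> 'x" where
  "canon S x = (SOME y. y \<in> S \<and> sim x y)"

lemma sim_refl: "sim x x"
  by (simp add: sim_def)

lemma sim_sym: "sim x y \<Longrightarrow> sim y x"
  unfolding sim_def by (erule ev_mono) simp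

lemma sim_trans: "sim x y \<Longrightarrow> sim y z \<Longrightarrow> sim x z"
  unfolding sim_def by (erule (1) ev_mono2) simp

lemma canon_in: "x \<in> S \<Longrightarrow> canon S x \<in> S" and sim_canon: "x \<in> S \<Longrightarrow> sim x (canon S x)"
proof -
  assume "x \<in> S"
  then have "canon S x \<in> S \<and> sim x (canon S x)" unfolding canon_def
    using sim_refl by (intro someI_ex[of "\<lambda>y. y \<in> S \<and> sim x y"]) blast
  then show "canon S x \<in> S" "sim x (canon S x)" by blast+
qed

lemma canon_sim: "sim x y \<Longrightarrow> canon S x = canon S y"
proof -
  assume "sim x y"
  then have "sim x = sim y" using sim_sym sim_trans by blast
  then show ?thesis by (simp add: canon_def)
qed

lemma canon_eq_iff:
  assumes "x \<in> S" "y \<in> S"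
  shows "canon S x = canon S y \<longleftrightarrow> sim x y"
proof
  assume eq: "canon S x = canon S y"
  have "sim x (canon S x)" "sim y (canon S x)" using sim_canon[OF assms(1)] sim_canon[OF assms(2)] eq by simp_all
  then show "sim x y" using sim_trans[OF _ sim_sym] by blast
qed (rule canon_sim)

lemma canonical:
  assumes "x \<in> canon S ` S"
  shows "x \<in> S" "canon S x = x"
proof -
  obtain y where y: "y \<in> S" "x = canon S y" using assms by blast
  show "x \<in> S" using canon_in[OF y(1)] y(2) by simp
  show "canon S x = x" using canon_sim[OF sim_canon[OF y(1)], of S] y(2) by simp
qed

lemma canonical_eq:
  assumes "x \<in> canon S ` S" "y \<in> canon S ` S"
  shows "x = y \<longleftrightarrow> ev (\<lambda>t. x t = y t)"
  using canon_eq_iff[OF canonical(1)[OF assms(1)] canonical(1)[OF assms(2)]]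
    canonical(2)[OF assms(1)] canonical(2)[OF assms(2)] by (simp add: sim_def)

definition UB :: "nat \<Rightarrow> (nat \<Rightarrow> (sort, label) atom set) cyl_alg" where
  "UB n = (let c = canon (SE n) in
    \<lparr>carrier = c ` SE n, join = (\<lambda>x y. c (\<lambda>t. x t \<union> y t)), meet = (\<lambda>x y. c (\<lambda>t. x t \<inter> y t)),
     compl = (\<lambda>x. c (\<lambda>t. At n - x t)), zero = c (\<lambda>t. {}), one = c (\<lambda>t. At n),
     cyl = (\<lambda>i x. c (\<lambda>t. cyl (Alg n) i (x t))), diag = (\<lambda>i j. c (\<lambda>t. diag (Alg n) i j))\<rparr>)"

lemma UB_simps [simp]:
  "carrier (UB n) = canon (SE n) ` SE n" "x \<oplus>\<^bsub>UB n\<^esub> y = canon (SE n) (\<lambda>t. x t \<union> y t)"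
  "x \<odot>\<^bsub>UB n\<^esub> y = canon (SE n) (\<lambda>t. x t \<inter> y t)" "\<ominus>\<^bsub>UB n\<^esub> x = canon (SE n) (\<lambda>t. At n - x t)"
  "\<zero>\<^bsub>UB n\<^esub> = canon (SE n) (\<lambda>t. {})" "\<one>\<^bsub>UB n\<^esub> = canon (SE n) (\<lambda>t. At n)"
  "cyl (UB n) i x = canon (SE n) (\<lambda>t. cyl (Alg n) i (x t))" "diag (UB n) i j = canon (SE n) (\<lambda>t. diag (Alg n) i j)"
  by (simp_all add: UB_def Let_def)

lemma cyl_structure_UB: "cyl_structure n (UB n)"
  using canonical(1)[of _ "SE n"] SE_closed by unfold_locales (auto simp del: Alg_simps)

lemma eval_UB:
  assumes e: "range e \<subseteq> canon (SE n) ` SE n"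
  shows "(\<lambda>s. eval_term (Alg n) (\<lambda>v. e v s) t) \<in> SE n \<and>
    eval_term (UB n) e t = canon (SE n) (\<lambda>s. eval_term (Alg n) (\<lambda>v. e v s) t)"
proof -
  have ss: "ev (\<lambda>t. x t = canon (SE n) x t)" if "x \<in> SE n" for x using sim_canon[OF that] by (simp add: sim_def)
  have J: "ev (\<lambda>x. eval_term (Alg n) (\<lambda>v. e v x) s = eval_term (UB n) e s x)"
    if "(\<lambda>x. eval_term (Alg n) (\<lambda>v. e v x) s) \<in> SE n \<and>
      eval_term (UB n) e s = canon (SE n) (\<lambda>x. eval_term (Alg n) (\<lambda>v. e v x) s)" for s
    unfolding conjunct2[OF that] by (rule ss[OF conjunct1[OF that]])
  show ?thesis
  proof (induction t)
    case (Var v)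
    have "e v \<in> canon (SE n) ` SE n" using e by blast
    from canonical[OF this] show ?case by simp
  next
    case (Join s t)
    have "sim (\<lambda>x. eval_term (UB n) e s x \<union> eval_term (UB n) e t x) (\<lambda>x. eval_term (Alg n) (\<lambda>v. e v x) s \<union> eval_term (Alg n) (\<lambda>v. e v x) t)"
      unfolding sim_def by (rule ev_mono2[OF J[OF Join(1)] J[OF Join(2)]]) simp
    from canon_sim[OF this, of "SE n"] show ?case using SE_closed(1)[OF conjunct1[OF Join(1)] conjunct1[OF Join(2)]] by simp
  next
    case (Meet s t)
    have "sim (\<lambda>x. eval_term (UB n) e s x \<inter> eval_term (UB n) e t x) (\<lambda>x. eval_term (Alg n) (\<lambda>v. e v x) s \<inter> eval_term (Alg n) (\<lambda>v. e v x) t)"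
      unfolding sim_def by (rule ev_mono2[OF J[OF Meet(1)] J[OF Meet(2)]]) simp
    from canon_sim[OF this, of "SE n"] show ?case using SE_closed(2)[OF conjunct1[OF Meet(1)] conjunct1[OF Meet(2)]] by simp
  next
    case (Compl s)
    have "sim (\<lambda>x. At n - eval_term (UB n) e s x) (\<lambda>x. At n - eval_term (Alg n) (\<lambda>v. e v x) s)"
      unfolding sim_def by (rule ev_mono[OF J[OF Compl]]) simp
    from canon_sim[OF this, of "SE n"] show ?case using SE_closed(3)[OF conjunct1[OF Compl]] by simp
  next
    case (Cyl i s)
    have "sim (\<lambda>x. cyl (Alg n) i (eval_term (UB n) e s x)) (\<lambda>x. cyl (Alg n) i (eval_term (Alg n) (\<lambda>v. e v x) s))"
      unfolding sim_def by (rule ev_mono[OF J[OF Cyl]]) simp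
    from canon_sim[OF this, of "SE n"] show ?case using SE_closed(6)[OF conjunct1[OF Cyl]] by (simp del: Alg_simps)
  qed (use SE_closed in \<open>simp_all del: Alg_simps(6,7)\<close>)
qed

text \<open>The theorem of Los for a subalgebra of the ultrapower. In the existential case the
  witnesses chosen index by index must form a sequence of the stock, which the Skolem operations
  \<open>OWit\<close> guarantee.\<close>

lemma satisfies_UB:
  assumes "range e \<subseteq> canon (SE n) ` SE n"
  shows "satisfies (UB n) e \<phi> \<longleftrightarrow> ev (\<lambda>t. satisfies (Alg n) (\<lambda>v. e v t) \<phi>)"
  using assms
proof (induction \<phi> arbitrary: e)
  case (Eq s t)
  then show ?case using eval_UB[OF Eq, of s] eval_UB[OF Eq, of t]
      canon_eq_iff[of "\<lambda>x. eval_term (Alg n) (\<lambda>v. e v x) s" "SE n" "\<lambda>x. eval_term (Alg n) (\<lambda>v. e v x) t"]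
    by (simp add: sim_def)
next
  case (Neg \<phi>)
  then show ?case by (simp add: ev_not)
next
  case (Conj \<phi> \<psi>)
  then show ?case by (simp add: ev_conj)
next
  case (Ex v \<phi>)
  have upd: "(\<lambda>u. (e(v := x)) u t) = (\<lambda>u. e u t)(v := x t)" for x t by (simp add: fun_eq_iff)
  have IH: "satisfies (UB n) (e(v := x)) \<phi> \<longleftrightarrow> ev (\<lambda>t. satisfies (Alg n) ((\<lambda>u. e u t)(v := x t)) \<phi>)"
    if "x \<in> canon (SE n) ` SE n" for x
  proof -
    have "range (e(v := x)) \<subseteq> canon (SE n) ` SE n" using Ex.prems that by auto
    from Ex.IH[OF this] show ?thesis unfolding upd .
  qed
  show ?case
  proof
    assume "satisfies (UB n) e (Ex v \<phi>)"
    then obtain x where x: "x \<in> canon (SE n) ` SE n" "satisfies (UB n) (e(v := x)) \<phi>" by auto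
    have "x t \<in> carrier (Alg n)" for t using canonical(1)[OF x(1)] SE_carrier by blast
    moreover have "ev (\<lambda>t. satisfies (Alg n) ((\<lambda>u. e u t)(v := x t)) \<phi>)" using IH[OF x(1)] x(2) by blast
    ultimately show "ev (\<lambda>t. satisfies (Alg n) (\<lambda>v. e v t) (Ex v \<phi>))" by (elim ev_mono) auto
  next
    assume ex: "ev (\<lambda>t. satisfies (Alg n) (\<lambda>v. e v t) (Ex v \<phi>))"
    \<comment> \<open>Operations on the stock take finite lists of arguments. Free variables are
      bounded, so a list of length \<open>N\<close> determines the witness; all later variables are
      read as the empty set.\<close>
    obtain N where N: "\<forall>u\<in>free_vars \<phi>. u < N"
      using finite_free_vars[of \<phi>] unfolding finite_nat_set_iff_bounded by blast
    let ?es = "map e [0..<N]"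
    let ?f = "\<lambda>t u. if u < length ?es then (?es ! u) t else {}"
    let ?w = "\<lambda>t. wit n \<phi> v (?f t)"
    have "e u \<in> SE n" for u by (rule canonical(1)) (use Ex.prems in blast)
    then have wS: "?w \<in> SE n" by (intro SE_wit) auto
    have cong: "satisfies (Alg n) ((?f t)(v := X)) \<phi> = satisfies (Alg n) ((\<lambda>u. e u t)(v := X)) \<phi>" for t X
      using N by (intro satisfies_cong) auto
    have "ev (\<lambda>t. satisfies (Alg n) ((\<lambda>u. e u t)(v := ?w t)) \<phi>)"
    proof (rule ev_mono[OF ex])
      fix t assume "satisfies (Alg n) (\<lambda>v. e v t) (Ex v \<phi>)"
      then have "\<exists>X\<in>carrier (Alg n). satisfies (Alg n) ((?f t)(v := X)) \<phi>" unfolding cong by simp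
      from wit_sat[OF this] show "satisfies (Alg n) ((\<lambda>u. e u t)(v := ?w t)) \<phi>" unfolding cong .
    qed
    moreover have "ev (\<lambda>t. ?w t = canon (SE n) ?w t)" using sim_canon[OF wS] unfolding sim_def .
    ultimately have "ev (\<lambda>t. satisfies (Alg n) ((\<lambda>u. e u t)(v := canon (SE n) ?w t)) \<phi>)"
      by (rule ev_mono2) metis
    moreover have c: "canon (SE n) ?w \<in> canon (SE n) ` SE n" using wS by blast
    ultimately have "satisfies (UB n) (e(v := canon (SE n) ?w)) \<phi>" using IH[OF c] by blast
    then show "satisfies (UB n) e (Ex v \<phi>)" using c by auto
  qed
qed

end

section \<open>The free model\<close>

datatype ('k, 'l) node = Nd (srt: 'k) (chl: "(('k, 'l) node \<times> 'l) list") (top: 'l)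

definition D :: "('k, 'l) node \<Rightarrow> ('k, 'l) node set" where
  "D u = fst ` set (chl u)"

text \<open>The child lists store the labels of the facets a node spans with its children: the label
  paired with \<open>d\<close> belongs to the facet omitting \<open>d\<close>, while \<open>top\<close> belongs to the set of all children.\<close>

definition nl :: "('k, 'l) node \<Rightarrow> ('k, 'l) node set \<Rightarrow> 'l" where
  "nl u E = (if E = D u then top u else the (map_of (chl u) (THE d. d \<in> D u - E)))"

lemma size_D: "d \<in> D u \<Longrightarrow> size d < size u"
proof (cases u)
  case (Nd k ps t)
  have "(d, b) \<in> set ps \<Longrightarrow> size d < Suc (size_list (size_prod size (\<lambda>_. 0)) ps)" for b
    by (induction ps) auto
  then show "d \<in> D u \<Longrightarrow> size d < size u" using Nd by (auto simp: D_def)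
qed

lemma finite_D [simp]: "finite (D u)"
  by (simp add: D_def)

text \<open>The condition on cardinalities admits the whole child set and its subsets missing one
  child, the only ones for which a node stores labels. The last claim keeps the stored labels within
  the range of \<open>g\<close>.\<close>

lemma node_exists:
  assumes "finite X"
  obtains u where "srt u = k" "D u = X" "\<And>E. E \<subseteq> X \<Longrightarrow> Suc (card E) \<ge> card X \<Longrightarrow> nl u E = g E"
    "insert (top u) (snd ` set (chl u)) \<subseteq> range g"
proof -
  obtain ds where ds: "set ds = X" "distinct ds" using finite_distinct_list[OF assms] by blast
  let ?u = "Nd k (map (\<lambda>d. (d, g (X - {d}))) ds) (g X)"
  have D: "D ?u = X" using ds by (force simp: D_def)
  have "nl ?u E = g E" if E: "E \<subseteq> X" "Suc (card E) \<ge> card X" for E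
  proof (cases "E = X")
    case False
    then have "card (X - E) = card X - card E" "card E < card X"
      using E assms by (auto simp: card_Diff_subset finite_subset psubset_card_mono)
    then have "card (X - E) = 1" using E by simp
    then obtain d where d: "X - E = {d}" by (auto simp: card_1_singleton_iff)
    then have "(THE d. d \<in> X - E) = d" by simp
    moreover have "d \<in> set ds" "X - {d} = E" using d E ds by auto
    moreover have "map_of (map (\<lambda>d. (d, g (X - {d}))) ds) d = Some (g (X - {d}))" if "d \<in> set ds"
      using that by (induction ds) auto
    ultimately show ?thesis using False by (simp add: nl_def D)
  qed (simp add: nl_def D)
  then show thesis using D by (intro that[of ?u]) auto
qed

text \<open>\<open>phi\<close> supplies default red labels and \<open>yy\<close> default base
  labels. The standard frame with all its tints cannot satisfy the assumption on \<open>phi\<close>,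
  since ranks would descend forever along \<open>SZ 0\<close>, \<open>SZ 1\<close> and so
  on.\<close>

locale free_model =
  fixes n :: nat and F :: "('k, 'l) frame" and KK :: "'k set" and LL :: "'l set"
    and phi :: "'k \<Rightarrow> 'l" and yy :: "'k set \<Rightarrow> 'l"
  assumes n: "2 < n"
    and sorts: "pp F \<in> KK" "x0 F \<in> KK" "x1 F \<in> KK" "pp F \<noteq> x0 F" "pp F \<noteq> x1 F" "x0 F \<noteq> x1 F"
    and labels: "w0 F \<in> LL" "w1 F \<in> LL" "gr F \<in> LL" "w0 F \<noteq> w1 F" "gr F \<noteq> w0 F" "\<not> red F (w0 F)" "\<not> red F (w1 F)"
    and phi: "k \<in> KK \<Longrightarrow> isZ F k \<Longrightarrow> phi k \<in> LL \<and> red F (phi k)"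
    and lt: "lt F k k' \<Longrightarrow> isZ F k \<and> isZ F k' \<and> \<not> lt F k' k"
      "lt F k k' \<Longrightarrow> k \<in> KK \<Longrightarrow> k' \<in> KK \<Longrightarrow> sm F (phi k') (phi k)"
    and yy: "finite Q \<Longrightarrow> Q \<subseteq> {k \<in> KK. isZ F k} \<Longrightarrow> yy Q \<in> LL"
      "finite Q \<Longrightarrow> Q \<subseteq> {k \<in> KK. isZ F k} \<Longrightarrow> k \<in> Q \<Longrightarrow> mem F k (yy Q)"
      "finite Q \<Longrightarrow> Q \<subseteq> {k \<in> KK. isZ F k} \<Longrightarrow> k \<in> KK \<Longrightarrow> isZ F k \<Longrightarrow> mem F k (yy Q) \<Longrightarrow> k \<in> Q"
begin

definition N :: "('k, 'l) node set \<Rightarrow> ('k, 'l) node set" where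
  "N S = {v \<in> S. srt v \<noteq> pp F}"

definition rel :: "('k, 'l) node set \<Rightarrow> bool" where
  "rel S \<longleftrightarrow> finite S \<and> card S = n - 1 \<and> card (N S) = 2"

text \<open>Children are strictly smaller than their parent, so at most one node of \<open>S\<close>
  qualifies; it is the one that stores the label of \<open>S\<close>.\<close>

definition asg :: "('k, 'l) node set \<Rightarrow> ('k, 'l) node \<Rightarrow> bool" where
  "asg S w \<longleftrightarrow> w \<in> S \<and> S - {w} \<subseteq> D w"

definition grn :: "('k, 'l) node set \<Rightarrow> bool" where
  "grn S \<longleftrightarrow> rel S \<and> (\<exists>w. asg S w \<and> nl w (S - {w}) = gr F)"

definition C :: "('k, 'l) node set \<Rightarrow> ('k, 'l) node set" where
  "C S = (\<Union>w\<in>S. D w)"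

text \<open>The search is confined to children of members of \<open>S\<close>, which keeps it
  finite. An apex outside \<open>C S\<close> has all of \<open>S\<close> among its children, by
  \<open>top_of_green\<close>, and its admissibility takes care of the simplex.\<close>

definition apexes :: "('k, 'l) node set \<Rightarrow> ('k, 'l) node set" where
  "apexes S = {z \<in> C S - S. isZ F (srt z) \<and> (\<forall>x\<in>N S. grn (insert z (S - {x})))}"

definition common :: "'k \<Rightarrow> ('k, 'l) node set \<Rightarrow> bool" where
  "common k S \<longleftrightarrow> (\<exists>x \<in> C S - S. srt x = k \<and> (\<forall>u\<in>N S. grn (insert x (S - {u}))))"

definition low :: "('k, 'l) node set \<Rightarrow> 'k" where
  "low S = (SOME k. k \<in> srt ` N S \<and> (\<forall>k' \<in> srt ` N S. \<not> lt F k' k))"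

text \<open>Defaults commit to as little as the rules allow. A base admits the tints of the apexes
  counted so far and no others; a facet of two tinted points stays white until common points of both
  base sorts exclude the two whites, and then takes the rank attached to its lower tint.\<close>

definition dflt :: "('k, 'l) node set \<Rightarrow> 'l" where
  "dflt S =
    (if srt ` N S = {x0 F, x1 F} then yy (srt ` apexes S)
     else if \<forall>u\<in>N S. isZ F (srt u) then
       if \<not> common (x0 F) S then w0 F else if \<not> common (x1 F) S then w1 F else phi (low S)
     else w0 F)"

definition L :: "('k, 'l) node set \<Rightarrow> 'l" where
  "L S = (if \<not> rel S then w0 F else if \<exists>w. asg S w then nl (THE w. asg S w) (S - {THE w. asg S w}) else dflt S)"

definition okT :: "('k, 'l) node set \<Rightarrow> bool" where
  "okT T \<longleftrightarrow> (\<forall>a\<in>T. \<forall>b\<in>T. \<forall>c\<in>T. a \<noteq> b \<longrightarrow> a \<noteq> c \<longrightarrow> b \<noteq> c \<longrightarrow>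
     simplex F (srt a) (srt b) (srt c) (L (T - {a})) (L (T - {b})) (L (T - {c})))"

definition base :: "('k, 'l) node set \<Rightarrow> ('k, 'l) node \<Rightarrow> bool" where
  "base G z \<longleftrightarrow> rel G \<and> srt ` N G = {x0 F, x1 F} \<and> isZ F (srt z) \<and> (\<forall>x\<in>N G. grn (insert z (G - {x})))"

text \<open>The last condition keeps a node from becoming a further apex of a base that was
  completed after some of its apexes; the types it would realise there are realised already.\<close>

definition admissible :: "('k, 'l) node \<Rightarrow> bool" where
  "admissible u \<longleftrightarrow> card (D u) \<le> n - 1 \<and> srt u \<in> KK \<and> insert (top u) (snd ` set (chl u)) \<subseteq> LL \<and>
     (\<forall>S. rel S \<longrightarrow> asg S u \<longrightarrow> nl u (S - {u}) \<in> LL \<and>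
        ((\<forall>v\<in>N S. isZ F (srt v)) \<longrightarrow> nl u (S - {u}) = w0 F \<or> nl u (S - {u}) = w1 F \<or> red F (nl u (S - {u})))) \<and>
     (card (D u) = n - 1 \<longrightarrow> card (N (insert u (D u))) = 3 \<longrightarrow> okT (insert u (D u))) \<and>
     (card (D u) = n - 1 \<longrightarrow> base (D u) u \<longrightarrow> (\<exists>g. asg (D u) g))"

inductive valid :: "('k, 'l) node \<Rightarrow> bool" where
  "(\<And>d. d \<in> D u \<Longrightarrow> valid d) \<Longrightarrow> admissible u \<Longrightarrow> valid u"

lemma N_subset: "x \<in> N S \<Longrightarrow> x \<in> S"
  by (simp add: N_def)

lemma valid_admissible: "valid u \<Longrightarrow> admissible u"
  by (erule valid.cases) simp

lemma valid_D: "valid u \<Longrightarrow> d \<in> D u \<Longrightarrow> valid d"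
  by (erule valid.cases) simp

lemma valid_card: "valid u \<Longrightarrow> card (D u) \<le> n - 1"
  using valid_admissible by (simp add: admissible_def)

lemma valid_KK: "valid u \<Longrightarrow> srt u \<in> KK"
  using valid_admissible by (simp add: admissible_def)

lemma not_isZ: "\<not> isZ F (pp F)" "\<not> isZ F (x0 F)" "\<not> isZ F (x1 F)"
  by (simp_all add: isZ_def)

lemma D_irrefl: "u \<notin> D u"
  using size_D by blast

lemma asg_unique: "asg S w \<Longrightarrow> asg S w' \<Longrightarrow> w = w'"
proof (rule ccontr)
  assume "asg S w" "asg S w'" "w \<noteq> w'"
  then have "w' \<in> D w" "w \<in> D w'" by (auto simp: asg_def)
  then show False using size_D[of w' w] size_D[of w w'] by simp
qed

lemma asg_max: "asg S w \<Longrightarrow> t \<in> S \<Longrightarrow> (\<And>s. s \<in> S \<Longrightarrow> size s \<le> size t) \<Longrightarrow> w = t"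
proof (rule ccontr)
  assume "asg S w" "t \<in> S" "\<And>s. s \<in> S \<Longrightarrow> size s \<le> size t" "w \<noteq> t"
  then have "t \<in> D w" "size w \<le> size t" by (auto simp: asg_def)
  then show False using size_D[of t w] by simp
qed

lemma L_asg: "rel S \<Longrightarrow> asg S w \<Longrightarrow> L S = nl w (S - {w})"
proof -
  assume a: "rel S" "asg S w"
  then have "(THE w. asg S w) = w" using asg_unique by blast
  then show ?thesis using a by (auto simp: L_def)
qed

lemma L_dflt: "rel S \<Longrightarrow> \<nexists>w. asg S w \<Longrightarrow> L S = dflt S"
  unfolding L_def by auto

lemma L_grn: "grn S \<Longrightarrow> L S = gr F"
  using L_asg by (auto simp: grn_def)

lemma grn_L:
  assumes "L S = gr F" "x \<in> N S" "z \<in> N S" "isZ F (srt z)" "srt x = x0 F \<or> srt x = x1 F"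
  shows "grn S"
proof -
  have "rel S" using assms(1) labels by (auto simp: L_def split: if_splits)
  moreover have "\<exists>w. asg S w"
  proof (rule ccontr)
    assume "\<nexists>w. asg S w"
    then have "L S = dflt S" using \<open>rel S\<close> L_dflt by blast
    moreover have "srt z \<in> srt ` N S" using assms(3) by blast
    then have "srt ` N S \<noteq> {x0 F, x1 F}" using assms(4) not_isZ by (metis insert_iff singletonD)
    moreover have "\<not> (\<forall>u\<in>N S. isZ F (srt u))" using assms(2,5) not_isZ by metis
    ultimately show False using assms(1) labels by (simp add: dflt_def)
  qed
  ultimately show ?thesis using assms(1) unfolding grn_def by (metis L_asg)
qed

lemma max_size:
  assumes "finite S" "S \<noteq> {}"
  obtains t where "t \<in> S" "\<And>s. s \<in> S \<Longrightarrow> size s \<le> size (t :: ('k, 'l) node)"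
proof -
  have "Max (size ` S) \<in> size ` S" using assms by (intro Max_in) auto
  then obtain t where t: "t \<in> S" "size t = Max (size ` S)" by force
  have "size s \<le> size t" if "s \<in> S" for s using assms(1) that t(2) by simp
  then show thesis using that t(1) by blast
qed

text \<open>The largest node belongs to at least two of the three facets, and it must be the one to
  which these are assigned; together they contain all other points.\<close>

lemma top3:
  assumes T: "finite T" "card T = n" and abc: "a \<in> T" "b \<in> T" "c \<in> T" "a \<noteq> b" "a \<noteq> c" "b \<noteq> c"
    and "asg (T - {a}) wa" "asg (T - {b}) wb" "asg (T - {c}) wc"
  shows "\<exists>t\<in>T. T - {t} \<subseteq> D t"
proof -
  obtain t where t: "t \<in> T" "\<And>s. s \<in> T \<Longrightarrow> size s \<le> size t" by (rule max_size[of T]) (use T abc in auto)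
  have *: "T - {x} - {t} \<subseteq> D t" if "asg (T - {x}) w" "x \<noteq> t" for x w
  proof -
    have "w = t" using asg_max[OF that(1)] t that(2) by auto
    then show ?thesis using that(1) by (simp add: asg_def)
  qed
  consider "a \<noteq> t" "b \<noteq> t" | "a \<noteq> t" "c \<noteq> t" | "b \<noteq> t" "c \<noteq> t" using abc by blast
  then have "T - {t} \<subseteq> D t"
    by cases (use *[OF assms(9)] *[OF assms(10)] *[OF assms(11)] abc in blast)+
  then show ?thesis using t by blast
qed

text \<open>The bound on children makes the rest of \<open>T\<close> the exact child set of
  \<open>t\<close>, so the rules were imposed by the admissibility of \<open>t\<close>.\<close>

lemma top_okT:
  assumes T: "finite T" "card T = n" "card (N T) = 3" and t: "t \<in> T" "T - {t} \<subseteq> D t" "valid t"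
  shows "okT T"
proof -
  have "card (T - {t}) = n - 1" using T t by simp
  then have "D t = T - {t}" by (intro card_seteq[OF finite_D t(2), symmetric]) (use valid_card[OF t(3)] in simp)
  then have "insert t (D t) = T" "card (D t) = n - 1" using t \<open>card (T - {t}) = n - 1\<close> by auto
  moreover have "card (D t) = n - 1 \<longrightarrow> card (N (insert t (D t))) = 3 \<longrightarrow> okT (insert t (D t))"
    using valid_admissible[OF t(3)] unfolding admissible_def by blast
  ultimately show ?thesis using T by simp
qed

text \<open>The largest node of \<open>insert z G\<close> is \<open>z\<close> or \<open>g\<close>.
  If it is \<open>z\<close>, the two green facets make all of \<open>G\<close> children of
  \<open>z\<close>; if it is \<open>g\<close>, one of them makes \<open>z\<close> a child of
  \<open>g\<close>. The bound \<open>n - 1\<close> turns the inclusions into equalities.\<close>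

lemma apex_of_base:
  assumes b: "base G z" and g: "asg G g" "valid g" "valid z" and z: "z \<notin> G"
  shows "D z = G \<or> D g = insert z (G - {g})"
proof -
  have rel: "rel G" and gr: "\<And>x. x \<in> N G \<Longrightarrow> \<exists>w. asg (insert z (G - {x})) w"
    using b by (auto simp: base_def grn_def)
  have fin: "finite G" and cG: "card G = n - 1" using rel by (auto simp: rel_def)
  obtain x y where xy: "N G = {x, y}" "x \<noteq> y" using rel by (auto simp: rel_def card_2_iff)
  then have "x \<in> N G" "y \<in> N G" by auto
  then have xyG: "x \<in> G" "y \<in> G" "x \<noteq> z" "y \<noteq> z" using z N_subset[of x G] N_subset[of y G] by auto
  obtain wx wy where w: "asg (insert z (G - {x})) wx" "asg (insert z (G - {y})) wy"
    using gr[of x] gr[of y] xy(1) by auto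
  obtain t where t: "t \<in> insert z G" "\<And>s. s \<in> insert z G \<Longrightarrow> size s \<le> size t"
    by (rule max_size[of "insert z G"]) (use fin in auto)
  show ?thesis
  proof (cases "t = z")
    case True
    have "wx = z" "wy = z" using asg_max[OF w(1), of z] asg_max[OF w(2), of z] t True by auto
    then have "G - {x} \<subseteq> D z" "G - {y} \<subseteq> D z" using w xyG z by (auto simp: asg_def)
    then have "G \<subseteq> D z" using xy by blast
    then have "D z = G" using valid_card[OF g(3)] cG by (metis card_seteq finite_D)
    then show ?thesis ..
  next
    case False
    then have tG: "t \<in> G" using t by blast
    have gt: "g = t" using asg_max[OF g(1) tG] t by blast
    have "z \<in> D t"
    proof (cases "t = x")
      case True
      then have "wy = t" using asg_max[OF w(2), of t] t xy tG by auto
      then show ?thesis using w(2) False by (auto simp: asg_def)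
    next
      case F: False
      then have "wx = t" using asg_max[OF w(1), of t] t xy tG by auto
      then show ?thesis using w(1) False by (auto simp: asg_def)
    qed
    then have sub: "insert z (G - {g}) \<subseteq> D g" using g(1) gt by (auto simp: asg_def)
    have "card (insert z (G - {g})) = n - 1" using fin z cG tG gt n by (simp add: card_Diff_singleton)
    then have "D g = insert z (G - {g})" using card_seteq[OF finite_D sub] valid_card[OF g(2)] by simp
    then show ?thesis ..
  qed
qed

text \<open>A default is red only if points \<open>x\<close> and \<open>y\<close> of the two base
  sorts are joined by green facets to both tinted points. With the plain points of \<open>S\<close>
  they form a base \<open>G\<close> for both, and comparing sizes shows that one of the two has
  exactly \<open>G\<close> as its children.\<close>

lemma red_base:
  assumes S: "rel S" "\<nexists>w. asg S w" and red: "red F (L S)" and Z: "\<And>v. v \<in> N S \<Longrightarrow> isZ F (srt v)"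
    and val: "\<And>v. v \<in> S \<Longrightarrow> valid v"
  obtains u G where "u \<in> N S" "D u = G" "S - N S \<subseteq> G" "\<And>v. v \<in> N S \<Longrightarrow> base G v \<and> v \<notin> G"
    "\<And>v. v \<in> G \<Longrightarrow> \<not> isZ F (srt v)"
proof -
  have fin: "finite S" and cS: "card S = n - 1" and cN: "card (N S) = 2" using S by (auto simp: rel_def)
  obtain u v where uv: "N S = {u, v}" "u \<noteq> v" using cN by (auto simp: card_2_iff)
  define E where "E = S - {u, v}"
  have uvS: "u \<in> S" "v \<in> S" using uv N_subset[of u S] N_subset[of v S] by auto
  have SE: "S = insert u (insert v E)" using uvS by (auto simp: E_def)
  have uE: "u \<notin> E" "v \<notin> E" and finE: "finite E" and ES: "E \<subseteq> S" using fin by (auto simp: E_def)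
  have cE: "card E = n - 3" using arg_cong[OF SE, of card] uE finE cS uv(2) by simp
  have EP: "srt e = pp F" if "e \<in> E" for e
  proof -
    have "e \<in> S" "e \<notin> N S" using that uv by (auto simp: E_def)
    then show ?thesis by (simp add: N_def)
  qed
  have nX: "srt ` N S \<noteq> {x0 F, x1 F}" using Z[of u] uv not_isZ by (metis imageI insertI1 insert_iff singletonD)
  have common: "common (x0 F) S" "common (x1 F) S"
    using red L_dflt[OF S] labels nX Z by (auto simp: dflt_def split: if_splits)
  obtain x where x: "x \<in> C S" "x \<notin> S" "srt x = x0 F" "\<And>w. w \<in> N S \<Longrightarrow> grn (insert x (S - {w}))"
    using common(1) unfolding common_def by auto
  obtain y where y: "y \<in> C S" "y \<notin> S" "srt y = x1 F" "\<And>w. w \<in> N S \<Longrightarrow> grn (insert y (S - {w}))"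
    using common(2) unfolding common_def by auto
  have xy: "x \<noteq> y" using x y sorts by auto
  define G where "G = insert x (insert y E)"
  have Su: "S - {v} = insert u E" "S - {u} = insert v E" using uvS uv(2) by (auto simp: E_def)
  have gx: "grn (insert x (insert u E))" "grn (insert x (insert v E))"
    "grn (insert y (insert u E))" "grn (insert y (insert v E))"
    using x(4)[of u] x(4)[of v] y(4)[of u] y(4)[of v] uv(1) Su by simp_all
  have xyE: "x \<notin> E" "y \<notin> E" using x(2) y(2) ES by blast+
  have NG: "N G = {x, y}" using x(3) y(3) sorts EP by (auto simp: N_def G_def)
  have cG: "card G = n - 1" "finite G" using xyE xy finE cE n by (auto simp: G_def)
  have relG: "rel G" using cG NG xy by (simp add: rel_def)
  have Gx: "G - {x} = insert y E" "G - {y} = insert x E" using xy xyE by (auto simp: G_def)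
  have bas: "base G w" if "w \<in> N S" for w
  proof -
    have "grn (insert w (insert y E))" "grn (insert w (insert x E))"
      using that gx uv(1) by (auto simp: insert_commute)
    then show ?thesis using that Z relG unfolding base_def NG by (simp add: Gx x(3) y(3))
  qed
  have notG: "w \<notin> G" if "w \<in> N S" for w
  proof -
    have "w = u \<or> w = v" using that uv(1) by blast
    then show ?thesis using uvS uE x(2) y(2) by (auto simp: G_def)
  qed
  have nZ: "\<not> isZ F (srt w)" if "w \<in> G" for w using that EP x(3) y(3) not_isZ by (auto simp: G_def)
  have EG: "S - N S \<subseteq> G" unfolding uv(1) G_def E_def by blast
  define H where "H = insert u (insert v G)"
  have "finite H" using cG by (simp add: H_def)
  then obtain t where t: "t \<in> H" "\<And>s. s \<in> H \<Longrightarrow> size s \<le> size t" by (rule max_size[of H]) (auto simp: H_def)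
  have as: "asg X t" if "grn X" "t \<in> X" "X \<subseteq> H" for X
  proof -
    obtain w where w: "asg X w" using \<open>grn X\<close> unfolding grn_def by blast
    then have "w = t" using asg_max[OF w that(2)] t that(3) by blast
    then show ?thesis using w by simp
  qed
  have sub: "insert x (insert u E) \<subseteq> H" "insert x (insert v E) \<subseteq> H" "insert y (insert u E) \<subseteq> H" "insert y (insert v E) \<subseteq> H"
    by (auto simp: H_def G_def)
  \<comment> \<open>Both \<open>x\<close> and \<open>y\<close> are children of members of
    \<open>S\<close>, hence smaller than some node of \<open>H\<close>.\<close>
  have "t \<noteq> x" "t \<noteq> y"
  proof -
    have SH: "S \<subseteq> H" unfolding SE by (auto simp: H_def G_def)
    have "z \<noteq> t" if "z \<in> C S" for z
    proof -
      obtain w where "w \<in> S" "z \<in> D w" using \<open>z \<in> C S\<close> by (auto simp: C_def)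
      then show ?thesis using size_D[of z w] t(2)[of w] SH by auto
    qed
    then show "t \<noteq> x" "t \<noteq> y" using x(1) y(1) by blast+
  qed
  \<comment> \<open>A largest node among the plain points would have the other \<open>n\<close>
    points of \<open>H\<close> as children, one more than permitted.\<close>
  moreover have "t \<notin> E"
  proof
    assume tE: "t \<in> E"
    have "insert x (insert u E) - {t} \<subseteq> D t" "insert y (insert v E) - {t} \<subseteq> D t"
      using tE as[OF gx(1) _ sub(1)] as[OF gx(4) _ sub(4)] by (simp_all add: asg_def)
    then have "(insert x (insert u E) - {t}) \<union> (insert y (insert v E) - {t}) \<subseteq> D t" by (rule Un_least)
    moreover have "H - {t} = (insert x (insert u E) - {t}) \<union> (insert y (insert v E) - {t})" by (auto simp: H_def G_def)
    ultimately have "H - {t} \<subseteq> D t" by metis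
    then have "card (H - {t}) \<le> card (D t)" by (intro card_mono) auto
    moreover have "card H = n + 1" using notG[of u] notG[of v] uv cG n by (simp add: H_def)
    moreover have "valid t" using tE val ES by blast
    ultimately show False using valid_card[of t] t(1) \<open>finite H\<close> n by simp
  qed
  ultimately have "t = u \<or> t = v" using t(1) by (simp add: H_def G_def)
  then have tN: "t \<in> N S" using uv by blast
  have "insert x E \<subseteq> D t" "insert y E \<subseteq> D t"
  proof -
    have "t \<notin> insert x E" "t \<notin> insert y E" using \<open>t \<noteq> x\<close> \<open>t \<noteq> y\<close> \<open>t \<notin> E\<close> by auto
    moreover have "asg (insert x (insert t E)) t" "asg (insert y (insert t E)) t"
      using \<open>t = u \<or> t = v\<close> as[OF gx(1) _ sub(1)] as[OF gx(2) _ sub(2)] as[OF gx(3) _ sub(3)] as[OF gx(4) _ sub(4)]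
      by (elim disjE; simp)+
    moreover have "insert x E = insert x (insert t E) - {t}" "insert y E = insert y (insert t E) - {t}"
      using calculation(1,2) by auto
    ultimately show "insert x E \<subseteq> D t" "insert y E \<subseteq> D t" unfolding asg_def by metis+
  qed
  then have "G \<subseteq> D t" by (auto simp: G_def)
  moreover have "card (D t) \<le> card G" using valid_card[OF val, OF N_subset[OF tN]] cG by simp
  ultimately have "D t = G" by (metis card_seteq finite_D)
  then show thesis by (intro that[OF tN _ EG]) (use bas notG nZ in auto)
qed

end

context free_model
begin

lemma N_Diff: "N (S - {x}) = N S - {x}"
  by (auto simp: N_def)

lemma rel_facet:
  assumes "finite T" "card T = n" "card (N T) = 3" "x \<in> N T"
  shows "rel (T - {x})"
  using assms N_subset[OF assms(4)] card_Diff_singleton[OF assms(4)] by (simp add: rel_def N_Diff)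

lemma N_eq3:
  assumes "card (N T) = 3" "{a, b, c} \<subseteq> N T" "a \<noteq> b" "a \<noteq> c" "b \<noteq> c"
  shows "N T = {a, b, c}"
proof -
  have "finite (N T)" using assms(1) by (intro card_ge_0_finite) simp
  then show ?thesis using card_subset_eq[of "N T" "{a, b, c}"] assms by simp
qed

lemma low_spec:
  assumes "N S = {u, v}" "isZ F (srt u)" "isZ F (srt v)"
  shows "low S \<in> srt ` N S" "lt F (srt u) (srt v) \<Longrightarrow> low S = srt u" "lt F (srt v) (srt u) \<Longrightarrow> low S = srt v"
proof -
  let ?P = "\<lambda>k. k \<in> srt ` N S \<and> (\<forall>k' \<in> srt ` N S. \<not> lt F k' k)"
  have "?P (srt u) \<or> ?P (srt v)" unfolding assms(1) using lt(1) by (simp; blast)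
  then have P: "?P (low S)" unfolding low_def by (intro someI_ex[of ?P]) blast
  show "low S \<in> srt ` N S" using P by blast
  show "lt F (srt u) (srt v) \<Longrightarrow> low S = srt u" "lt F (srt v) (srt u) \<Longrightarrow> low S = srt v"
    using P unfolding assms(1) by auto
qed

lemma red_phi_low:
  assumes "N S = {u, v}" "isZ F (srt u)" "isZ F (srt v)" "valid u" "valid v"
  shows "red F (phi (low S))" "phi (low S) \<in> LL"
proof -
  have "low S = srt u \<or> low S = srt v" using low_spec(1)[OF assms(1-3)] unfolding assms(1) by blast
  then have "low S \<in> KK" "isZ F (low S)" using assms valid_KK by (elim disjE; simp)+
  then show "red F (phi (low S))" "phi (low S) \<in> LL" using phi by blast+
qed

text \<open>A green facet is assigned. Here it must be assigned to \<open>c\<close>, since any other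
  node would have \<open>c\<close> as a child; the two facets together exhaust
  \<open>T - {c}\<close>.\<close>

lemma top_of_green:
  assumes N: "N T = {a, b, c}" "a \<noteq> b" "a \<noteq> c" "b \<noteq> c" and g: "grn (T - {a})" "grn (T - {b})" and c: "c \<notin> C (T - {c})"
  shows "T - {c} \<subseteq> D c"
proof -
  have cT: "c \<in> T" using N(1) N_subset by blast
  have *: "T - {x} - {c} \<subseteq> D c" if "grn (T - {x})" "x \<noteq> c" for x
  proof -
    obtain w where w: "asg (T - {x}) w" using \<open>grn (T - {x})\<close> unfolding grn_def by blast
    have "w = c"
    proof (rule ccontr)
      assume "w \<noteq> c"
      then have "c \<in> D w" "w \<in> T - {c}" using w cT \<open>x \<noteq> c\<close> unfolding asg_def by blast+
      then show False using c unfolding C_def by blast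
    qed
    then show ?thesis using w unfolding asg_def by blast
  qed
  show ?thesis using *[OF g(1)] *[OF g(2)] N(2-4) by blast
qed

section \<open>Colour rules in simplices without a top node\<close>

context
  fixes T :: "('k, 'l) node set"
  assumes T: "finite T" "card T = n" "card (N T) = 3" and val: "\<And>v. v \<in> T \<Longrightarrow> valid v"
    and notop: "\<And>t. t \<in> T \<Longrightarrow> \<not> T - {t} \<subseteq> D t"
begin

lemma grn_asg: "grn S \<Longrightarrow> \<exists>w. asg S w"
  by (auto simp: grn_def)

lemma unassigned:
  assumes "N T = {a, b, c}" "a \<noteq> b" "a \<noteq> c" "b \<noteq> c" "\<exists>w. asg (T - {a}) w" "\<exists>w. asg (T - {b}) w"
  shows "\<nexists>w. asg (T - {c}) w"
proof
  have "a \<in> T" "b \<in> T" "c \<in> T" using assms(1) N_subset[of _ T] by auto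
  moreover assume "\<exists>w. asg (T - {c}) w"
  ultimately have "\<exists>t\<in>T. T - {t} \<subseteq> D t" using top3[OF T(1,2), of a b c] assms(2-6) by blast
  then show False using notop by blast
qed

text \<open>An apex that is nobody's child would be a top, so \<open>c\<close> is counted among the
  apexes of the base. Two green facets are assigned already, so the base is not, and its default
  label lists the tint of \<open>c\<close>.\<close>

lemma simplex_base:
  assumes N: "N T = {a, b, c}" "a \<noteq> b" "a \<noteq> c" "b \<noteq> c" and k: "srt a = x0 F" "srt b = x1 F" "isZ F (srt c)"
    and l: "L (T - {a}) = gr F" "L (T - {b}) = gr F"
  shows "mem F (srt c) (L (T - {c}))"
proof -
  have inT: "a \<in> T" "b \<in> T" "c \<in> T" using N N_subset[of _ T] by auto
  have Nd: "N (T - {a}) = {b, c}" "N (T - {b}) = {a, c}" "N (T - {c}) = {a, b}"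
    unfolding N_Diff N(1) using N(2-4) by auto
  have g: "grn (T - {a})" "grn (T - {b})"
    using grn_L[OF l(1), of b c] grn_L[OF l(2), of a c] Nd k by auto
  have cC: "c \<in> C (T - {c})" using top_of_green[OF N g] notop inT by blast
  have na: "\<nexists>w. asg (T - {c}) w" using unassigned[OF N] g grn_asg by blast
  have rel: "rel (T - {c})" using rel_facet[OF T] N by blast
  have ins: "insert c (T - {c} - {a}) = T - {a}" "insert c (T - {c} - {b}) = T - {b}" using inT N(2-4) by auto
  have cA: "c \<in> apexes (T - {c})"
    using cC k(3) g unfolding apexes_def Nd by (simp add: ins)
  have sub: "srt ` apexes (T - {c}) \<subseteq> {k \<in> KK. isZ F k}"
  proof
    fix k assume "k \<in> srt ` apexes (T - {c})"
    then obtain z where z: "k = srt z" "z \<in> C (T - {c})" "isZ F (srt z)" by (auto simp: apexes_def)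
    then obtain w where "w \<in> T" "z \<in> D w" by (auto simp: C_def)
    then have "valid z" using val valid_D by blast
    then show "k \<in> {k \<in> KK. isZ F k}" using z valid_KK by simp
  qed
  have "finite (C (T - {c}))" using T(1) by (simp add: C_def)
  moreover have "apexes (T - {c}) \<subseteq> C (T - {c})" by (auto simp: apexes_def)
  ultimately have fin: "finite (srt ` apexes (T - {c}))" by (metis finite_subset finite_imageI)
  have "L (T - {c}) = yy (srt ` apexes (T - {c}))"
    using L_dflt[OF rel na] k by (simp add: dflt_def Nd)
  then show ?thesis using yy(2)[OF fin sub] cA by simp
qed

text \<open>As for bases, \<open>a\<close> must be a child of some point of the opposite facet, and
  that facet is unassigned. Thus \<open>a\<close> is a common point, and the default passes over the
  white that it forbids.\<close>

lemma simplex_white: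
  assumes N: "N T = {a, b, c}" "a \<noteq> b" "a \<noteq> c" "b \<noteq> c" and k: "isZ F (srt b)" "isZ F (srt c)"
    and l: "L (T - {b}) = gr F" "L (T - {c}) = gr F"
  shows "srt a = x0 F \<Longrightarrow> L (T - {a}) \<noteq> w0 F" "srt a = x1 F \<Longrightarrow> L (T - {a}) \<noteq> w1 F"
proof -
  have inT: "a \<in> T" "b \<in> T" "c \<in> T" using N N_subset[of _ T] by auto
  have N': "N T = {b, c, a}" using N by auto
  have Nd: "N (T - {b}) = {a, c}" "N (T - {c}) = {a, b}" "N (T - {a}) = {b, c}"
    unfolding N_Diff N(1) using N(2-4) by auto
  have *: "common (srt a) (T - {a})" "L (T - {a}) = dflt (T - {a})" if ka: "srt a = x0 F \<or> srt a = x1 F"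
  proof -
    have g: "grn (T - {b})" "grn (T - {c})"
      using grn_L[OF l(1), of a c] grn_L[OF l(2), of a b] Nd k ka by auto
    have aC: "a \<in> C (T - {a})" using top_of_green[OF N' _ _ _ g] N(2-4) notop inT by blast
    have "\<nexists>w. asg (T - {a}) w" using unassigned[OF N'] N(2-4) g grn_asg by blast
    then show "L (T - {a}) = dflt (T - {a})" using L_dflt rel_facet[OF T] N by blast
    have ins: "insert a (T - {a} - {b}) = T - {b}" "insert a (T - {a} - {c}) = T - {c}" using inT N(2-4) by auto
    show "common (srt a) (T - {a})" unfolding common_def Nd
      by (rule bexI[of _ a]) (use aC g in \<open>simp_all add: ins\<close>)
  qed
  have nX: "srt ` N (T - {a}) \<noteq> {x0 F, x1 F}" unfolding Nd using k not_isZ by (metis imageI insertI1 insert_iff singletonD)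
  have r: "red F (phi (low (T - {a})))" using red_phi_low[OF Nd(3) k] val inT by blast
  have Z: "\<forall>u\<in>N (T - {a}). isZ F (srt u)" unfolding Nd using k by simp
  show "srt a = x0 F \<Longrightarrow> L (T - {a}) \<noteq> w0 F"
    using * nX Z r labels by (auto simp: dflt_def)
  show "srt a = x1 F \<Longrightarrow> L (T - {a}) \<noteq> w1 F"
    using * nX Z r labels by (auto simp: dflt_def)
qed

text \<open>The facet omitting \<open>w\<close> is in the situation described by
  \<open>red_base\<close>. Since \<open>u\<close> completes a cone over \<open>D u\<close>,
  admissibility provides an older node \<open>g\<close> that labels the base. If a neighbouring
  facet were assigned, there would be a cycle of children through such nodes, a top, or two
  incompatible descriptions of \<open>D g\<close>.\<close>

lemma red_unassigned_step:
  assumes N: "N T = {u, v, w}" "u \<noteq> v" "u \<noteq> w" "v \<noteq> w"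
    and Z: "\<And>x. x \<in> N T \<Longrightarrow> isZ F (srt x)" and red: "\<And>x. x \<in> N T \<Longrightarrow> red F (L (T - {x}))"
    and G: "D u = G" "T - {u, v, w} \<subseteq> G" "base G v" "v \<notin> G" "base G u" "\<And>x. x \<in> G \<Longrightarrow> \<not> isZ F (srt x)"
  shows "(\<nexists>y. asg (T - {v}) y) \<and> (\<nexists>y. asg (T - {u}) y)"
proof -
  have inT: "u \<in> T" "v \<in> T" "w \<in> T" using N N_subset[of _ T] by auto
  have Zs: "isZ F (srt u)" "isZ F (srt v)" "isZ F (srt w)" using Z N(1) by auto
  have vl: "valid u" "valid v" "valid w" using val inT by auto
  have Nd: "N (T - {v}) = {u, w}" "N (T - {u}) = {v, w}"
    unfolding N_Diff N(1) using N(2-4) by auto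
  have rel: "rel (T - {v})" "rel (T - {u})" using rel_facet[OF T] N by auto
  have relG: "rel G" using G(3) by (simp add: base_def)
  have "card (D u) = n - 1" using relG G(1) by (simp add: rel_def)
  \<comment> \<open>This is what the last clause of \<open>admissible\<close> is for.\<close>
  then obtain g where g: "asg G g" using valid_admissible[OF vl(1)] G(1,5) unfolding admissible_def by blast
  have gG: "g \<in> G" using g by (simp add: asg_def)
  then have gu: "g \<in> D u" using G(1) by simp
  have vg: "valid g" using valid_D[OF vl(1) gu] .
  have notG: "u \<notin> G" "w \<notin> G" using G(6) Zs by auto
  have av: "D v = G \<or> D g = insert v (G - {g})" using apex_of_base[OF G(3) g vg vl(2) G(4)] .
  have sz: "size e < size u" if "e \<in> G" for e using size_D[of e u] that G(1) by simp
  have cases: "y = u \<or> y = w \<or> y \<in> G" if "asg (T - {v}) y" for y using that G(2) by (auto simp: asg_def)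
  have cases': "y = v \<or> y = w \<or> y \<in> T - {u, v, w}" if "asg (T - {u}) y" for y using that by (auto simp: asg_def)
  have vw: "y = v \<Longrightarrow> w \<in> D v" "y = w \<Longrightarrow> v \<in> D w" "y \<in> T - {u, v, w} \<Longrightarrow> v \<in> D y \<and> w \<in> D y"
    if "asg (T - {u}) y" for y
    using that inT N(2-4) by (auto simp: asg_def)
  have no_v: "\<nexists>y. asg (T - {v}) y"
  proof
    assume "\<exists>y. asg (T - {v}) y"
    then obtain y where y: "asg (T - {v}) y" by blast
    have "y = w"
    proof (rule ccontr)
      assume ny: "y \<noteq> w"
      then consider "y = u" | "y \<in> G" using cases y by blast
      then show False
      proof cases
        case 1
        then have "w \<in> D u" using y inT N(2-4) by (auto simp: asg_def)
        then show False using notG G(1) by simp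
      next
        case 2
        then have "u \<in> D y" using y inT N(2-4) notG by (auto simp: asg_def)
        then show False using size_D[of u y] sz[OF 2] by simp
      qed
    qed
    then have wE: "T - {v} - {w} \<subseteq> D w" using y by (simp add: asg_def)
    then have uw: "u \<in> D w" using inT N(2-4) by blast
    show False
    proof (cases "\<exists>y. asg (T - {u}) y")
      case True
      then obtain y' where y': "asg (T - {u}) y'" by blast
      consider "y' = v" | "y' = w" | "y' \<in> T - {u, v, w}" using cases'[OF y'] by blast
      then show False
      proof cases
        case 1
        then have wv: "w \<in> D v" using vw[OF y'] by blast
        then have "D v \<noteq> G" using notG by auto
        then have "v \<in> D g" using av by auto
        then show False using size_D[OF wv] size_D[OF uw] size_D[of v g] size_D[OF gu] by simp
      next
        case 2
        then have "T - {u} - {w} \<subseteq> D w" using y' by (simp add: asg_def)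
        then have "T - {w} \<subseteq> D w" using wE N(2) by blast
        then show False using notop inT by blast
      next
        case 3
        then have "w \<in> D y'" "y' \<in> G" using vw[OF y'] G(2) by blast+
        then show False using size_D[of w y'] sz[of y'] size_D[OF uw] by simp
      qed
    next
      case False
      \<comment> \<open>Now the facet omitting \<open>u\<close> is red by default as well, so it has
        a base \<open>G'\<close> of its own. As \<open>u\<close> is a child of \<open>w\<close>, the
        node spanning \<open>G'\<close> can only be \<open>v\<close>.\<close>
      have red': "red F (L (T - {u}))" using red N(1) by simp
      obtain x G' where x: "x \<in> N (T - {u})" "D x = G'" "\<And>v. v \<in> N (T - {u}) \<Longrightarrow> base G' v \<and> v \<notin> G'"
        "\<And>v. v \<in> G' \<Longrightarrow> \<not> isZ F (srt v)"
        by (rule red_base[OF rel(2) False red']) (use Z val Nd N(1) in auto)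
      have "x \<noteq> w" using x(2,4) uw Zs by auto
      then have xv: "x = v" using x(1) Nd by simp
      have bw: "base G' w" "w \<notin> G'" "base G' v" using x(3) Nd by auto
      have "card (D v) = n - 1" using bw(1) x(2) xv by (simp add: base_def rel_def)
      then obtain g' where g': "asg G' g'" using valid_admissible[OF vl(2)] x(2) xv bw(3) unfolding admissible_def by blast
      have g'v: "g' \<in> D v" using g' x(2) xv by (simp add: asg_def)
      have "D w = G' \<or> D g' = insert w (G' - {g'})"
        using apex_of_base[OF bw(1) g' _ vl(3) bw(2)] valid_D[OF vl(2) g'v] by blast
      moreover have "D w \<noteq> G'" using uw x(4) Zs by auto
      ultimately have wg': "w \<in> D g'" by auto
      show False using av
      proof
        assume "D v = G"
        then have "size g' < size u" using g'v sz by simp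
        then show False using size_D[OF wg'] size_D[OF uw] by simp
      next
        assume "D g = insert v (G - {g})"
        then show False using size_D[of v g] size_D[OF gu] size_D[OF uw] size_D[OF wg'] size_D[OF g'v] by simp
      qed
    qed
  qed
  have red': "red F (L (T - {v}))" using red N(1) by simp
  obtain x G' where x: "x \<in> N (T - {v})" "D x = G'" "T - {v} - N (T - {v}) \<subseteq> G'" "\<And>z. z \<in> N (T - {v}) \<Longrightarrow> base G' z \<and> z \<notin> G'"
      "\<And>z. z \<in> G' \<Longrightarrow> \<not> isZ F (srt z)"
    by (rule red_base[OF rel(1) no_v red']) (use Z val Nd N(1) in auto)
  have EG': "T - {u, v, w} \<subseteq> G'" using x(3) Nd by auto
  have b: "base G' u" "base G' w" "u \<notin> G'" "w \<notin> G'" using x(4) Nd by auto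
  have relG': "rel G'" using b(1) by (simp add: base_def)
  have "valid x" using x(1) Nd vl by auto
  moreover have "base (D x) x" using x(1,2,4) by blast
  moreover have "card (D x) = n - 1" using relG' x(2) by (simp add: rel_def)
  ultimately obtain g' where g': "asg G' g'" using valid_admissible x(2) unfolding admissible_def by blast
  have g'G': "g' \<in> G'" using g' by (simp add: asg_def)
  have vg': "valid g'" using valid_D[OF \<open>valid x\<close>] x(2) g'G' by blast
  \<comment> \<open>If \<open>u\<close> spans \<open>G'\<close>, then \<open>G'\<close> is
    \<open>G\<close> and \<open>w\<close> is a further apex of it. Otherwise \<open>w\<close> spans
    \<open>G'\<close>, and \<open>u\<close> is attached to \<open>G'\<close> through its labelling
    node.\<close>
  have disj: "(D w = G \<or> D g = insert w (G - {g})) \<or> D w = G' \<and> u \<in> D g'"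
  proof (cases "x = u")
    case True
    then have "G' = G" using x(2) G(1) by simp
    then show ?thesis using apex_of_base[of G w g] b g vg vl by blast
  next
    case False
    then have xw: "D w = G'" using x(1,2) Nd by auto
    have "D u = G' \<or> D g' = insert u (G' - {g'})" using apex_of_base[OF b(1) g' vg' vl(1) b(3)] .
    then show ?thesis using xw G(1) by auto
  qed
  have no_u: False if y: "asg (T - {u}) y" for y
  proof -
    consider "y = v" "w \<in> D v" | "y = w" "v \<in> D w" | "y \<in> G" "y \<in> G'" "v \<in> D y" "w \<in> D y"
      using cases'[OF y] vw[OF y] G(2) EG' by blast
    then show False
    proof cases
      case 1
      then have "D v \<noteq> G" using notG by auto
      then have Dg: "D g = insert v (G - {g})" using av by blast
      then have vg: "v \<in> D g" by simp
      show False using disj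
      proof (elim disjE conjE)
        assume "D w = G"
        then show False using size_D[of g w] gG size_D[OF vg] size_D[OF 1(2)] by simp
      next
        assume "D g = insert w (G - {g})"
        then have "insert w (G - {g}) = insert v (G - {g})" using Dg by simp
        then show False using notG G(4) N(4) by (metis Diff_iff insert_iff)
      next
        assume "D w = G'" "u \<in> D g'"
        then show False
          using size_D[of g' w] g'G' size_D[OF vg] size_D[OF 1(2)] size_D[OF gu] size_D[of u g'] by simp
      qed
    next
      case 2
      then have "D w \<noteq> G'" using x(5) Zs by auto
      moreover have "D w \<noteq> G" using 2 G(4) by auto
      ultimately have Dg: "D g = insert w (G - {g})" using disj by blast
      show False using av
      proof
        assume "D v = G"
        then show False using size_D[of g v] gG size_D[of w g] Dg size_D[OF 2(2)] by simp
      next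
        assume "D g = insert v (G - {g})"
        then have "insert w (G - {g}) = insert v (G - {g})" using Dg by simp
        then show False using notG G(4) N(4) by (metis Diff_iff insert_iff)
      qed
    next
      case 3
      have "D v \<noteq> G" using 3 size_D[of v y] size_D[of y v] by auto
      then have Dg: "D g = insert v (G - {g})" using av by blast
      have "D w \<noteq> G" "D w \<noteq> G'" using 3 size_D[of w y] size_D[of y w] by auto
      then have "insert w (G - {g}) = insert v (G - {g})" using Dg disj by simp
      then show False using notG G(4) N(4) by (metis Diff_iff insert_iff)
    qed
  qed
  show ?thesis using no_u no_v by blast
qed

lemma all_unassigned:
  assumes N: "N T = {a, b, c}" "a \<noteq> b" "a \<noteq> c" "b \<noteq> c"
    and Z: "\<And>x. x \<in> N T \<Longrightarrow> isZ F (srt x)" and red: "\<And>x. x \<in> N T \<Longrightarrow> red F (L (T - {x}))"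
    and c: "\<nexists>y. asg (T - {c}) y"
  shows "(\<nexists>y. asg (T - {a}) y) \<and> (\<nexists>y. asg (T - {b}) y)"
proof -
  have cN: "c \<in> N T" using N by simp
  have Nd: "N (T - {c}) = {a, b}" unfolding N_Diff N(1) using N(2-4) by auto
  obtain x G where x: "x \<in> N (T - {c})" "D x = G" "T - {c} - N (T - {c}) \<subseteq> G" "\<And>v. v \<in> N (T - {c}) \<Longrightarrow> base G v \<and> v \<notin> G"
      "\<And>v. v \<in> G \<Longrightarrow> \<not> isZ F (srt v)"
    by (rule red_base[OF rel_facet[OF T cN] c red[OF cN]]) (use Z val Nd N(1) in auto)
  have E: "T - {a, b, c} \<subseteq> G" "T - {b, a, c} \<subseteq> G" using x(3) Nd by auto
  have b: "base G a" "a \<notin> G" "base G b" "b \<notin> G" using x(4) Nd by auto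
  have "x = a \<or> x = b" using x(1) Nd by blast
  then show ?thesis
  proof
    assume "x = a"
    then show ?thesis using red_unassigned_step[OF N Z red _ E(1) b(3,4,1) x(5)] x(2) by blast
  next
    assume "x = b"
    have N': "N T = {b, a, c}" using N by auto
    show ?thesis using red_unassigned_step[OF N' N(2)[symmetric] N(4,3) Z red _ E(2) b(1,2,3) x(5)] x(2) \<open>x = b\<close> by blast
  qed
qed

text \<open>Three assigned facets would give a top, so one is a default, and by
  \<open>all_unassigned\<close> all are. Their ranks are then \<open>phi\<close> of the lower tints,
  and \<open>phi\<close> drops along \<open>lt\<close>.\<close>

lemma simplex_red:
  assumes N: "N T = {a, b, c}" "a \<noteq> b" "a \<noteq> c" "b \<noteq> c" and k: "lt F (srt a) (srt b)" "lt F (srt b) (srt c)"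
    and r: "red F (L (T - {a}))" "red F (L (T - {b}))" "red F (L (T - {c}))"
  shows "sm F (L (T - {a})) (L (T - {c}))"
proof -
  have inT: "a \<in> T" "b \<in> T" "c \<in> T" using N N_subset[of _ T] by auto
  have Zs: "isZ F (srt a)" "isZ F (srt b)" "isZ F (srt c)" using lt(1)[OF k(1)] lt(1)[OF k(2)] by auto
  have Z: "isZ F (srt x)" if "x \<in> N T" for x using that Zs N(1) by auto
  have red: "red F (L (T - {x}))" if "x \<in> N T" for x using that r N(1) by auto
  have N': "N T = {b, c, a}" "N T = {a, c, b}" using N by auto
  have "(\<nexists>y. asg (T - {a}) y) \<and> (\<nexists>y. asg (T - {c}) y)"
  proof (cases "\<exists>y. asg (T - {c}) y")
    case False
    then show ?thesis using all_unassigned[OF N Z red] by blast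
  next
    case c: True
    show ?thesis
    proof (cases "\<exists>y. asg (T - {a}) y")
      case False
      then show ?thesis using all_unassigned[OF N'(1) N(4) N(2,3)[symmetric] Z red] c by blast
    next
      case a: True
      have "\<nexists>y. asg (T - {b}) y" using unassigned[OF N'(2) N(3,2) N(4)[symmetric] a c] .
      then show ?thesis using all_unassigned[OF N'(2) N(3,2) N(4)[symmetric] Z red] by blast
    qed
  qed
  then have un: "\<nexists>y. asg (T - {a}) y" "\<nexists>y. asg (T - {c}) y" by blast+
  have Nd: "N (T - {a}) = {b, c}" "N (T - {c}) = {a, b}" unfolding N_Diff N(1) using N(2-4) by auto
  have rel: "rel (T - {a})" "rel (T - {c})" using rel_facet[OF T] N by auto
  have phi_low: "L S = phi (low S)" if S: "rel S" "\<nexists>y. asg S y" "red F (L S)" "\<forall>u\<in>N S. isZ F (srt u)" for S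
  proof -
    obtain u where "u \<in> N S" using S(1) by (force simp: rel_def card_2_iff)
    then have "srt u \<in> srt ` N S" "isZ F (srt u)" using S(4) by auto
    then have "srt ` N S \<noteq> {x0 F, x1 F}" using not_isZ by (metis insert_iff singletonD)
    then show ?thesis using L_dflt[OF S(1,2)] S(3,4) labels by (auto simp: dflt_def split: if_splits)
  qed
  have "L (T - {a}) = phi (srt b)"
    using phi_low[OF rel(1) un(1) r(1)] low_spec(2)[OF Nd(1) Zs(2,3) k(2)] Nd(1) Zs by simp
  moreover have "L (T - {c}) = phi (srt a)"
    using phi_low[OF rel(2) un(2) r(3)] low_spec(2)[OF Nd(2) Zs(1,2) k(1)] Nd(2) Zs by simp
  moreover have "srt a \<in> KK" "srt b \<in> KK" using val inT valid_KK by auto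
  ultimately show ?thesis using lt(2)[OF k(1)] by simp
qed

end

theorem valid_okT:
  assumes T: "finite T" "card T = n" "card (N T) = 3" and val: "\<And>v. v \<in> T \<Longrightarrow> valid v"
  shows "okT T"
proof (cases "\<exists>t\<in>T. T - {t} \<subseteq> D t")
  case True
  then show ?thesis using top_okT[OF T] val by blast
next
  case False
  then have nt: "\<And>t. t \<in> T \<Longrightarrow> \<not> T - {t} \<subseteq> D t" by blast
  have NT: "N T = {a, b, c}"
    if "a \<in> T" "b \<in> T" "c \<in> T" "a \<noteq> b" "a \<noteq> c" "b \<noteq> c" "srt a \<noteq> pp F" "srt b \<noteq> pp F" "srt c \<noteq> pp F" for a b c
    using that by (intro N_eq3[OF T(3)]) (auto simp: N_def)
  show ?thesis unfolding okT_def simplex_def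
  proof (intro ballI impI conjI; elim conjE)
    fix a b c assume abc: "a \<in> T" "b \<in> T" "c \<in> T" "a \<noteq> b" "a \<noteq> c" "b \<noteq> c"
    { assume k: "srt a = x0 F" "isZ F (srt b)" "isZ F (srt c)" and l: "L (T - {b}) = gr F" "L (T - {c}) = gr F"
      have "N T = {a, b, c}" using k sorts by (intro NT abc) (auto simp: isZ_def)
      then show "L (T - {a}) \<noteq> w0 F" using simplex_white(1)[OF T val nt _ abc(4-6) k(2,3) l k(1)] by simp }
    { assume k: "srt a = x1 F" "isZ F (srt b)" "isZ F (srt c)" and l: "L (T - {b}) = gr F" "L (T - {c}) = gr F"
      have "N T = {a, b, c}" using k sorts by (intro NT abc) (auto simp: isZ_def)
      then show "L (T - {a}) \<noteq> w1 F" using simplex_white(2)[OF T val nt _ abc(4-6) k(2,3) l k(1)] by simp }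
    { assume k: "lt F (srt a) (srt b)" "lt F (srt b) (srt c)"
        and l: "red F (L (T - {a}))" "red F (L (T - {b}))" "red F (L (T - {c}))"
      have "N T = {a, b, c}" using lt(1)[OF k(1)] lt(1)[OF k(2)] by (intro NT abc) (auto simp: isZ_def)
      then show "sm F (L (T - {a})) (L (T - {c}))" using simplex_red[OF T val nt _ abc(4-6) k l] by simp }
    { assume k: "srt a = x0 F" "srt b = x1 F" "isZ F (srt c)" and l: "L (T - {a}) = gr F" "L (T - {b}) = gr F"
      have "N T = {a, b, c}" using k sorts by (intro NT abc) (auto simp: isZ_def)
      then show "mem F (srt c) (L (T - {c}))" using simplex_base[OF T val nt _ abc(4-6) k l] by simp }
  qed
qed

end

section \<open>Types of tuples of nodes\<close>

context free_model
begin

lemma L_cases: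
  assumes "\<And>v. v \<in> S \<Longrightarrow> valid v"
  shows "L S \<in> LL" "rel S \<Longrightarrow> (\<And>v. v \<in> N S \<Longrightarrow> isZ F (srt v)) \<Longrightarrow> L S = w0 F \<or> L S = w1 F \<or> red F (L S)"
proof -
  have *: "L S \<in> LL \<and> ((\<forall>v\<in>N S. isZ F (srt v)) \<longrightarrow> L S = w0 F \<or> L S = w1 F \<or> red F (L S))" if rel: "rel S"
  proof (cases "\<exists>w. asg S w")
    case True
    then obtain w where w: "asg S w" by blast
    then have "valid w" using assms by (auto simp: asg_def)
    then show ?thesis using L_asg[OF rel w] valid_admissible[of w] rel w unfolding admissible_def by metis
  next
    case False
    then have d: "L S = dflt S" using L_dflt rel by blast
    obtain u v where uv: "N S = {u, v}" using rel by (auto simp: rel_def card_2_iff)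
    have vuv: "valid u" "valid v" using uv N_subset[of u S] N_subset[of v S] assms by auto
    show ?thesis
    proof (cases "srt ` N S = {x0 F, x1 F}")
      case True
      have sub: "srt ` apexes S \<subseteq> {k \<in> KK. isZ F k}"
      proof
        fix k assume "k \<in> srt ` apexes S"
        then obtain z where z: "k = srt z" "z \<in> C S" "isZ F (srt z)" by (auto simp: apexes_def)
        then obtain w where "w \<in> S" "z \<in> D w" by (auto simp: C_def)
        then have "valid z" using assms valid_D by blast
        then show "k \<in> {k \<in> KK. isZ F k}" using z valid_KK by simp
      qed
      have "finite (C S)" using rel by (simp add: C_def rel_def)
      moreover have "apexes S \<subseteq> C S" by (auto simp: apexes_def)
      ultimately have fin: "finite (srt ` apexes S)" by (metis finite_subset finite_imageI)
      have "x0 F \<in> srt ` N S" using True by simp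
      then obtain x where "x \<in> N S" "\<not> isZ F (srt x)" using not_isZ by (metis imageE)
      then show ?thesis using d True yy(1)[OF fin sub] by (auto simp: dflt_def)
    next
      case nX: False
      show ?thesis
      proof (cases "\<forall>u\<in>N S. isZ F (srt u)")
        case True
        then have "red F (phi (low S))" "phi (low S) \<in> LL" using red_phi_low[OF uv _ _ vuv] uv by auto
        then show ?thesis using d nX True labels by (simp add: dflt_def)
      next
        case False
        then show ?thesis using d nX labels by (auto simp: dflt_def)
      qed
    qed
  qed
  show "L S \<in> LL" using * labels by (cases "rel S") (auto simp: L_def)
  show "rel S \<Longrightarrow> (\<And>v. v \<in> N S \<Longrightarrow> isZ F (srt v)) \<Longrightarrow> L S = w0 F \<or> L S = w1 F \<or> red F (L S)" using * by blast
qed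

definition htype :: "(nat \<Rightarrow> ('k, 'l) node) \<Rightarrow> ('k, 'l) atom" where
  "htype s = Atom (\<lambda>j. if j < n then srt (s j) else pp F) (\<lambda>i j. i < n \<and> j < n \<and> s i = s j)
     (\<lambda>m. if m < n then L (s ` ({..<n} - {m})) else w0 F)"

definition matches :: "nat set \<Rightarrow> (nat \<Rightarrow> ('k, 'l) node) \<Rightarrow> ('k, 'l) atom \<Rightarrow> bool" where
  "matches J s b \<longleftrightarrow> (\<forall>j\<in>J. srt (s j) = kd b j) \<and> (\<forall>j\<in>J. \<forall>j'\<in>J. s j = s j' \<longleftrightarrow> eqv b j j') \<and>
     (\<forall>m<n. {..<n} - {m} \<subseteq> J \<longrightarrow> L (s ` ({..<n} - {m})) = lab b m)"

lemma card_N_image: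
  assumes "inj_on s X"
  shows "card (N (s ` X)) = card {j \<in> X. srt (s j) \<noteq> pp F}"
proof -
  have "N (s ` X) = s ` {j \<in> X. srt (s j) \<noteq> pp F}" by (auto simp: N_def)
  moreover have "inj_on s {j \<in> X. srt (s j) \<noteq> pp F}" using assms by (rule inj_on_subset) blast
  ultimately show ?thesis by (simp add: card_image)
qed

lemma rel_facet_iff:
  assumes "m < n" "\<And>j. j < n \<Longrightarrow> j \<noteq> m \<Longrightarrow> srt (s j) = kd b j"
    and "\<And>j j'. j < n \<Longrightarrow> j' < n \<Longrightarrow> j \<noteq> m \<Longrightarrow> j' \<noteq> m \<Longrightarrow> s j = s j' \<longleftrightarrow> eqv b j j'"
  shows "rel (s ` ({..<n} - {m})) \<longleftrightarrow> facet F n b m"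
proof -
  have cX: "card ({..<n} - {m}) = n - 1" using assms(1) by simp
  have ap: "apart n b m \<longleftrightarrow> inj_on s ({..<n} - {m})"
    unfolding apart_def inj_on_def using assms(3) by (metis Diff_iff lessThan_iff singletonD singletonI)
  show ?thesis
  proof (cases "inj_on s ({..<n} - {m})")
    case True
    have "{j \<in> {..<n} - {m}. srt (s j) \<noteq> pp F} = {j. j < n \<and> j \<noteq> m \<and> kd b j \<noteq> pp F}"
      using assms(2) by auto
    then show ?thesis using card_N_image[OF True] card_image[OF True] cX ap True by (simp add: rel_def facet_def)
  next
    case False
    then have "card (s ` ({..<n} - {m})) \<noteq> n - 1" using cX by (metis eq_card_imp_inj_on finite_Diff finite_lessThan)
    then show ?thesis using ap False by (simp add: rel_def facet_def)
  qed
qed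

lemma okT_simplex:
  assumes "\<And>j. j < n \<Longrightarrow> srt (s j) = kd b j" "inj_on s {..<n}" "\<And>j. j < n \<Longrightarrow> L (s ` ({..<n} - {j})) = lab b j"
  shows "okT (s ` {..<n}) \<longleftrightarrow> (\<forall>i\<in>{..<n}. \<forall>j\<in>{..<n}. \<forall>m\<in>{..<n}. i \<noteq> j \<longrightarrow> i \<noteq> m \<longrightarrow> j \<noteq> m \<longrightarrow>
    simplex F (kd b i) (kd b j) (kd b m) (lab b i) (lab b j) (lab b m))"
proof -
  have d: "s ` {..<n} - {s j} = s ` ({..<n} - {j})" if "j < n" for j
    using assms(2) that by (auto simp: inj_on_def)
  have e: "s i = s j \<longleftrightarrow> i = j" if "i < n" "j < n" for i j using assms(2) that by (auto simp: inj_on_def)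
  show ?thesis
    unfolding okT_def ball_simps by (intro ball_cong refl) (simp add: d e assms(1,3))
qed

lemma htype_ok:
  assumes "\<And>j. j < n \<Longrightarrow> valid (s j)"
  shows "ok F n (htype s)"
proof -
  let ?b = "htype s"
  have k: "j < n \<Longrightarrow> srt (s j) = kd ?b j" for j by (simp add: htype_def)
  have l: "j < n \<Longrightarrow> L (s ` ({..<n} - {j})) = lab ?b j" for j by (simp add: htype_def)
  have e: "i < n \<Longrightarrow> j < n \<Longrightarrow> eqv ?b i j \<longleftrightarrow> s i = s j" for i j by (simp add: htype_def)
  have rf: "rel (s ` ({..<n} - {m})) \<longleftrightarrow> facet F n ?b m" if "m < n" for m
    using that k e by (intro rel_facet_iff) auto
  have val: "valid v" if "v \<in> s ` ({..<n} - {m})" for v m using that assms by auto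
  show ?thesis unfolding ok_def
  proof (intro conjI allI impI)
    fix i j assume ij: "i < n" "j < n"
    { assume "eqv ?b i j"
      then have eq: "s i = s j" using e ij by simp
      then show "kd ?b i = kd ?b j" using arg_cong[OF eq, of srt] k[OF ij(1)] k[OF ij(2)] by simp
      assume "i \<noteq> j"
      have *: "s ` ({..<n} - {i}) \<subseteq> s ` ({..<n} - {j})" if "s i = s j" "i < n" "i \<noteq> j" for i j
      proof
        fix x assume "x \<in> s ` ({..<n} - {i})"
        then obtain m where m: "m < n" "x = s m" by auto
        show "x \<in> s ` ({..<n} - {j})"
          by (rule image_eqI[of _ _ "if m = j then i else m"]) (use m that in auto)
      qed
      have "s ` ({..<n} - {i}) = s ` ({..<n} - {j})"
        by (rule subset_antisym[OF *[OF eq ij(1) \<open>i \<noteq> j\<close>] *[OF eq[symmetric] ij(2) \<open>i \<noteq> j\<close>[symmetric]]])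
      then show "lab ?b i = lab ?b j" using l[OF ij(1)] l[OF ij(2)] by simp }
    fix m assume "m < n"
    assume f: "facet F n ?b i" "i \<noteq> j" "i \<noteq> m" "j \<noteq> m" "isZ F (kd ?b j)" "isZ F (kd ?b m)"
    let ?S = "s ` ({..<n} - {i})"
    have rel: "rel ?S" using rf f(1) ij by blast
    then have c2: "card (N ?S) = 2" by (simp add: rel_def)
    have "apart n ?b i" using f(1) by (simp add: facet_def)
    then have "s j \<noteq> s m" using apartD[of n ?b i j m] e ij \<open>m < n\<close> f by blast
    moreover have "s j \<in> N ?S" "s m \<in> N ?S" using f ij \<open>m < n\<close> k by (auto simp: N_def isZ_def)
    ultimately have "N ?S = {s j, s m}" using c2 by (auto simp: card_2_iff)
    then have "isZ F (srt v)" if "v \<in> N ?S" for v using that f(5,6) k[OF ij(2)] k[OF \<open>m < n\<close>] by auto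
    then show "lab ?b i = w0 F \<or> lab ?b i = w1 F \<or> red F (lab ?b i)"
      using L_cases(2)[OF val rel] l ij by simp
  next
    fix i assume "i < n" "\<not> facet F n ?b i"
    then show "lab ?b i = w0 F" using rf[of i] l[of i] unfolding L_def by simp
  next
    fix i j m assume inj: "\<forall>i<n. \<forall>j<n. eqv ?b i j \<longrightarrow> i = j" and c3: "card {j. j < n \<and> kd ?b j \<noteq> pp F} = 3"
      and ijm: "i < n" "j < n" "m < n" "i \<noteq> j" "i \<noteq> m" "j \<noteq> m"
    have inj': "inj_on s {..<n}" using inj e by (auto simp: inj_on_def)
    have "{j \<in> {..<n}. srt (s j) \<noteq> pp F} = {j. j < n \<and> kd ?b j \<noteq> pp F}" using k by auto
    then have "card (N (s ` {..<n})) = 3" using card_N_image[OF inj'] c3 by simp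
    then have "okT (s ` {..<n})" using card_image[OF inj'] assms by (intro valid_okT) auto
    then show "simplex F (kd ?b i) (kd ?b j) (kd ?b m) (lab ?b i) (lab ?b j) (lab ?b m)"
      using okT_simplex[of s ?b, OF k inj' l] ijm by blast
  qed (auto simp: htype_def)
qed

end

section \<open>Extending partial tuples and realising all types\<close>

context free_model
begin

text \<open>If \<open>b\<close> identifies the new place with an old one, the old point is reused.
  Otherwise a new node is built over all old points with the labels dictated by \<open>b\<close>. It
  can fail to be valid only by completing a cone over a base that no node labels, and then an
  existing apex already realises \<open>b\<close>.\<close>

lemma extension:
  assumes b: "ok F n b" "\<And>j. j < n \<Longrightarrow> kd b j \<in> KK" "\<And>j. j < n \<Longrightarrow> lab b j \<in> LL"
    and J: "J \<subseteq> {..<n}" "i < n" "i \<notin> J" and s: "\<And>j. j \<in> J \<Longrightarrow> valid (s j)" "matches J s b"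
  shows "\<exists>u. valid u \<and> matches (insert i J) (s(i := u)) b"
proof (cases "\<exists>j\<in>J. eqv b i j")
  case True
  then obtain j where j: "j \<in> J" "eqv b i j" by blast
  then have jn: "j < n" "j \<noteq> i" using J by auto
  let ?s = "s(i := s j)"
  have eji: "eqv b j i" using okD(2)[OF b(1) J(2) jn(1) j(2)] .
  have e: "eqv b i m \<longleftrightarrow> eqv b j m" if "m < n" for m
    using okD(3)[OF b(1) J(2) jn(1) that j(2)] okD(3)[OF b(1) jn(1) J(2) that eji] by blast
  have sy: "eqv b x y \<longleftrightarrow> eqv b y x" if "x < n" "y < n" for x y using okD(2)[OF b(1)] that by blast
  have es: "s x = s y \<longleftrightarrow> eqv b x y" if "x \<in> J" "y \<in> J" for x y using s(2) that by (simp add: matches_def)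
  have "L (?s ` ({..<n} - {m})) = lab b m" if m: "m < n" "{..<n} - {m} \<subseteq> insert i J" for m
  proof -
    consider "m = i" | "m = j" | "m \<noteq> i" "m \<noteq> j" by blast
    then show ?thesis
    proof cases
      case 1
      then have "?s ` ({..<n} - {m}) = s ` ({..<n} - {m})" by (intro image_cong) auto
      moreover have "{..<n} - {m} \<subseteq> J" using m 1 by blast
      ultimately show ?thesis using s(2) m by (simp add: matches_def)
    next
      case 2
      have "?s ` ({..<n} - {m}) = s ` ({..<n} - {i})"
      proof (intro equalityI subsetI)
        fix x assume "x \<in> ?s ` ({..<n} - {m})"
        then obtain y where y: "y < n" "y \<noteq> j" "x = ?s y" using 2 by (elim imageE) blast
        show "x \<in> s ` ({..<n} - {i})"
          by (rule image_eqI[of _ _ "if y = i then j else y"]) (use y jn in auto)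
      next
        fix x assume "x \<in> s ` ({..<n} - {i})"
        then obtain y where y: "y < n" "y \<noteq> i" "x = s y" by auto
        show "x \<in> ?s ` ({..<n} - {m})"
          by (rule image_eqI[of _ _ "if y = j then i else y"]) (use y jn J 2 in auto)
      qed
      moreover have "{..<n} - {i} \<subseteq> J" using m 2 j by blast
      ultimately have "L (?s ` ({..<n} - {m})) = lab b i" using s(2) J(2) by (simp add: matches_def)
      then show ?thesis using okD(5)[OF b(1) J(2) jn(1) jn(2)[symmetric] j(2)] 2 by simp
    next
      \<comment> \<open>Two places other than \<open>m\<close> carry the same point, so there is no
        facet on either side and both labels are the default.\<close>
      case 3
      have "\<not> inj_on ?s ({..<n} - {m})" using 3 J jn unfolding inj_on_def
        by (intro notI) (drule bspec[of _ _ i]; force)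
      then have "card (?s ` ({..<n} - {m})) \<noteq> card ({..<n} - {m})"
        by (metis eq_card_imp_inj_on finite_Diff finite_lessThan)
      then have "\<not> rel (?s ` ({..<n} - {m}))" using m(1) by (simp add: rel_def)
      moreover have "\<not> apart n b m" using apartD[of n b m i j] 3 J jn j by auto
      then have "lab b m = w0 F" using okD(6)[OF b(1) m(1) m(1)] by (simp add: facet_def)
      ultimately show ?thesis by (simp add: L_def)
    qed
  qed
  moreover have "kd b j = kd b i" using okD(4)[OF b(1) J(2) jn(1) j(2)] by simp
  then have "\<forall>x\<in>insert i J. srt (?s x) = kd b x" using s(2) j by (auto simp: matches_def)
  moreover have "?s x = ?s y \<longleftrightarrow> eqv b x y" if "x \<in> insert i J" "y \<in> insert i J" for x y
  proof -
    have n: "x < n" "y < n" using that J by auto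
    show ?thesis
      using that es[of x y] es[of j y] es[of x j] es[of j j] e[OF n(1)] e[OF n(2)] sy[OF n] sy[OF n(1) J(2)] sy[OF n(1) jn(1)]
        okD(1)[OF b(1) J(2) J(2)] j J
      by (cases "x = i"; cases "y = i") auto
  qed
  ultimately have "matches (insert i J) ?s b" unfolding matches_def by blast
  then show ?thesis using s(1) j by blast
next
  case noeq: False
  have fJ: "finite J" using J(1) finite_subset by blast
  have cJ: "card J \<le> n - 1"
    using card_mono[of "{..<n} - {i}" J] J by auto
  \<comment> \<open>\<open>cand E m\<close> holds when the facet omitting \<open>m\<close> consists
    of the new point and \<open>E\<close>. If \<open>s\<close> repeats points, several
    \<open>m\<close> may fit the same \<open>E\<close>; \<open>g_lab\<close> shows that the choice
    does not affect the label of a facet.\<close>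
  define cand where "cand E m \<longleftrightarrow> m < n \<and> m \<noteq> i \<and> {..<n} - {m} \<subseteq> insert i J \<and> s ` ({..<n} - {m} - {i}) = E" for E m
  define g where "g E = (if \<exists>m. cand E m then lab b (SOME m. cand E m) else w0 F)" for E
  have gLL: "g E \<in> LL" for E
  proof (cases "\<exists>m. cand E m")
    case True
    then have "cand E (SOME m. cand E m)" by (rule someI_ex)
    then have "(SOME m. cand E m) < n" unfolding cand_def[of E "SOME m. cand E m"] by blast
    then show ?thesis using True b(3) unfolding g_def by simp
  qed (use labels in \<open>simp add: g_def\<close>)
  obtain u where u: "srt u = kd b i" "D u = s ` J" "\<And>E. E \<subseteq> s ` J \<Longrightarrow> Suc (card E) \<ge> card (s ` J) \<Longrightarrow> nl u E = g E"
    "insert (top u) (snd ` set (chl u)) \<subseteq> range g"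
    by (rule node_exists[of "s ` J" "kd b i" g]) (use fJ in auto)
  have cD: "card (s ` J) \<le> n - 1" using card_image_le[OF fJ, of s] cJ by simp
  have M: "srt ((s(i := v)) x) = kd b x" "(s(i := v)) x = (s(i := v)) y \<longleftrightarrow> eqv b x y"
    if v: "srt v = kd b i" "v \<notin> s ` J" and x: "x \<in> insert i J" and y: "y \<in> insert i J" for v x y
  proof -
    show "srt ((s(i := v)) x) = kd b x" using v(1) x s(2) by (auto simp: matches_def)
    have n: "x < n" "y < n" using x y J by auto
    have "s x = s y \<longleftrightarrow> eqv b x y" if "x \<in> J" "y \<in> J" using s(2) that by (simp add: matches_def)
    moreover have "\<not> eqv b i y" if "y \<in> J" using noeq that by blast
    moreover have "\<not> eqv b x i" if "x \<in> J" using noeq that okD(2)[OF b(1) n(1) J(2)] by blast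
    moreover have "s x \<noteq> v" if "x \<in> J" using v(2) that by blast
    moreover have "s y \<noteq> v" if "y \<in> J" using v(2) that by blast
    ultimately show "(s(i := v)) x = (s(i := v)) y \<longleftrightarrow> eqv b x y"
      using x y J(3) okD(1)[OF b(1) J(2) J(2)] by (cases "x = i"; cases "y = i") auto
  qed
  have img: "(s(i := v)) ` ({..<n} - {m}) = insert v (s ` ({..<n} - {m} - {i}))" if "m \<noteq> i" for v m
  proof -
    have "{..<n} - {m} = insert i ({..<n} - {m} - {i})" using that J(2) by auto
    then have "(s(i := v)) ` ({..<n} - {m}) = insert v ((s(i := v)) ` ({..<n} - {m} - {i}))" by (metis fun_upd_same image_insert)
    also have "(s(i := v)) ` ({..<n} - {m} - {i}) = s ` ({..<n} - {m} - {i})" by (intro image_cong) auto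
    finally show ?thesis .
  qed
  have rf: "rel ((s(i := v)) ` ({..<n} - {m})) \<longleftrightarrow> facet F n b m"
    if "srt v = kd b i" "v \<notin> s ` J" "m < n" "{..<n} - {m} \<subseteq> insert i J" for v m
    using that(3,4) by (intro rel_facet_iff M[OF that(1,2)]) auto
  have ui: "u \<notin> s ` J" using D_irrefl[of u] u(2) by simp
  have g_lab: "g (s ` ({..<n} - {m} - {i})) = lab b m"
    if m: "m < n" "m \<noteq> i" "{..<n} - {m} \<subseteq> insert i J" and f: "facet F n b m" for m
  proof -
    let ?E = "s ` ({..<n} - {m} - {i})"
    have "cand ?E m" using m by (simp add: cand_def)
    define m' where "m' = (SOME m. cand ?E m)"
    have c': "cand ?E m'" unfolding m'_def by (rule someI[of "cand ?E"]) fact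
    have g: "g ?E = lab b m'" using \<open>cand ?E m\<close> by (auto simp: g_def m'_def)
    show ?thesis
    proof (cases "m' = m")
      case False
      have m'n: "m' < n" "m' \<noteq> i" using c' by (auto simp: cand_def)
      then have "s m' \<in> ?E" using False by auto
      then have "s m' \<in> s ` ({..<n} - {m'} - {i})" using c' by (simp add: cand_def)
      then obtain j where j': "s m' = s j" "j \<in> {..<n} - {m'} - {i}" by (rule imageE)
      then have j: "j < n" "j \<noteq> m'" "j \<noteq> i" "s j = s m'" by simp_all
      have "j \<in> J" "m' \<in> J" using c' j m m'n False by (auto simp: cand_def)
      then have e: "eqv b j m'" using s(2) j(4) by (simp add: matches_def)
      have "j = m"
      proof (rule ccontr)
        assume "j \<noteq> m"
        then show False using apartD[OF _ e j(1) m'n(1) _ False] f j(2) by (auto simp: facet_def)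
      qed
      then show ?thesis using okD(5)[OF b(1) j(1) m'n(1) j(2) e] g by simp
    qed (use g in simp)
  qed
  have FAC: "L ((s(i := u)) ` ({..<n} - {m})) = lab b m" if m: "m < n" "m \<noteq> i" "{..<n} - {m} \<subseteq> insert i J" for m
  proof (cases "facet F n b m")
    case False
    then have "\<not> rel ((s(i := u)) ` ({..<n} - {m}))" using rf[OF u(1) ui m(1,3)] by simp
    then show ?thesis using okD(6)[OF b(1) m(1) m(1) False] by (simp add: L_def)
  next
    case True
    let ?E = "s ` ({..<n} - {m} - {i})"
    let ?S = "(s(i := u)) ` ({..<n} - {m})"
    have EJ: "?E \<subseteq> s ` J" using m(3) by (intro image_mono) blast
    have S: "?S = insert u ?E" "u \<notin> ?E" using img[OF m(2)] ui EJ by auto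
    have rel: "rel ?S" using rf[OF u(1) ui m(1,3)] True by simp
    have "Suc (card ?E) = n - 1" using rel S n by (simp add: rel_def)
    then have "nl u ?E = lab b m" using u(3)[OF EJ] cD g_lab[OF m True] by simp
    moreover have "asg ?S u" unfolding asg_def u(2) using S EJ by auto
    ultimately show ?thesis using L_asg[OF rel] S by simp
  qed
  have Li: "L (s ` ({..<n} - {i})) = lab b i" if "{..<n} - {i} \<subseteq> J"
    using s(2) that J(2) by (simp add: matches_def)
  have upd_i: "(s(i := v)) ` ({..<n} - {i}) = s ` ({..<n} - {i})" for v by (intro image_cong) auto
  have matchI: "matches (insert i J) (s(i := v)) b"
    if v: "srt v = kd b i" "v \<notin> s ` J"
      and L: "\<And>m. m < n \<Longrightarrow> m \<noteq> i \<Longrightarrow> {..<n} - {m} \<subseteq> insert i J \<Longrightarrow> L ((s(i := v)) ` ({..<n} - {m})) = lab b m" for v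
  proof -
    have "L ((s(i := v)) ` ({..<n} - {m})) = lab b m" if m: "m < n" "{..<n} - {m} \<subseteq> insert i J" for m
    proof (cases "m = i")
      case True
      then have "{..<n} - {i} \<subseteq> J" using m by blast
      then show ?thesis using Li upd_i True by simp
    next
      case False
      then show ?thesis using L m by blast
    qed
    moreover have "srt ((s(i := v)) x) = kd b x" if "x \<in> insert i J" for x using M(1)[OF v that that] .
    moreover have "(s(i := v)) x = (s(i := v)) y \<longleftrightarrow> eqv b x y" if "x \<in> insert i J" "y \<in> insert i J" for x y
      using M(2)[OF v that] .
    ultimately show ?thesis unfolding matches_def by blast
  qed
  have full: "J = {..<n} - {i} \<and> inj_on s J" if "card (D u) = n - 1"
  proof -
    have "card J = n - 1" using that u(2) card_image_le[OF fJ, of s] cJ by simp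
    moreover have "J \<subseteq> {..<n} - {i}" using J by blast
    ultimately have "J = {..<n} - {i}" using card_subset_eq[of "{..<n} - {i}" J] J(2) by simp
    moreover have "inj_on s J" using that u(2) \<open>card J = n - 1\<close> fJ by (intro eq_card_imp_inj_on) auto
    ultimately show ?thesis by blast
  qed
  have all: "(s(i := u)) ` {..<n} = insert u (D u)" "inj_on (s(i := u)) {..<n}" "\<forall>x<n. \<forall>y<n. eqv b x y \<longrightarrow> x = y"
    if "card (D u) = n - 1"
  proof -
    note f = full[OF that]
    have nJ: "{..<n} = insert i J" using f J(2) by auto
    have upd: "(s(i := u)) ` J = s ` J" using J(3) by (intro image_cong) auto
    show "(s(i := u)) ` {..<n} = insert u (D u)" unfolding nJ image_insert upd u(2) by simp
    have "inj_on (s(i := u)) J" by (rule inj_on_fun_updI[OF conjunct2[OF f] ui])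
    then show inj: "inj_on (s(i := u)) {..<n}" unfolding nJ using upd ui J(3) by simp
    show "\<forall>x<n. \<forall>y<n. eqv b x y \<longrightarrow> x = y"
    proof (intro allI impI)
      fix x y assume xy: "x < n" "y < n" "eqv b x y"
      then have "x \<in> insert i J" "y \<in> insert i J" using nJ by blast+
      then have "(s(i := u)) x = (s(i := u)) y" using M(2)[OF u(1) ui] xy(3) by blast
      then show "x = y" using inj_onD[OF inj] xy(1,2) by blast
    qed
  qed
  have Lall: "L ((s(i := u)) ` ({..<n} - {j})) = lab b j" if "card (D u) = n - 1" "j < n" for j
    using FAC[of j] Li upd_i full[OF that(1)] that(2) J(2) by (cases "j = i") auto
  have kall: "srt ((s(i := u)) j) = kd b j" if "card (D u) = n - 1" "j < n" for j
    using M(1)[OF u(1) ui, of j j] full[OF that(1)] that(2) J(2) by auto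
  have p3: "nl u (S - {u}) \<in> LL \<and>
      ((\<forall>v\<in>N S. isZ F (srt v)) \<longrightarrow> nl u (S - {u}) = w0 F \<or> nl u (S - {u}) = w1 F \<or> red F (nl u (S - {u})))"
    if S: "rel S" "asg S u" for S
  proof -
    let ?E = "S - {u}"
    have EJ: "?E \<subseteq> s ` J" and uS: "u \<in> S" using S(2) u(2) by (auto simp: asg_def)
    have "Suc (card ?E) = n - 1" using S(1) card_Suc_Diff1[OF _ uS] by (simp add: rel_def)
    then have nl: "nl u ?E = g ?E" using u(3)[OF EJ] cD by simp
    have "g ?E = w0 F \<or> g ?E = w1 F \<or> red F (g ?E)" if Z: "\<forall>v\<in>N S. isZ F (srt v)"
    proof (cases "\<exists>m. cand ?E m")
      case False
      then show ?thesis by (simp add: g_def)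
    next
      case True
      then obtain m where c: "cand ?E m" by blast
      then have m: "m < n" "m \<noteq> i" "{..<n} - {m} \<subseteq> insert i J" "s ` ({..<n} - {m} - {i}) = ?E" by (auto simp: cand_def)
      have SE: "S = (s(i := u)) ` ({..<n} - {m})" using img[OF m(2), of u] m(4) uS by auto
      have f: "facet F n b m" using rf[OF u(1) ui m(1,3)] S(1) SE by simp
      then have "card {j. j < n \<and> j \<noteq> m \<and> kd b j \<noteq> pp F} = 2" by (simp add: facet_def)
      then obtain p q where pq: "{j. j < n \<and> j \<noteq> m \<and> kd b j \<noteq> pp F} = {p, q}" "p \<noteq> q" by (auto simp: card_2_iff)
      then have p: "p < n" "p \<noteq> m" "kd b p \<noteq> pp F" and q: "q < n" "q \<noteq> m" "kd b q \<noteq> pp F" by blast+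
      have ZZ: "isZ F (kd b x)" if "x < n" "x \<noteq> m" "kd b x \<noteq> pp F" for x
      proof -
        have k: "srt ((s(i := u)) x) = kd b x" using M(1)[OF u(1) ui, of x x] that m(3) by auto
        then have "(s(i := u)) x \<in> N S" using that unfolding N_def SE by auto
        then show ?thesis using Z k by force
      qed
      have "lab b m = w0 F \<or> lab b m = w1 F \<or> red F (lab b m)"
        using okD(7)[OF b(1) m(1) m(1) p(1) q(1) f] p q pq(2) ZZ by simp
      then show ?thesis using g_lab[OF m(1-3) f] m(4) by simp
    qed
    then show ?thesis using gLL nl by simp
  qed
  have p4: "okT (insert u (D u))" if "card (D u) = n - 1" "card (N (insert u (D u))) = 3"
  proof -
    let ?s = "s(i := u)"
    note a = all[OF that(1)]
    have "{j \<in> {..<n}. srt (?s j) \<noteq> pp F} = {j. j < n \<and> kd b j \<noteq> pp F}"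
      by (intro Collect_cong conj_cong) (simp_all add: kall[OF that(1)] del: fun_upd_apply)
    then have c3: "card {j. j < n \<and> kd b j \<noteq> pp F} = 3" using card_N_image[OF a(2)] that(2) a(1) by simp
    have "okT (?s ` {..<n})"
    proof (rule iffD2[OF okT_simplex[OF kall[OF that(1)] a(2) Lall[OF that(1)]]], assumption+, intro ballI impI)
      fix x y z assume "x \<in> {..<n}" "y \<in> {..<n}" "z \<in> {..<n}" "x \<noteq> y" "x \<noteq> z" "y \<noteq> z"
      then show "simplex F (kd b x) (kd b y) (kd b z) (lab b x) (lab b y) (lab b z)"
        using okD(8)[OF b(1) _ _ a(3) c3] by simp
    qed
    then show ?thesis unfolding a(1) .
  qed
  have vD: "valid d" if "d \<in> D u" for d
  proof -
    obtain j where "d = s j" "j \<in> J" using \<open>d \<in> D u\<close> unfolding u(2) by (rule imageE)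
    then show ?thesis using s(1)[of j] by simp
  qed
  have vI: "valid u" if "card (D u) = n - 1 \<Longrightarrow> base (D u) u \<Longrightarrow> \<exists>g. asg (D u) g"
  proof (rule valid.intros)
    have "range g \<subseteq> LL" by (rule image_subsetI) (rule gLL)
    then have "insert (top u) (snd ` set (chl u)) \<subseteq> LL" using u(4) by (rule order_trans[rotated])
    moreover have "card (D u) \<le> n - 1" "srt u \<in> KK" using cD u(1,2) b(2)[OF J(2)] by auto
    ultimately show "admissible u" unfolding admissible_def using p3 p4 that by (intro conjI allI impI) simp_all
  qed (rule vD)
  show ?thesis
  proof (cases "valid u")
    case True
    then show ?thesis using matchI[OF u(1) ui FAC] by blast
  next
    case False
    \<comment> \<open>Only the last clause of \<open>admissible\<close> is left to fail: the
      children form a base without a labelling node, and \<open>u\<close> would be an apex over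
      it.\<close>
    then have c: "card (D u) = n - 1" and base: "base (D u) u" and na: "\<nexists>g. asg (D u) g" using vI by blast+
    have DJ: "D u = s ` ({..<n} - {i})" using full[OF c] u(2) by simp
    have relD: "rel (D u)" and sN: "srt ` N (D u) = {x0 F, x1 F}" and Zu: "isZ F (kd b i)"
      and gr: "\<And>x. x \<in> N (D u) \<Longrightarrow> grn (insert u (D u - {x}))"
      using base u(1) by (auto simp: base_def)
    have "x0 F \<in> srt ` N (D u)" "x1 F \<in> srt ` N (D u)" using sN by auto
    then obtain vp vq where vp: "vp \<in> N (D u)" "srt vp = x0 F" and vq: "vq \<in> N (D u)" "srt vq = x1 F" by auto
    obtain p where p: "p < n" "p \<noteq> i" "vp = s p" using vp N_subset[of vp "D u"] DJ by auto
    obtain q where q: "q < n" "q \<noteq> i" "vq = s q" using vq N_subset[of vq "D u"] DJ by auto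
    have kp: "kd b p = x0 F" and kq: "kd b q = x1 F" using kall[OF c p(1)] kall[OF c q(1)] p q vp vq by auto
    have pq: "p \<noteq> q" using kp kq sorts by auto
    have J': "J = {..<n} - {i}" "inj_on s J" using full[OF c] by auto
    have Dm: "D u - {s m} = s ` ({..<n} - {m} - {i})" if "m < n" "m \<noteq> i" for m
    proof -
      have "m \<in> J" using that J' by simp
      then have "s ` J - {s m} = s ` (J - {m})" using inj_on_image_set_diff[OF J'(2), of J "{m}"] by simp
      moreover have "J - {m} = {..<n} - {m} - {i}" using J' by blast
      ultimately show ?thesis using u(2) by simp
    qed
    have sub_n: "{..<n} - {m} \<subseteq> insert i J" for m using J'(1) by blast
    have glab: "lab b m = gr F" if "m < n" "m \<noteq> i" "grn (insert u (D u - {s m}))" for m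
      using FAC[OF that(1,2) sub_n] L_grn[OF that(3)] unfolding img[OF that(2)] Dm[OF that(1,2)] by simp
    have lp: "lab b p = gr F" using glab[OF p(1,2)] gr[OF vp(1)] p(3) by simp
    have lq: "lab b q = gr F" using glab[OF q(1,2)] gr[OF vq(1)] q(3) by simp
    have "N (D u) = {s p, s q}"
    proof -
      have "card (N (D u)) = 2" using relD by (simp add: rel_def)
      moreover have "s p \<noteq> s q" using J' p q pq by (auto simp: inj_on_def)
      ultimately show ?thesis using vp(1) vq(1) p q by (auto simp: card_2_iff)
    qed
    then have kP: "kd b m = pp F" if "m < n" "m \<noteq> i" "m \<noteq> p" "m \<noteq> q" for m
    proof -
      have "s m \<noteq> s p" "s m \<noteq> s q" "s m \<in> D u" using J' p q that DJ by (auto simp: inj_on_def)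
      then have "s m \<notin> N (D u)" using \<open>N (D u) = {s p, s q}\<close> by simp
      then show ?thesis using \<open>s m \<in> D u\<close> kall[OF c that(1)] that(2) by (simp add: N_def)
    qed
    have S3: "{j. j < n \<and> kd b j \<noteq> pp F} = {p, q, i}"
      using kP kp kq sorts Zu not_isZ p q J(2) by auto
    then have c3: "card {j. j < n \<and> kd b j \<noteq> pp F} = 3" using p q pq by simp
    have "simplex F (kd b p) (kd b q) (kd b i) (lab b p) (lab b q) (lab b i)"
      using okD(8)[OF b(1) p(1) p(1) all(3)[OF c] c3 q(1) J(2)] pq p q by simp
    then have mem: "mem F (kd b i) (lab b i)" using kp kq lp lq Zu by (simp add: simplex_def)
    have "lab b i = L (D u)" using Li J' DJ by simp
    also have "\<dots> = yy (srt ` apexes (D u))" using L_dflt[OF relD na] sN by (simp add: dflt_def)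
    finally have lab: "lab b i = yy (srt ` apexes (D u))" .
    have apv: "valid z" if "z \<in> apexes (D u)" for z
    proof -
      obtain w where "w \<in> D u" "z \<in> D w" using \<open>z \<in> apexes (D u)\<close> by (auto simp: apexes_def C_def)
      then show ?thesis using vD valid_D by blast
    qed
    have sub: "srt ` apexes (D u) \<subseteq> {k \<in> KK. isZ F k}"
      using apv valid_KK by (auto simp: apexes_def)
    have "finite (C (D u))" by (simp add: C_def)
    moreover have "apexes (D u) \<subseteq> C (D u)" by (auto simp: apexes_def)
    ultimately have fin: "finite (srt ` apexes (D u))" by (metis finite_subset finite_imageI)
    \<comment> \<open>The label that \<open>b\<close> gives to the base is its default. It admits
      the tint of the new point by the simplex rule, while \<open>yy\<close> admits no tint other
      than those of existing apexes.\<close>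
    have "kd b i \<in> srt ` apexes (D u)"
      using yy(3)[OF fin sub b(2)[OF J(2)] Zu] mem lab by simp
    then obtain z where z: "z \<in> apexes (D u)" "srt z = kd b i" by auto
    have zD: "z \<notin> s ` J" using z(1) u(2) by (simp add: apexes_def)
    have "matches (insert i J) (s(i := z)) b"
    proof (rule matchI[OF z(2) zD])
      fix m assume m: "m < n" "m \<noteq> i" "{..<n} - {m} \<subseteq> insert i J"
      have im: "(s(i := z)) ` ({..<n} - {m}) = insert z (D u - {s m})" using img[OF m(2)] Dm[OF m(1,2)] by simp
      show "L ((s(i := z)) ` ({..<n} - {m})) = lab b m"
      proof (cases "m = p \<or> m = q")
        case True
        then have "s m \<in> N (D u)" using vp(1) vq(1) p(3) q(3) by auto
        then have "grn (insert z (D u - {s m}))" using z(1) by (simp add: apexes_def)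
        then show ?thesis using L_grn im lp lq True by auto
      next
        case False
        \<comment> \<open>Omitting a plain place leaves three points that are not plain, hence no
          facet: only the labels opposite \<open>p\<close> and \<open>q\<close> have to be
          matched.\<close>
        have "{j. j < n \<and> j \<noteq> m \<and> kd b j \<noteq> pp F} = {j. j < n \<and> kd b j \<noteq> pp F}" using kP m False by auto
        then have nf: "\<not> facet F n b m" using c3 by (simp add: facet_def)
        then have "\<not> rel ((s(i := z)) ` ({..<n} - {m}))" using rf[OF z(2) zD m(1,3)] by simp
        then show ?thesis using okD(6)[OF b(1) m(1) m(1) nf] by (simp add: L_def)
      qed
    qed
    then show ?thesis using apv[OF z(1)] by blast
  qed
qed

lemma realised:
  assumes b: "ok F n b" "\<And>j. j < n \<Longrightarrow> kd b j \<in> KK" "\<And>j. j < n \<Longrightarrow> lab b j \<in> LL"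
  shows "\<exists>s. (\<forall>j<n. valid (s j)) \<and> matches {..<n} s b"
proof -
  have "\<exists>s. (\<forall>j<m. valid (s j)) \<and> matches {..<m} s b" if "m \<le> n" for m
    using that
  proof (induction m)
    case 0
    \<comment> \<open>The empty tuple matches because no set of all places but one is empty.\<close>
    have "(if m = 0 then 1 else 0) \<in> {..<n} - {m}" for m using n by auto
    then have "\<not> {..<n} - {m} \<subseteq> {}" for m by blast
    then show ?case by (auto simp: matches_def)
  next
    case (Suc m)
    then obtain s where s: "\<forall>j<m. valid (s j)" "matches {..<m} s b" by auto
    obtain u where u: "valid u" "matches (insert m {..<m}) (s(m := u)) b"
      using extension[OF b, of "{..<m}" m s] s Suc.prems by auto
    have "\<forall>j<Suc m. valid ((s(m := u)) j)" using s(1) u(1) by (auto simp: less_Suc_eq)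
    then show ?case using u(2) unfolding lessThan_Suc by blast
  qed
  then show ?thesis by blast
qed

end

section \<open>Comparing consistency in two frames\<close>

definition same :: "('k, 'l) frame \<Rightarrow> ('k', 'l') frame \<Rightarrow> nat \<Rightarrow> ('k, 'l) atom \<Rightarrow> ('k', 'l') atom \<Rightarrow> bool" where
  "same F G n a b \<longleftrightarrow> (\<forall>i<n. \<forall>j<n.
     (eqv a i j \<longleftrightarrow> eqv b i j) \<and> (kd a i = kd a j \<longleftrightarrow> kd b i = kd b j) \<and> (kd a i = pp F \<longleftrightarrow> kd b i = pp G) \<and>
     (kd a i = x0 F \<longleftrightarrow> kd b i = x0 G) \<and> (kd a i = x1 F \<longleftrightarrow> kd b i = x1 G) \<and> (lt F (kd a i) (kd a j) \<longleftrightarrow> lt G (kd b i) (kd b j)) \<and>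
     (lab a i = lab a j \<longleftrightarrow> lab b i = lab b j) \<and> (lab a i = w0 F \<longleftrightarrow> lab b i = w0 G) \<and> (lab a i = w1 F \<longleftrightarrow> lab b i = w1 G) \<and>
     (lab a i = gr F \<longleftrightarrow> lab b i = gr G) \<and> (red F (lab a i) \<longleftrightarrow> red G (lab b i)) \<and>
     (sm F (lab a i) (lab a j) \<longleftrightarrow> sm G (lab b i) (lab b j)) \<and> (mem F (kd a i) (lab a j) \<longleftrightarrow> mem G (kd b i) (lab b j)))"

text \<open>Consistency is a condition on finitely many atomic relations between the colours of a
  type, and \<open>same\<close> lists them all. It therefore passes to the ultrapower frame relation
  by relation.\<close>

lemma ok_same:
  assumes s: "same F G n a b"
  shows "ok F n a \<longleftrightarrow> ok G n b"
proof -
  have e: "eqv a i j \<longleftrightarrow> eqv b i j" "kd a i = kd a j \<longleftrightarrow> kd b i = kd b j" "lab a i = lab a j \<longleftrightarrow> lab b i = lab b j"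
    "lt F (kd a i) (kd a j) \<longleftrightarrow> lt G (kd b i) (kd b j)" "sm F (lab a i) (lab a j) \<longleftrightarrow> sm G (lab b i) (lab b j)"
    "mem F (kd a i) (lab a j) \<longleftrightarrow> mem G (kd b i) (lab b j)" if "i < n" "j < n" for i j
    using s[unfolded same_def, rule_format, OF that] by simp_all
  have k: "kd a i = pp F \<longleftrightarrow> kd b i = pp G" "kd a i = x0 F \<longleftrightarrow> kd b i = x0 G" "kd a i = x1 F \<longleftrightarrow> kd b i = x1 G"
    "lab a i = w0 F \<longleftrightarrow> lab b i = w0 G" "lab a i = w1 F \<longleftrightarrow> lab b i = w1 G" "lab a i = gr F \<longleftrightarrow> lab b i = gr G"
    "red F (lab a i) \<longleftrightarrow> red G (lab b i)" if "i < n" for i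
    using s[unfolded same_def, rule_format, OF that that] by simp_all
  have Z: "isZ F (kd a i) \<longleftrightarrow> isZ G (kd b i)" if "i < n" for i
    using that by (simp add: isZ_def k)
  have fa: "facet F n a i \<longleftrightarrow> facet G n b i" if "i < n" for i
  proof -
    have "apart n a i \<longleftrightarrow> apart n b i" unfolding apart_def using e(1) by simp
    moreover have "{j. j < n \<and> j \<noteq> i \<and> kd a j \<noteq> pp F} = {j. j < n \<and> j \<noteq> i \<and> kd b j \<noteq> pp G}"
      using k(1) by blast
    ultimately show ?thesis by (simp add: facet_def)
  qed
  have sx: "simplex F (kd a i) (kd a j) (kd a m) (lab a i) (lab a j) (lab a m) \<longleftrightarrow>
     simplex G (kd b i) (kd b j) (kd b m) (lab b i) (lab b j) (lab b m)" if "i < n" "j < n" "m < n" for i j m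
    unfolding simplex_def using that by (simp only: e k Z)
  have c: "{j. j < n \<and> kd a j \<noteq> pp F} = {j. j < n \<and> kd b j \<noteq> pp G}" using k(1) by blast
  show ?thesis unfolding ok_def c
    by (intro arg_cong2[where f = "(\<and>)"] all_cong imp_cong refl)
      (simp_all add: e k Z fa sx)
qed

instance node :: (countable, countable) countable by countable_datatype

context free_model
begin

text \<open>The colour types need not be countable, but a valid node contains only colours from
  \<open>KK\<close> and \<open>LL\<close>; replacing these by numbers gives trees over countable
  types.\<close>

lemma countable_valid:
  assumes "countable KK" "countable LL"
  shows "countable {u. valid u}"
proof -
  have "set1_node u \<subseteq> KK \<and> set2_node u \<subseteq> LL" if "valid u" for u
    using that
  proof (induction rule: valid.induct)
    case (1 u)
    have a: "srt u \<in> KK" "insert (top u) (snd ` set (chl u)) \<subseteq> LL" using 1(2) by (auto simp: admissible_def)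
    have IH: "set1_node d \<subseteq> KK" "set2_node d \<subseteq> LL" if "(d, l) \<in> set (chl u)" for d l
    proof -
      have "d \<in> D u" using that by (force simp: D_def)
      then show "set1_node d \<subseteq> KK" "set2_node d \<subseteq> LL" using 1(3) by blast+
    qed
    show ?case
    proof (cases u)
      case (Nd k ps t)
      then show ?thesis using a IH by (auto simp: image_subset_iff) blast+
    qed
  qed
  moreover have "u \<in> range (map_node (from_nat_into KK) (from_nat_into LL))"
    if "set1_node u \<subseteq> KK" "set2_node u \<subseteq> LL" for u
  proof -
    have "map_node (from_nat_into KK) (from_nat_into LL) (map_node (to_nat_on KK) (to_nat_on LL) u) = map_node id id u"
      unfolding node.map_comp using that assms by (intro node.map_cong refl) (auto simp: from_nat_into_to_nat_on subset_iff)
    then show ?thesis unfolding node.map_id by (metis rangeI)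
  qed
  ultimately have "{u. valid u} \<subseteq> range (map_node (from_nat_into KK) (from_nat_into LL))" by blast
  then show ?thesis by (rule countable_subset) simp
qed

lemma htype_in:
  assumes "\<And>j. j < n \<Longrightarrow> valid (s j)" "j < n"
  shows "kd (htype s) j \<in> KK" "lab (htype s) j \<in> LL"
proof -
  show "kd (htype s) j \<in> KK" using assms valid_KK by (simp add: htype_def)
  have "valid v" if "v \<in> s ` ({..<n} - {j})" for v using that assms(1) by auto
  then show "lab (htype s) j \<in> LL" using assms(2) L_cases(1)[of "s ` ({..<n} - {j})"] by (simp add: htype_def)
qed

end

text \<open>The standard type at index \<open>t\<close> of a type with sequences as colours. The
  equality pattern is finite and does not vary with \<open>t\<close>.\<close>

definition at :: "nat \<Rightarrow> (nat \<Rightarrow> sort, nat \<Rightarrow> label) atom \<Rightarrow> nat \<Rightarrow> (sort, label) atom" where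
  "at n a t = mk n (\<lambda>i. kd a i t) (eqv a) (\<lambda>i. lab a i t)"

lemma mk_At: "mk n k e l \<in> At n \<longleftrightarrow> ok std n (mk n k e l)"
  by (auto simp: At_def mk_def)

lemma at_At: "at n a t \<in> At n \<longleftrightarrow> ok std n (at n a t)"
  by (simp add: at_def mk_At)

lemma at_sel: "j < n \<Longrightarrow> kd (at n a t) j = kd a j t" "j < n \<Longrightarrow> lab (at n a t) j = lab a j t"
  "eqv (at n a t) i j \<longleftrightarrow> i < n \<and> j < n \<and> eqv a i j"
  by (auto simp: at_def mk_def)

section \<open>The frame of nonstandard colours\<close>

context ultra
begin

definition KK :: "nat \<Rightarrow> (nat \<Rightarrow> sort) set" where "KK n = canon (SK n) ` SK n"
definition LL :: "nat \<Rightarrow> (nat \<Rightarrow> label) set" where "LL n = canon (SL n) ` SL n"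

definition star :: "nat \<Rightarrow> (nat \<Rightarrow> sort, nat \<Rightarrow> label) frame" where
  "star n = \<lparr>pp = canon (SK n) (\<lambda>t. SP), x0 = canon (SK n) (\<lambda>t. SX0), x1 = canon (SK n) (\<lambda>t. SX1),
     w0 = canon (SL n) (\<lambda>t. LW0), w1 = canon (SL n) (\<lambda>t. LW1), gr = canon (SL n) (\<lambda>t. LG),
     red = (\<lambda>l. ev (\<lambda>t. red std (l t))), lt = (\<lambda>k k'. ev (\<lambda>t. lt std (k t) (k' t))),
     sm = (\<lambda>l l'. ev (\<lambda>t. sm std (l t) (l' t))), mem = (\<lambda>k l. ev (\<lambda>t. mem std (k t) (l t)))\<rparr>"

lemma star_simps [simp]:
  "pp (star n) = canon (SK n) (\<lambda>t. SP)" "x0 (star n) = canon (SK n) (\<lambda>t. SX0)" "x1 (star n) = canon (SK n) (\<lambda>t. SX1)"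
  "w0 (star n) = canon (SL n) (\<lambda>t. LW0)" "w1 (star n) = canon (SL n) (\<lambda>t. LW1)" "gr (star n) = canon (SL n) (\<lambda>t. LG)"
  "red (star n) l \<longleftrightarrow> ev (\<lambda>t. red std (l t))" "lt (star n) k k' \<longleftrightarrow> ev (\<lambda>t. lt std (k t) (k' t))"
  "sm (star n) l l' \<longleftrightarrow> ev (\<lambda>t. sm std (l t) (l' t))" "mem (star n) k l \<longleftrightarrow> ev (\<lambda>t. mem std (k t) (l t))"
  by (simp_all add: star_def)

lemma KK_const: "k \<in> KK n \<Longrightarrow> k = canon (SK n) (\<lambda>t. c) \<longleftrightarrow> ev (\<lambda>t. k t = c)"
proof -
  assume k: "k \<in> KK n"
  note c = canonical[OF k[unfolded KK_def]]
  show ?thesis using canon_eq_iff[OF c(1) SK_const, of c] c(2) by (simp add: sim_def)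
qed

lemma LL_const: "k \<in> LL n \<Longrightarrow> k = canon (SL n) (\<lambda>t. c) \<longleftrightarrow> ev (\<lambda>t. k t = c)"
proof -
  assume k: "k \<in> LL n"
  note c = canonical[OF k[unfolded LL_def]]
  show ?thesis using canon_eq_iff[OF c(1) SL_const, of c] c(2) by (simp add: sim_def)
qed

lemma KK_eq: "k \<in> KK n \<Longrightarrow> k' \<in> KK n \<Longrightarrow> k = k' \<longleftrightarrow> ev (\<lambda>t. k t = k' t)"
  unfolding KK_def by (rule canonical_eq)

lemma LL_eq: "k \<in> LL n \<Longrightarrow> k' \<in> LL n \<Longrightarrow> k = k' \<longleftrightarrow> ev (\<lambda>t. k t = k' t)"
  unfolding LL_def by (rule canonical_eq)

lemma ev_agreeI: "c = ev P \<Longrightarrow> ev (\<lambda>t. c = P t)"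
  using ev_agree[of P] by (simp add: eq_commute)

lemma ev_same:
  assumes k: "\<And>j. j < n \<Longrightarrow> kd a j \<in> KK n" and l: "\<And>j. j < n \<Longrightarrow> lab a j \<in> LL n"
  shows "ev (\<lambda>t. same (star n) std n a (at n a t))"
proof -
  have "ev (\<lambda>t.
     (eqv a i j \<longleftrightarrow> eqv (at n a t) i j) \<and> (kd a i = kd a j \<longleftrightarrow> kd (at n a t) i = kd (at n a t) j) \<and>
     (kd a i = pp (star n) \<longleftrightarrow> kd (at n a t) i = pp std) \<and>
     (kd a i = x0 (star n) \<longleftrightarrow> kd (at n a t) i = x0 std) \<and> (kd a i = x1 (star n) \<longleftrightarrow> kd (at n a t) i = x1 std) \<and>
     (lt (star n) (kd a i) (kd a j) \<longleftrightarrow> lt std (kd (at n a t) i) (kd (at n a t) j)) \<and>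
     (lab a i = lab a j \<longleftrightarrow> lab (at n a t) i = lab (at n a t) j) \<and> (lab a i = w0 (star n) \<longleftrightarrow> lab (at n a t) i = w0 std) \<and>
     (lab a i = w1 (star n) \<longleftrightarrow> lab (at n a t) i = w1 std) \<and>
     (lab a i = gr (star n) \<longleftrightarrow> lab (at n a t) i = gr std) \<and> (red (star n) (lab a i) \<longleftrightarrow> red std (lab (at n a t) i)) \<and>
     (sm (star n) (lab a i) (lab a j) \<longleftrightarrow> sm std (lab (at n a t) i) (lab (at n a t) j)) \<and>
     (mem (star n) (kd a i) (lab a j) \<longleftrightarrow> mem std (kd (at n a t) i) (lab (at n a t) j)))"
    if ij: "i < n" "j < n" for i j
    unfolding ev_conj at_sel(1)[OF ij(1)] at_sel(1)[OF ij(2)] at_sel(2)[OF ij(1)] at_sel(2)[OF ij(2)] at_sel(3)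
      star_simps std_simps KK_eq[OF k[OF ij(1)] k[OF ij(2)]] LL_eq[OF l[OF ij(1)] l[OF ij(2)]]
      KK_const[OF k[OF ij(1)]] LL_const[OF l[OF ij(1)]]
    by (intro conjI ev_agreeI refl) (simp add: ij)
  then show ?thesis unfolding same_def ev_all_less by blast
qed

lemma ok_star:
  assumes k: "\<And>j. j < n \<Longrightarrow> kd a j \<in> KK n" and l: "\<And>j. j < n \<Longrightarrow> lab a j \<in> LL n"
  shows "ok (star n) n a \<longleftrightarrow> ev (\<lambda>t. at n a t \<in> At n)"
proof -
  have 1: "ev (\<lambda>t. ok (star n) n a \<longleftrightarrow> at n a t \<in> At n)"
    unfolding at_At by (rule ev_mono[OF ev_same[OF assms]]) (simp_all add: ok_same)
  show ?thesis
  proof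
    assume "ok (star n) n a"
    then show "ev (\<lambda>t. at n a t \<in> At n)" using 1 by simp
  next
    assume "ev (\<lambda>t. at n a t \<in> At n)"
    then have "ev (\<lambda>t. ok (star n) n a)" by (rule ev_mono2[OF 1]) simp
    then show "ok (star n) n a" by simp
  qed
qed

lemma ev_ex: "ev P \<Longrightarrow> \<exists>t. P t"
proof (rule ccontr)
  assume "ev P" "\<nexists>t. P t"
  then show False using ev_mono[of P "\<lambda>t. False"] by auto
qed

text \<open>\<open>zs k k' d\<close> says that the tints \<open>k\<close> and \<open>k'\<close> lie in the same component of the successor
  relation, at distance \<open>d\<close>; \<open>phi\<close> ranks a component downwards from an infinite number.\<close>

definition zs :: "(nat \<Rightarrow> sort) \<Rightarrow> (nat \<Rightarrow> sort) \<Rightarrow> int \<Rightarrow> bool" where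
  "zs k k' d \<longleftrightarrow> ev (\<lambda>t. \<exists>i j. k t = SZ i \<and> k' t = SZ j \<and> int i - int j = d)"

definition root :: "(nat \<Rightarrow> sort) \<Rightarrow> nat \<Rightarrow> sort" where
  "root k = (SOME k'. \<exists>d. zs k k' d)"

definition off :: "(nat \<Rightarrow> sort) \<Rightarrow> int" where
  "off k = (THE d. zs k (root k) d)"

definition phi :: "nat \<Rightarrow> (nat \<Rightarrow> sort) \<Rightarrow> nat \<Rightarrow> label" where
  "phi n k = canon (SL n) (\<lambda>t. LR (t + nat (- off k) - nat (off k)))"

definition yy :: "nat \<Rightarrow> (nat \<Rightarrow> sort) set \<Rightarrow> nat \<Rightarrow> label" where
  "yy n Q = canon (SL n) (\<lambda>t. LY (map (\<lambda>k. k t) (SOME ks. set ks = Q)))"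

lemma zs_unique: "zs k k' d \<Longrightarrow> zs k k' d' \<Longrightarrow> d = d'"
proof -
  assume "zs k k' d" "zs k k' d'"
  then have "ev (\<lambda>t. d = d')" unfolding zs_def by (rule ev_mono2) auto
  then show "d = d'" by simp
qed

lemma zs_off: "ev (\<lambda>t. isZ std (k t)) \<Longrightarrow> zs k (root k) (off k)"
proof -
  assume "ev (\<lambda>t. isZ std (k t))"
  then have "zs k k 0" unfolding zs_def std_isZ by (rule ev_mono) auto
  then have "\<exists>d. zs k (root k) d" unfolding root_def by (intro someI_ex[of "\<lambda>k'. \<exists>d. zs k k' d"]) blast
  then have "\<exists>!d. zs k (root k) d" using zs_unique by blast
  then show ?thesis unfolding off_def by (rule theI')
qed

text \<open>Neighbouring tints have the same tints at finite distance, so the choice in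
  \<open>root\<close> gives both the same root, and their distances to it differ by one.\<close>

lemma off_Suc:
  assumes lt: "ev (\<lambda>t. lt std (k t) (k' t))"
  shows "off k' = off k + 1"
proof -
  have 1: "zs k' r (d + 1)" if "zs k r d" for r d
    using lt that unfolding zs_def by (rule ev_mono2) (auto simp: std_rel)
  have 2: "zs k r (d - 1)" if "zs k' r d" for r d
    using lt that unfolding zs_def by (rule ev_mono2) (auto simp: std_rel)
  have "(\<lambda>r. \<exists>d. zs k r d) = (\<lambda>r. \<exists>d. zs k' r d)" using 1 2 by blast
  then have "root k = root k'" by (simp add: root_def)
  moreover have "ev (\<lambda>t. isZ std (k t))" "ev (\<lambda>t. isZ std (k' t))"
    using lt by (auto elim!: ev_mono simp: std_rel std_isZ)
  ultimately show ?thesis using zs_off[of k] zs_off[of k'] 1 zs_unique by metis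
qed

lemma sim_phi: "sim (\<lambda>t. LR (t + nat (- off k) - nat (off k))) (phi n k)"
  unfolding phi_def by (rule sim_canon[OF SL_rank])

lemma star_model:
  assumes n: "2 < n"
  shows "free_model n (star n) (KK n) (LL n) (phi n) (yy n)"
proof
  have ks: "canon (SK n) (\<lambda>t. c) \<in> KK n" for c unfolding KK_def using SK_const by blast
  have ls: "canon (SL n) (\<lambda>t. c) \<in> LL n" for c unfolding LL_def using SL_const by blast
  have kne: "canon (SK n) (\<lambda>t. c) = canon (SK n) (\<lambda>t. c') \<longleftrightarrow> c = c'" for c c'
    using canon_eq_iff[OF SK_const SK_const, of n c c'] by (simp add: sim_def)
  have lne: "canon (SL n) (\<lambda>t. c) = canon (SL n) (\<lambda>t. c') \<longleftrightarrow> c = c'" for c c'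
    using canon_eq_iff[OF SL_const SL_const, of n c c'] by (simp add: sim_def)
  have nr: "\<not> ev (\<lambda>t. red std (canon (SL n) (\<lambda>t. c) t))" if "\<not> red std c" for c
  proof
    assume "ev (\<lambda>t. red std (canon (SL n) (\<lambda>t. c) t))"
    then have "ev (\<lambda>t. red std c)" using sim_canon[OF SL_const, of c n, unfolded sim_def] by (rule ev_mono2) simp
    then show False using that by simp
  qed
  show "2 < n" by (rule n)
  show "pp (star n) \<in> KK n" "x0 (star n) \<in> KK n" "x1 (star n) \<in> KK n" by (simp_all add: ks)
  show "pp (star n) \<noteq> x0 (star n)" "pp (star n) \<noteq> x1 (star n)" "x0 (star n) \<noteq> x1 (star n)" by (simp_all add: kne)
  show "w0 (star n) \<in> LL n" "w1 (star n) \<in> LL n" "gr (star n) \<in> LL n" by (simp_all add: ls)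
  show "w0 (star n) \<noteq> w1 (star n)" "gr (star n) \<noteq> w0 (star n)" by (simp_all add: lne)
  show "\<not> red (star n) (w0 (star n))" "\<not> red (star n) (w1 (star n))" using nr by (auto simp: std_rel)
  show "phi n k \<in> LL n \<and> red (star n) (phi n k)" for k
  proof
    show "phi n k \<in> LL n" unfolding phi_def LL_def using SL_rank by blast
    show "red (star n) (phi n k)" unfolding star_simps
      using sim_phi[of k n] unfolding sim_def by (rule ev_mono) (simp add: std_rel, metis rangeI)
  qed
  show "isZ (star n) k \<and> isZ (star n) k' \<and> \<not> lt (star n) k' k" if "lt (star n) k k'" for k k'
  proof -
    have e: "ev (\<lambda>t. lt std (k t) (k' t))" using that by simp
    have z: "k'' \<noteq> canon (SK n) (\<lambda>t. c)" if z: "ev (\<lambda>t. isZ std (k'' t))" "c \<in> {SP, SX0, SX1}" for k'' c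
    proof
      assume "k'' = canon (SK n) (\<lambda>t. c)"
      then have "ev (\<lambda>t. c = k'' t)" using sim_canon[OF SK_const, of c n] by (simp add: sim_def)
      then have "ev (\<lambda>t. isZ std c)" using z(1) by (rule ev_mono2) simp
      then show False using z(2) by (auto simp: std_isZ)
    qed
    have "ev (\<lambda>t. isZ std (k t))" "ev (\<lambda>t. isZ std (k' t))" using e by (auto elim!: ev_mono simp: std_rel std_isZ)
    moreover have "\<not> ev (\<lambda>t. lt std (k' t) (k t))"
    proof
      assume "ev (\<lambda>t. lt std (k' t) (k t))"
      with e have "ev (\<lambda>t. False)" by (rule ev_mono2) (auto simp: std_rel)
      then show False by simp
    qed
    ultimately show ?thesis using z by (auto simp: isZ_def)
  qed
  show "sm (star n) (phi n k') (phi n k)" if "lt (star n) k k'" for k k'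
  proof -
    have o: "off k' = off k + 1" using off_Suc that by simp
    let ?r = "\<lambda>k t. t + nat (- off k) - nat (off k)"
    \<comment> \<open>Truncated subtraction distorts the ranks only at small indices; from this
      bound on they differ by exactly one.\<close>
    have "ev (\<lambda>t. ?r k' t < ?r k t)"
      by (rule ev_cofinite[of "nat (off k) + nat (off k') + 1"]) (use o in linarith)
    then show ?thesis unfolding star_simps
      by (rule ev_mono3[OF _ sim_phi[of k n, unfolded sim_def] sim_phi[of k' n, unfolded sim_def]]) (simp add: std_rel, metis)
  qed
  fix Q assume Q: "finite Q" "Q \<subseteq> {k \<in> KK n. isZ (star n) k}"
  let ?ks = "SOME ks. set ks = Q"
  have ks: "set ?ks = Q" using finite_list[OF Q(1)] by (rule someI_ex)
  have QS: "set ?ks \<subseteq> SK n" using Q(2) canonical(1) unfolding ks KK_def by blast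
  have list: "(\<lambda>t. LY (map (\<lambda>k. k t) ?ks)) \<in> SL n" by (rule SL_list[OF QS])
  show "yy n Q \<in> LL n" unfolding yy_def LL_def using list by blast
  have mem: "mem (star n) k (yy n Q) \<longleftrightarrow> k \<in> Q" if k: "k \<in> KK n" for k
  proof -
    have s: "ev (\<lambda>t. LY (map (\<lambda>k. k t) ?ks) = yy n Q t)" using sim_canon[OF list] by (simp add: sim_def yy_def)
    have m: "mem std (k t) (LY (map (\<lambda>k. k t) ?ks)) \<longleftrightarrow> (\<exists>q\<in>Q. k t = q t)" for t
      by (auto simp: std_rel ks)
    have "mem (star n) k (yy n Q) \<longleftrightarrow> ev (\<lambda>t. \<exists>q\<in>Q. k t = q t)"
    proof
      assume "mem (star n) k (yy n Q)"
      then have "ev (\<lambda>t. mem std (k t) (yy n Q t))" by simp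
      with s show "ev (\<lambda>t. \<exists>q\<in>Q. k t = q t)" by (rule ev_mono2) (metis m)
    next
      assume "ev (\<lambda>t. \<exists>q\<in>Q. k t = q t)"
      with s show "mem (star n) k (yy n Q)" unfolding star_simps by (rule ev_mono2) (metis m)
    qed
    \<comment> \<open>Because \<open>Q\<close> is finite, \<open>ev\<close> passes through the
      disjunction: a tint that equals a listed one at almost every index equals one of them in the
      quotient. So the list acquires no nonstandard members.\<close>
    also have "\<dots> \<longleftrightarrow> (\<exists>q\<in>Q. ev (\<lambda>t. k t = q t))" by (rule ev_bex[OF Q(1)])
    also have "\<dots> \<longleftrightarrow> (\<exists>q\<in>Q. k = q)" using Q(2) KK_eq[OF k] by blast
    finally show ?thesis by simp
  qed
  show "mem (star n) k (yy n Q)" if "k \<in> Q" for k using mem[of k] that Q(2) by blast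
  show "k \<in> Q" if "k \<in> KK n" "mem (star n) k (yy n Q)" for k using mem[OF that(1)] that(2) by blast
qed

text \<open>An atom is chosen from \<open>y t\<close> at every index. The operations
  \<open>OKd\<close> and \<open>OLab\<close> keep its sequences of colours in the stock, and the
  ultrafilter decides its finite equality pattern, which gives one nonstandard type.\<close>

lemma sequence_atom:
  assumes y: "y \<in> SE n" and ne: "ev (\<lambda>t. y t \<noteq> {})"
  obtains b where "ok (star n) n b" "\<And>j. j < n \<Longrightarrow> kd b j \<in> KK n" "\<And>j. j < n \<Longrightarrow> lab b j \<in> LL n" "ev (\<lambda>t. at n b t \<in> y t)"
proof -
  let ?c = "\<lambda>t. SOME a. a \<in> y t"
  define b where "b = Atom (\<lambda>j. canon (SK n) (\<lambda>t. kd (?c t) j)) (\<lambda>i j. ev (\<lambda>t. eqv (?c t) i j)) (\<lambda>j. canon (SL n) (\<lambda>t. lab (?c t) j))"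
  have k: "kd b j \<in> KK n" and l: "lab b j \<in> LL n" for j
    unfolding b_def KK_def LL_def using SK_kd[OF y] SL_lab[OF y] by simp_all
  have cy: "ev (\<lambda>t. ?c t \<in> y t)" using ne by (rule ev_mono) (simp add: some_in_eq)
  have ek: "ev (\<lambda>t. \<forall>j<n. kd (?c t) j = kd b j t)"
    unfolding ev_all_less using sim_canon[OF SK_kd[OF y]] by (simp add: b_def sim_def)
  have el: "ev (\<lambda>t. \<forall>j<n. lab (?c t) j = lab b j t)"
    unfolding ev_all_less using sim_canon[OF SL_lab[OF y]] by (simp add: b_def sim_def)
  have ee: "ev (\<lambda>t. \<forall>i<n. \<forall>j<n. eqv (?c t) i j \<longleftrightarrow> eqv b i j)"
    unfolding ev_all_less using ev_agree by (simp add: b_def)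
  have kl: "ev (\<lambda>t. (\<forall>j<n. kd (?c t) j = kd b j t) \<and> (\<forall>j<n. lab (?c t) j = lab b j t))" using ek el ev_conj by simp
  have eq: "ev (\<lambda>t. at n b t \<in> y t \<and> at n b t \<in> At n)"
  proof (rule ev_mono3[OF cy kl ee])
    fix t assume c: "?c t \<in> y t" and kl: "(\<forall>j<n. kd (?c t) j = kd b j t) \<and> (\<forall>j<n. lab (?c t) j = lab b j t)"
      and e: "\<forall>i<n. \<forall>j<n. eqv (?c t) i j \<longleftrightarrow> eqv b i j"
    have cA: "?c t \<in> At n" using carrier_Alg_subset[OF SE_carrier[OF y]] c by blast
    have "kd (at n b t) j = kd (?c t) j" "lab (at n b t) j = lab (?c t) j" for j
      using kl cA by (cases "j < n"; simp add: at_def mk_def At_def)+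
    moreover have "eqv (at n b t) i j = eqv (?c t) i j" for i j
      using e cA unfolding at_sel(3) At_def by blast
    ultimately have "at n b t = ?c t" by (intro atom.expand) (simp add: fun_eq_iff)
    then show "at n b t \<in> y t \<and> at n b t \<in> At n" using c cA by simp
  qed
  then have "ok (star n) n b" using ok_star[OF k l] unfolding ev_conj by blast
  then show thesis using that[of b] k l eq unfolding ev_conj by blast
qed

end

lemma (in free_model) matches_all:
  assumes "matches {..<n} s b"
  shows "j < n \<Longrightarrow> kd (htype s) j = kd b j" "j < n \<Longrightarrow> lab (htype s) j = lab b j"
    "i < n \<Longrightarrow> j < n \<Longrightarrow> eqv (htype s) i j \<longleftrightarrow> eqv b i j"
  using assms by (auto simp: matches_def htype_def)

lemma (in free_model) htype_cong: "(\<And>j. j < n \<Longrightarrow> s j = s' j) \<Longrightarrow> htype s = htype s'"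
proof -
  assume e: "\<And>j. j < n \<Longrightarrow> s j = s' j"
  have "s ` ({..<n} - {m}) = s' ` ({..<n} - {m})" for m using e by (intro image_cong) auto
  then show ?thesis using e by (auto simp: htype_def fun_eq_iff)
qed

lemma at_cong:
  assumes "\<And>j. j < n \<Longrightarrow> kd a j = kd b j" "\<And>j. j < n \<Longrightarrow> lab a j = lab b j"
    "\<And>i j. i < n \<Longrightarrow> j < n \<Longrightarrow> eqv a i j \<longleftrightarrow> eqv b i j"
  shows "at n a t = at n b t"
  using assms by (auto simp: at_def mk_def fun_eq_iff)

section \<open>The complete representation\<close>

text \<open>\<open>\<iota>\<close> merely names the valid nodes by points of \<open>'u\<close>.
  There is one base, so the unit is a single square.\<close>

locale representation = ultra +
  fixes n :: nat and \<iota> :: "(nat \<Rightarrow> sort, nat \<Rightarrow> label) node \<Rightarrow> 'u"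
  assumes n: "2 < n"
    and inj: "inj_on \<iota> {u. free_model.valid n (star n) (KK n) (LL n) (phi n) (yy n) u}"
begin

sublocale M: free_model n "star n" "KK n" "LL n" "phi n" "yy n"
  by (rule star_model[OF n])

definition U where "U = {u. M.valid u}"
definition base where "base = \<iota> ` U"
definition pre where "pre = inv_into U \<iota>"
definition sq where "sq = square n base"

definition tp :: "(nat \<Rightarrow> 'u) \<Rightarrow> nat \<Rightarrow> (sort, label) atom" where
  "tp s t = at n (M.htype (pre \<circ> s)) t"

definition rho :: "(nat \<Rightarrow> (sort, label) atom set) \<Rightarrow> (nat \<Rightarrow> 'u) set" where
  "rho x = {s \<in> sq. ev (\<lambda>t. tp s t \<in> x t)}"

lemma inj_U: "inj_on \<iota> U"
  using inj by (simp add: U_def)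

lemma pre_base: "x \<in> base \<Longrightarrow> M.valid (pre x)" "x \<in> base \<Longrightarrow> \<iota> (pre x) = x"
proof -
  assume x: "x \<in> base"
  have "pre x \<in> U" unfolding pre_def using x unfolding base_def by (rule inv_into_into)
  then show "M.valid (pre x)" by (simp add: U_def)
  show "\<iota> (pre x) = x" unfolding pre_def using x unfolding base_def by (rule f_inv_into_f)
qed

lemma pre_iota: "M.valid u \<Longrightarrow> pre (\<iota> u) = u"
  unfolding pre_def by (rule inv_into_f_f[OF inj_U]) (simp add: U_def)

lemma iota_base: "M.valid u \<Longrightarrow> \<iota> u \<in> base"
  by (simp add: base_def U_def)

lemma sq_base: "s \<in> sq \<Longrightarrow> j < n \<Longrightarrow> s j \<in> base"
  unfolding sq_def square_def by (auto dest: PiE_mem)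

lemma sq_valid: "s \<in> sq \<Longrightarrow> j < n \<Longrightarrow> M.valid ((pre \<circ> s) j)"
  using pre_base(1) sq_base by simp

lemma sq_in:
  assumes s: "s \<in> sq" and j: "j < n"
  shows "kd (M.htype (pre \<circ> s)) j \<in> KK n" "lab (M.htype (pre \<circ> s)) j \<in> LL n"
  proof -
  have v: "\<And>j. j < n \<Longrightarrow> M.valid ((pre \<circ> s) j)" by (rule sq_valid[OF s])
  show "kd (M.htype (pre \<circ> s)) j \<in> KK n" "lab (M.htype (pre \<circ> s)) j \<in> LL n"
    by (rule M.htype_in[OF v j]; assumption)+
qed

lemma tp_At: "s \<in> sq \<Longrightarrow> ev (\<lambda>t. tp s t \<in> At n)"
proof -
  assume s: "s \<in> sq"
  have "ok (star n) n (M.htype (pre \<circ> s))" by (rule M.htype_ok[OF sq_valid[OF s]])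
  then show ?thesis unfolding tp_def using ok_star[of n "M.htype (pre \<circ> s)", OF sq_in[OF s]] by blast
qed

lemma tp_SE: "s \<in> sq \<Longrightarrow> (\<lambda>t. {tp s t} \<inter> At n) \<in> SE n"
proof -
  assume s: "s \<in> sq"
  have "kd (M.htype (pre \<circ> s)) j \<in> SK n" "lab (M.htype (pre \<circ> s)) j \<in> SL n" if "j < n" for j
    using sq_in[OF s that] canonical(1) unfolding KK_def LL_def by blast+
  then show ?thesis unfolding tp_def at_def by (rule SE_mk)
qed

lemma tp_agree:
  assumes "s \<in> sq" "s' \<in> sq" "i < n" "\<forall>j. j \<noteq> i \<longrightarrow> s j = s' j"
  shows "agree i (tp s t) (tp s' t)"
proof -
  have "(pre \<circ> s) ` ({..<n} - {i}) = (pre \<circ> s') ` ({..<n} - {i})" using assms(4) by (intro image_cong) auto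
  then show ?thesis using assms(3,4) by (auto simp: agree_def tp_def at_def mk_def M.htype_def)
qed

lemma tp_eqv: "s \<in> sq \<Longrightarrow> i < n \<Longrightarrow> j < n \<Longrightarrow> eqv (tp s t) i j \<longleftrightarrow> s i = s j"
proof -
  assume s: "s \<in> sq" and ij: "i < n" "j < n"
  have "pre (s i) = pre (s j) \<longleftrightarrow> s i = s j" using pre_base(2)[OF sq_base[OF s ij(1)]] pre_base(2)[OF sq_base[OF s ij(2)]] by metis
  then show ?thesis using ij by (simp add: tp_def at_sel M.htype_def)
qed

lemma realise:
  assumes y: "y \<in> SE n" "ev (\<lambda>t. y t \<noteq> {})"
  shows "\<exists>s\<in>sq. ev (\<lambda>t. tp s t \<in> y t)"
proof -
  obtain b where b: "ok (star n) n b" "\<And>j. j < n \<Longrightarrow> kd b j \<in> KK n" "\<And>j. j < n \<Longrightarrow> lab b j \<in> LL n"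
    and by': "ev (\<lambda>t. at n b t \<in> y t)"
    using sequence_atom[OF y] by blast
  obtain \<sigma> where \<sigma>: "\<forall>j<n. M.valid (\<sigma> j)" "M.matches {..<n} \<sigma> b" using M.realised[OF b] by blast
  define s where "s = restrict (\<iota> \<circ> \<sigma>) {..<n}"
  have s: "s \<in> sq" unfolding s_def sq_def square_def restrict_PiE_iff using \<sigma>(1) iota_base by simp
  have "M.htype (pre \<circ> s) = M.htype \<sigma>" by (rule M.htype_cong) (use \<sigma>(1) pre_iota in \<open>simp add: s_def\<close>)
  moreover have "at n (M.htype \<sigma>) t = at n b t" for t by (rule at_cong) (use M.matches_all[OF \<sigma>(2)] in auto)
  ultimately have "tp s t = at n b t" for t by (simp add: tp_def)
  then show ?thesis using s by' by (intro bexI[of _ s]) simp_all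
qed

text \<open>The meet of \<open>x\<close> with the cylinder over the type of \<open>s\<close> is
  again in the stock, and a type inside it agrees with that of \<open>s\<close> off place
  \<open>i\<close>. The free model then supplies the point for place \<open>i\<close>.\<close>

lemma extend:
  assumes s: "s \<in> sq" and i: "i < n" and x: "x \<in> SE n" and e: "ev (\<lambda>t. tp s t \<in> cyl (Alg n) i (x t))"
  shows "\<exists>s'\<in>rho x. \<forall>j. j \<noteq> i \<longrightarrow> s j = s' j"
proof -
  let ?a = "M.htype (pre \<circ> s)"
  let ?y = "\<lambda>t. x t \<inter> cyl (Alg n) i ({tp s t} \<inter> At n)"
  have y: "?y \<in> SE n" by (rule SE_closed(2)[OF x SE_closed(6)[OF tp_SE[OF s]]])
  have "ev (\<lambda>t. ?y t \<noteq> {})"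
  proof (rule ev_mono2[OF e tp_At[OF s]])
    fix t assume "tp s t \<in> cyl (Alg n) i (x t)" "tp s t \<in> At n"
    then obtain m where m: "m \<in> x t" "agree i (tp s t) m" by auto
    have "m \<in> At n" using carrier_Alg_subset[OF SE_carrier[OF x]] m(1) by blast
    then have "m \<in> ?y t" using m \<open>tp s t \<in> At n\<close> agree_sym[OF m(2)] by simp
    then show "?y t \<noteq> {}" by blast
  qed
  then obtain b where b: "ok (star n) n b" "\<And>j. j < n \<Longrightarrow> kd b j \<in> KK n" "\<And>j. j < n \<Longrightarrow> lab b j \<in> LL n"
    and by': "ev (\<lambda>t. at n b t \<in> ?y t)"
    using sequence_atom[OF y] by blast
  have ag: "ev (\<lambda>t. agree i (at n b t) (tp s t))" using by' by (rule ev_mono) auto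
  have k: "kd ?a j = kd b j" if "j < n" "j \<noteq> i" for j
    unfolding KK_eq[OF sq_in(1)[OF s that(1)] b(2)[OF that(1)]]
  using ag
  proof (rule ev_mono)
    fix t assume "agree i (at n b t) (tp s t)"
    then have "kd (at n b t) j = kd (tp s t) j" using \<open>j \<noteq> i\<close> unfolding agree_def by blast
    then show "kd ?a j t = kd b j t" unfolding tp_def at_sel(1)[OF \<open>j < n\<close>] by (rule sym)
  qed
  have l: "lab ?a i = lab b i"
    unfolding LL_eq[OF sq_in(2)[OF s i] b(3)[OF i]]
  using ag
  proof (rule ev_mono)
    fix t assume "agree i (at n b t) (tp s t)"
    then have "lab (at n b t) i = lab (tp s t) i" unfolding agree_def by blast
    then show "lab ?a i t = lab b i t" unfolding tp_def at_sel(2)[OF i] by (rule sym)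
  qed
  have q: "eqv ?a j j' \<longleftrightarrow> eqv b j j'" if "j < n" "j' < n" "j \<noteq> i" "j' \<noteq> i" for j j'
  proof -
    \<comment> \<open>The equality pattern does not depend on the index, so agreement at a single
      index suffices.\<close>
    obtain t where "agree i (at n b t) (tp s t)" using ev_ex[OF ag] by blast
    then have "eqv (at n b t) j j' = eqv (tp s t) j j'" using that unfolding agree_def by blast
    then show ?thesis using that unfolding tp_def at_sel(3) by simp
  qed
  have "M.matches ({..<n} - {i}) (pre \<circ> s) b" unfolding M.matches_def
  proof (intro conjI ballI allI impI)
    fix j assume j: "j \<in> {..<n} - {i}"
    then show "srt ((pre \<circ> s) j) = kd b j" using k[of j] by (simp add: M.htype_def)
    fix j' assume "j' \<in> {..<n} - {i}"
    then show "((pre \<circ> s) j = (pre \<circ> s) j') = eqv b j j'" using q[of j j'] j by (simp add: M.htype_def)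
  next
    fix m assume m: "m < n" "{..<n} - {m} \<subseteq> {..<n} - {i}"
    then have "m = i" using i by blast
    then show "M.L ((pre \<circ> s) ` ({..<n} - {m})) = lab b m" using l i by (simp add: M.htype_def)
  qed
  then obtain u where u: "M.valid u" "M.matches (insert i ({..<n} - {i})) ((pre \<circ> s)(i := u)) b"
    using M.extension[OF b, of "{..<n} - {i}" i "pre \<circ> s"] i sq_valid[OF s] by auto
  have "insert i ({..<n} - {i}) = {..<n}" using i by blast
  then have u2: "M.matches {..<n} ((pre \<circ> s)(i := u)) b" using u(2) by simp
  let ?s = "s(i := \<iota> u)"
  have s': "?s \<in> sq" unfolding sq_def by (rule square_upd[OF s[unfolded sq_def] i iota_base[OF u(1)]])
  have "pre \<circ> ?s = (pre \<circ> s)(i := u)" using pre_iota[OF u(1)] by (auto simp: fun_eq_iff)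
  then have "tp ?s t = at n b t" for t
    unfolding tp_def by (intro at_cong) (use M.matches_all[OF u2] in auto)
  then have "ev (\<lambda>t. tp ?s t \<in> x t)" using by' by (elim ev_mono) simp
  then have "?s \<in> rho x" using s' by (simp add: rho_def)
  then show ?thesis by (intro bexI[of _ ?s]) simp_all
qed

lemma rho_canon: "x \<in> SE n \<Longrightarrow> rho (canon (SE n) x) = rho x"
proof -
  assume "x \<in> SE n"
  then have s: "ev (\<lambda>t. x t = canon (SE n) x t)" using sim_canon by (simp add: sim_def)
  have "ev (\<lambda>t. tp s t \<in> canon (SE n) x t) \<longleftrightarrow> ev (\<lambda>t. tp s t \<in> x t)" for s
  proof
    assume "ev (\<lambda>t. tp s t \<in> canon (SE n) x t)"
    with s show "ev (\<lambda>t. tp s t \<in> x t)" by (rule ev_mono2) simp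
  next
    assume "ev (\<lambda>t. tp s t \<in> x t)"
    with s show "ev (\<lambda>t. tp s t \<in> canon (SE n) x t)" by (rule ev_mono2) simp
  qed
  then show ?thesis by (simp add: rho_def)
qed

lemma rho_simps:
  "rho (\<lambda>t. x t \<union> y t) = rho x \<union> rho y" "rho (\<lambda>t. x t \<inter> y t) = rho x \<inter> rho y"
  "rho (\<lambda>t. At n - x t) = sq - rho x" "rho (\<lambda>t. {}) = {}" "rho (\<lambda>t. At n) = sq"
proof -
  show "rho (\<lambda>t. x t \<union> y t) = rho x \<union> rho y" "rho (\<lambda>t. x t \<inter> y t) = rho x \<inter> rho y"
    by (auto simp: rho_def ev_disj ev_conj)
  show "rho (\<lambda>t. {}) = {}" "rho (\<lambda>t. At n) = sq" using tp_At by (auto simp: rho_def)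
  have "ev (\<lambda>t. tp s t \<in> At n - x t) \<longleftrightarrow> \<not> ev (\<lambda>t. tp s t \<in> x t)" if "s \<in> sq" for s
    using tp_At[OF that] ev_not[of "\<lambda>t. tp s t \<in> x t"] by (simp add: ev_conj)
  then show "rho (\<lambda>t. At n - x t) = sq - rho x" by (auto simp: rho_def)
qed

lemma complete_rep: "complete_representation n (UB n) {base} rho"
proof -
  have V: "(\<Union>U\<in>{base}. square n U) = sq" by (simp add: sq_def)
  have car: "x \<in> SE n" "canon (SE n) x = x" if "x \<in> canon (SE n) ` SE n" for x using canonical[OF that] by blast+
  have injr: "x = y" if xy: "x \<in> canon (SE n) ` SE n" "y \<in> canon (SE n) ` SE n" and r: "rho x = rho y" for x y
  proof -
    have le: "\<not> ev (\<lambda>t. x t \<inter> (At n - y t) \<noteq> {})" if x: "x \<in> SE n" and y: "y \<in> SE n" and r: "rho x = rho y" for x y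
    proof
      have z: "(\<lambda>t. x t \<inter> (At n - y t)) \<in> SE n" by (rule SE_closed(2)[OF x SE_closed(3)[OF y]])
      assume "ev (\<lambda>t. x t \<inter> (At n - y t) \<noteq> {})"
      from realise[OF z this] obtain s where s: "s \<in> sq" "ev (\<lambda>t. tp s t \<in> x t \<inter> (At n - y t))" by blast
      then have "s \<in> rho (\<lambda>t. x t \<inter> (At n - y t))" by (simp add: rho_def)
      then have "s \<in> rho x \<inter> (sq - rho y)" unfolding rho_simps .
      then show False using r by blast
    qed
    have "ev (\<lambda>t. x t \<inter> (At n - y t) = {})" "ev (\<lambda>t. y t \<inter> (At n - x t) = {})"
      using le[OF car(1)[OF xy(1)] car(1)[OF xy(2)] r] le[OF car(1)[OF xy(2)] car(1)[OF xy(1)] r[symmetric]]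
      by (simp_all add: ev_not)
    then have "ev (\<lambda>t. x t = y t)"
    proof (rule ev_mono2)
      fix t assume "x t \<inter> (At n - y t) = {}" "y t \<inter> (At n - x t) = {}"
      moreover have "x t \<subseteq> At n" "y t \<subseteq> At n" using carrier_Alg_subset SE_carrier car(1) xy by blast+
      ultimately show "x t = y t" by blast
    qed
    then show ?thesis using canonical_eq[OF xy] by blast
  qed
  have hom: "rho \<in> cyl_hom n (UB n) (full_set_algebra sq)"
    unfolding cyl_hom_def
  proof (intro CollectI conjI ballI allI impI funcsetI)
    show "rho x \<in> carrier (full_set_algebra sq)" for x by (auto simp: full_set_algebra_def rho_def)
    show "rho (x \<oplus>\<^bsub>UB n\<^esub> y) = rho x \<oplus>\<^bsub>full_set_algebra sq\<^esub> rho y" if "x \<in> carrier (UB n)" "y \<in> carrier (UB n)" for x y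
      using rho_canon[OF SE_closed(1)[OF car(1) car(1), of x y]] that by (simp add: full_set_algebra_def rho_simps)
    show "rho (x \<odot>\<^bsub>UB n\<^esub> y) = rho x \<odot>\<^bsub>full_set_algebra sq\<^esub> rho y" if "x \<in> carrier (UB n)" "y \<in> carrier (UB n)" for x y
      using rho_canon[OF SE_closed(2)[OF car(1) car(1), of x y]] that by (simp add: full_set_algebra_def rho_simps)
    show "rho (\<ominus>\<^bsub>UB n\<^esub> x) = \<ominus>\<^bsub>full_set_algebra sq\<^esub> rho x" if "x \<in> carrier (UB n)" for x
      using rho_canon[OF SE_closed(3)[OF car(1), of x]] that by (simp add: full_set_algebra_def rho_simps)
    show "rho \<zero>\<^bsub>UB n\<^esub> = \<zero>\<^bsub>full_set_algebra sq\<^esub>" using rho_canon[OF SE_closed(4)] by (simp add: full_set_algebra_def rho_simps)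
    show "rho \<one>\<^bsub>UB n\<^esub> = \<one>\<^bsub>full_set_algebra sq\<^esub>" using rho_canon[OF SE_closed(5)] by (simp add: full_set_algebra_def rho_simps)
    show "rho (diag (UB n) i j) = diag (full_set_algebra sq) i j" if ij: "i < n" "j < n" for i j
    proof -
      have "s \<in> rho (\<lambda>t. diag (Alg n) i j) \<longleftrightarrow> s i = s j" if "s \<in> sq" for s
        using that tp_eqv[OF that ij] tp_At[OF that] by (simp add: rho_def ev_conj)
      moreover have "rho (\<lambda>t. diag (Alg n) i j) \<subseteq> sq" by (auto simp: rho_def)
      ultimately have "rho (\<lambda>t. diag (Alg n) i j) = {s \<in> sq. s i = s j}" by blast
      then show ?thesis unfolding UB_simps rho_canon[OF SE_closed(7)] by (simp add: full_set_algebra_def)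
    qed
    fix i x assume i: "i < n" and x: "x \<in> carrier (UB n)"
    have xS: "x \<in> SE n" using car(1) x by simp
    have "s \<in> rho (\<lambda>t. cyl (Alg n) i (x t)) \<longleftrightarrow> (\<exists>s'\<in>rho x. \<forall>j. j \<noteq> i \<longrightarrow> s j = s' j)" if s: "s \<in> sq" for s
    proof
      assume "s \<in> rho (\<lambda>t. cyl (Alg n) i (x t))"
      then have "ev (\<lambda>t. tp s t \<in> cyl (Alg n) i (x t))" unfolding rho_def by blast
      then show "\<exists>s'\<in>rho x. \<forall>j. j \<noteq> i \<longrightarrow> s j = s' j" by (rule extend[OF s i xS])
    next
      assume "\<exists>s'\<in>rho x. \<forall>j. j \<noteq> i \<longrightarrow> s j = s' j"
      then obtain s' where s': "s' \<in> sq" "ev (\<lambda>t. tp s' t \<in> x t)" "\<forall>j. j \<noteq> i \<longrightarrow> s j = s' j" by (auto simp: rho_def)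
      have "ev (\<lambda>t. tp s t \<in> cyl (Alg n) i (x t))"
        using tp_At[OF s] s'(2) by (rule ev_mono2) (use tp_agree[OF s s'(1) i s'(3)] in auto)
      then show "s \<in> rho (\<lambda>t. cyl (Alg n) i (x t))" using s unfolding rho_def by blast
    qed
    moreover have "rho (\<lambda>t. cyl (Alg n) i (x t)) \<subseteq> sq" by (auto simp: rho_def)
    ultimately have "rho (\<lambda>t. cyl (Alg n) i (x t)) = {s \<in> sq. \<exists>s'\<in>rho x. \<forall>j. j \<noteq> i \<longrightarrow> s j = s' j}" by blast
    then show "rho (cyl (UB n) i x) = cyl (full_set_algebra sq) i (rho x)"
      unfolding UB_simps rho_canon[OF SE_closed(6)[OF xS]] by (simp add: full_set_algebra_def)
  qed
  have sums: "rho z = \<Union> (rho ` X)" if X: "X \<subseteq> carrier (UB n)" and z: "is_sum (UB n) X z" for X z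
  proof (rule antisym)
    have zc: "z \<in> canon (SE n) ` SE n" using z by (simp add: is_sum_def)
    show "\<Union> (rho ` X) \<subseteq> rho z"
    proof (rule UN_least)
      fix x assume x: "x \<in> X"
      then have xc: "x \<in> canon (SE n) ` SE n" using X by auto
      have "x \<oplus>\<^bsub>UB n\<^esub> z = z" using z x unfolding is_sum_def by blast
      then have "rho (canon (SE n) (\<lambda>t. x t \<union> z t)) = rho z" by simp
      then have "rho x \<union> rho z = rho z"
        unfolding rho_canon[OF SE_closed(1)[OF car(1)[OF xc] car(1)[OF zc]]] rho_simps .
      then show "rho x \<subseteq> rho z" by blast
    qed
    show "rho z \<subseteq> \<Union> (rho ` X)"
    proof (rule subsetI, rule ccontr)
      fix s assume s: "s \<in> rho z" and no: "s \<notin> \<Union> (rho ` X)"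
      have sq: "s \<in> sq" using s by (simp add: rho_def)
      \<comment> \<open>If \<open>s\<close> avoids every \<open>rho x\<close>, its type can be
        removed from \<open>z\<close> and an upper bound of \<open>X\<close> remains. The type of
        \<open>s\<close> is an element, so the difference is one too, and \<open>z\<close> is not
        least.\<close>
      let ?b = "\<lambda>t. z t \<inter> (At n - ({tp s t} \<inter> At n))"
      have bS: "?b \<in> SE n" by (rule SE_closed(2)[OF car(1)[OF zc] SE_closed(3)[OF tp_SE[OF sq]]])
      define w where "w = canon (SE n) ?b"
      have wc: "w \<in> canon (SE n) ` SE n" unfolding w_def using bS by blast
      have wb: "ev (\<lambda>t. ?b t = w t)" using sim_canon[OF bS] by (simp add: sim_def w_def)
      have absorb: "x \<oplus>\<^bsub>UB n\<^esub> w = w \<longleftrightarrow> ev (\<lambda>t. x t \<union> w t = w t)" if xc: "x \<in> canon (SE n) ` SE n" for x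
        using canon_eq_iff[OF SE_closed(1)[OF car(1)[OF xc] car(1)[OF wc]] car(1)[OF wc]] car(2)[OF wc]
        by (simp add: sim_def)
      have "x \<oplus>\<^bsub>UB n\<^esub> w = w" if x: "x \<in> X" for x
      proof -
        have xc: "x \<in> canon (SE n) ` SE n" using X x by auto
        have "x \<oplus>\<^bsub>UB n\<^esub> z = z" using z x unfolding is_sum_def by blast
        then have xz: "ev (\<lambda>t. x t \<union> z t = z t)"
          using canon_eq_iff[OF SE_closed(1)[OF car(1)[OF xc] car(1)[OF zc]] car(1)[OF zc]] car(2)[OF zc]
          by (simp add: sim_def)
        have nx: "ev (\<lambda>t. tp s t \<notin> x t)" using no x sq by (auto simp: rho_def ev_not)
        have "ev (\<lambda>t. x t \<union> w t = w t)"
        proof (rule ev_mono3[OF xz nx wb])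
          fix t assume h: "x t \<union> z t = z t" "tp s t \<notin> x t" "?b t = w t"
          have "x t \<subseteq> At n" using carrier_Alg_subset SE_carrier car(1)[OF xc] by blast
          then show "x t \<union> w t = w t" using h by blast
        qed
        then show ?thesis using absorb[OF xc] by blast
      qed
      moreover have "w \<in> carrier (UB n)" using wc by simp
      ultimately have "z \<oplus>\<^bsub>UB n\<^esub> w = w" using z unfolding is_sum_def by blast
      then have zw: "ev (\<lambda>t. z t \<union> w t = w t)" using absorb[OF zc] by blast
      have "ev (\<lambda>t. tp s t \<in> z t \<and> tp s t \<in> At n)" using s tp_At[OF sq] by (simp add: rho_def ev_conj)
      from zw wb this have "ev (\<lambda>t. False)" by (rule ev_mono3) blast
      then show False by simp
    qed
  qed
  show ?thesis unfolding complete_representation_def V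
    using hom sums injr by (auto simp: inj_on_def disjoint_def)
qed

end

section \<open>Two algebras that no theory separates in the required way\<close>

lemma countable_embedding:
  assumes "countable X" "infinite (UNIV :: 'a set)"
  obtains h :: "'x \<Rightarrow> 'a" where "inj_on h X"
proof -
  obtain f :: "nat \<Rightarrow> 'a" where "inj f" using infinite_countable_subset[OF assms(2)] by blast
  then have "inj_on (f \<circ> to_nat_on X) X"
    using inj_on_to_nat_on[OF assms(1)] by (intro comp_inj_on) (auto intro: inj_on_subset)
  then show thesis by (rule that)
qed

lemma sentence_iso:
  assumes A: "cyl_structure n A" and h: "h \<in> cyl_iso n A B" and p: "\<phi> \<in> sentences n"
    and e: "range e \<subseteq> carrier A"
  shows "satisfies B e' \<phi> \<longleftrightarrow> satisfies A e \<phi>"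
proof -
  have "satisfies B e' \<phi> = satisfies B (h \<circ> e) \<phi>" by (rule satisfies_cong) (use p in \<open>simp add: sentences_def\<close>)
  then show ?thesis using satisfies_iso[OF A h e, of \<phi>] p by (simp add: sentences_def)
qed

text \<open>\<open>A\<close> is a copy of \<open>Alg n\<close> and \<open>B\<close> one of
  \<open>UB n\<close>; both originals are countable. A sentence true in \<open>UB n\<close> is true
  in \<open>Alg n\<close> at almost every index, and its truth there does not depend on the
  index.\<close>

lemma witnesses:
  assumes n: "2 < n" and "infinite (UNIV :: 'a set)" "infinite (UNIV :: 'u set)"
  obtains A B :: "'a cyl_alg" and h where "B \<in> CRA n TYPE('u)" "h \<in> cyl_iso n (Alg n) A"
    "\<forall>T. T \<subseteq> sentences n \<longrightarrow> B \<in> Mod n T \<longrightarrow> A \<in> Mod n T"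
proof -
  obtain ev where "ultra ev" using ex_ultra by blast
  then interpret ultra ev .
  interpret M: free_model n "star n" "KK n" "LL n" "phi n" "yy n" by (rule star_model[OF n])
  have "countable {u. M.valid u}"
    by (rule M.countable_valid) (simp_all add: KK_def LL_def countable_S)
  then obtain \<iota> :: "_ \<Rightarrow> 'u" where \<iota>: "inj_on \<iota> {u. M.valid u}" using countable_embedding[OF _ assms(3)] by blast
  interpret R: representation ev n \<iota> by unfold_locales (rule n, rule \<iota>)
  obtain h1 :: "_ \<Rightarrow> 'a" where h1: "inj_on h1 (carrier (Alg n))" using countable_embedding[OF countable_Alg assms(2)] by blast
  have "countable (carrier (UB n))" by (simp add: countable_S)
  then obtain h2 :: "_ \<Rightarrow> 'a" where h2: "inj_on h2 (carrier (UB n))" using countable_embedding[OF _ assms(2)] by blast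
  let ?A = "transport h1 (Alg n)" and ?B = "transport h2 (UB n)"
  note A = transport_iso[OF cyl_structure_Alg h1]
  note B = transport_iso[OF cyl_structure_UB h2]
  have "?B \<in> CRA n TYPE('u)"
    using CRA_intro[OF B(2) n complete_representation_iso[OF cyl_structure_UB B R.complete_rep]] .
  moreover have "?A \<in> Mod n T" if T: "T \<subseteq> sentences n" and mB: "?B \<in> Mod n T" for T
  proof -
    have "satisfies ?A e \<phi>" if \<phi>: "\<phi> \<in> T" and "range e \<subseteq> carrier ?A" for \<phi> e
    proof -
      have p: "\<phi> \<in> sentences n" using T \<phi> by blast
      \<comment> \<open>\<open>Mod\<close> quantifies over assignments, but a sentence ignores them;
        the constant zero assignment stands for all.\<close>
      let ?z = "\<lambda>v :: nat. canon (SE n) (\<lambda>t. {})"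
      have z: "range ?z \<subseteq> canon (SE n) ` SE n" using SE_closed(4) by auto
      then have z': "range ?z \<subseteq> carrier (UB n)" by simp
      have "range (h2 \<circ> ?z) \<subseteq> carrier ?B" using z' by (auto simp: transport_def Let_def)
      then have "satisfies ?B (h2 \<circ> ?z) \<phi>" using mB \<phi> unfolding Mod_def by blast
      then have "satisfies (UB n) ?z \<phi>" using sentence_iso[OF cyl_structure_UB B(1) p z'] by blast
      then have "ev (\<lambda>t. satisfies (Alg n) (\<lambda>v. ?z v t) \<phi>)" using satisfies_UB[OF z] by blast
      then obtain t where t: "satisfies (Alg n) (\<lambda>v. ?z v t) \<phi>" using ev_ex by blast
      have "range (\<lambda>v. ?z v t) \<subseteq> carrier (Alg n)" using SE_carrier[OF canon_in[OF SE_closed(4)]] by auto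
      then show ?thesis using sentence_iso[OF cyl_structure_Alg A(1) p] t by blast
    qed
    then show ?thesis using A(2) by (simp add: Mod_def)
  qed
  ultimately show thesis using A(1) by (intro that[of ?B h1 ?A]) blast+
qed

lemma not_dilates_Alg: "2 < n \<Longrightarrow> h \<in> cyl_iso n (Alg n) A \<Longrightarrow> \<not> dilates n A B g"
proof
  assume n: "2 < n" and h: "h \<in> cyl_iso n (Alg n) A" and "dilates n A B g"
  then have d: "dilates n (Alg n) B (g \<circ> h)" using dilates_iso[OF cyl_structure_Alg] by blast
  note d = d[unfolded dilates_def]
  note sums = d[THEN conjunct2, THEN conjunct2, THEN conjunct2, THEN conjunct2, rule_format]
  show False
  proof (rule no_dilation[OF n, of B "g \<circ> h"])
    show "cylindric_algebra (n + 3) B" using d by (rule conjunct1)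
    show "g \<circ> h \<in> cyl_hom n (Alg n) B" using d[THEN conjunct2] by (rule conjunct1)
    show "inj_on (g \<circ> h) (carrier (Alg n))" using d[THEN conjunct2, THEN conjunct2] by (rule conjunct1)
    show "cyl B i ((g \<circ> h) x) = (g \<circ> h) x" if "x \<in> carrier (Alg n)" "n \<le> i" "i < n + 3" for x i
      using d[THEN conjunct2, THEN conjunct2, THEN conjunct2, THEN conjunct1, rule_format, OF that] .
    show "is_sum B ((g \<circ> h) ` X) \<one>\<^bsub>B\<^esub>" if "X \<subseteq> carrier (Alg n)" "is_sum (Alg n) X (At n)" for X
    proof -
      have "is_sum (Alg n) X \<one>\<^bsub>Alg n\<^esub>" using that(2) unfolding Alg_simps(5) .
      from sums[OF that(1) this] show ?thesis .
    qed
  qed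
qed

theorem theorem5p2:
  fixes n :: nat
  assumes "n > 2"
    and "infinite (UNIV :: 'a set)"
    and "infinite (UNIV :: 'u set)"
  shows "(\<forall>K :: 'a cyl_alg set.
            CRA n TYPE('u) \<subseteq> K \<and> K \<subseteq> Sc n (NrCA n (n + 3) :: 'b cyl_alg set) \<longrightarrow>
            \<not> elementary n K) \<and>
         \<not> elementary n (CRA n TYPE('u) :: 'a cyl_alg set)"
proof -
  obtain A B :: "'a cyl_alg" and h where B: "B \<in> CRA n TYPE('u)" and h: "h \<in> cyl_iso n (Alg n) A"
    and AB: "\<forall>T. T \<subseteq> sentences n \<longrightarrow> B \<in> Mod n T \<longrightarrow> A \<in> Mod n T"
    by (rule witnesses[OF assms])
  have mem: "A \<in> K" if "elementary n K" "B \<in> K" for K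
  proof -
    obtain T where T: "T \<subseteq> sentences n" "K = Mod n T"
      using \<open>elementary n K\<close> unfolding elementary_def by (elim exE conjE)
    show ?thesis unfolding T(2) by (rule AB[rule_format, OF T(1)]) (use \<open>B \<in> K\<close> T(2) in simp)
  qed
  have "A \<notin> Sc n (NrCA n (n + 3) :: 'b cyl_alg set)"
  proof
    assume "A \<in> Sc n (NrCA n (n + 3) :: 'b cyl_alg set)"
    then obtain C :: "'b cyl_alg" and g where "dilates n A C g" using Sc_dilates by blast
    then show False using not_dilates_Alg[OF assms(1) h] by blast
  qed
  \<comment> \<open>Nothing relates \<open>'b\<close> to \<open>'u\<close>, so a dilation of an
    algebra represented over \<open>'u\<close> need not fit into \<open>'b\<close>. This membership
    is therefore refuted through its own dilation.\<close>
  moreover have "A \<notin> CRA n TYPE('u)"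
  proof
    assume "A \<in> CRA n TYPE('u)"
    then obtain C :: "(nat \<Rightarrow> 'u) set cyl_alg" and g where "dilates n A C g" using CRA_dilates assms(1) by blast
    then show False using not_dilates_Alg[OF assms(1) h] by blast
  qed
  ultimately show ?thesis using mem B by blast
qed

end
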